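(* Let $F(z,u)=G(uH(z))M(z)$ be a confluent critical extended composition scheme with $0<\lambda_H<1$, i.e. $0<\lambda_G<1$ and $\lambda_M=\lambda_G\lambda_H$ (standing assumptions as in the context), and let $X_n$ be the associated core size, $\mathbb P\{X_n=k\}=\frac{[z^nu^k]F(z,u)}{[z^n]F(z,1)}$. Put $$p=\frac{c_MG(\rho_G)}{c_MG(\rho_G)+\tau_Mc_G(-c_H/\rho_G)^{\lambda_G}},\qquad \kappa=\frac{\tau_H}{-c_H}.$$ Then $X_n$ is a convex combination of a Boltzmann distribution $\mathcal B_G(\rho_G)$ and an asymptotically continuous random variable $Z_n$: $$X_n\overset{d}{=}\mathrm{Be}(p)\cdot\mathcal B_G(\rho_G)+(1-\mathrm{Be}(p))\cdot Z_n,\qquad \frac{Z_n}{\kappa\cdot n^{\lambda_H}}\longrightarrow X\quad(n\to\infty),$$ the latter convergence holding in distribution and with convergence of all moments, where $X\sim\mathrm{ML}(\lambda_H,-\lambda_G\lambda_H)$ is two-parameter Mittag-Leffler distributed, and where the Bernoulli variable $\mathrm{Be}(p)$ of parameter $p$ is independent of $\mathcal B_G(\rho_G)$, $Z_n$, and $X$.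
   Context: Standing assumptions. $G(z)=\sum_n g_nz^n$, $H(z)$, $M(z)$ are power series with nonnegative coefficients, analytic at $0$, with $H(0)=0$ and $M\not\equiv0$, and with finite radii of convergence $\rho_G,\rho_H,\rho_M$. The scheme is critical: $H(\rho_H)=\rho_G$ and $\rho_M\ge\rho_H$; here $\rho_M=\rho_H$, since confluence requires $\lambda_M=\lambda_G\lambda_H$ to be finite ($\lambda_M$ is set to $+\infty$ when $\rho_M>\rho_H$). For $f\in\{G,H,M\}$: $z=\rho_f$ is the only singularity of $f$ on $|z|\le\rho_f$, $f$ is analytic in a domain $\{|z|<\rho_f+\varepsilon,\ |\arg(z-\rho_f)|>\theta\}$ for some $\varepsilon>0$, $0<\theta<\pi/2$, and there, as $z\to\rho_f$ (all three singular exponents $\lambda_f$ lying in $(0,1)$), $$f(z)=\tau_f+c_f(1-z/\rho_f)^{\lambda_f}(1+o(1)),\qquad c_f\neq0,\quad \tau_f=f(\rho_f).$$ Boltzmann distribution $\mathcal B_G(\rho_G)$ (also denoting a random variable with this law): $\mathbb P\{\mathcal B_G(\rho_G)=k\}=g_k\rho_G^k/G(\rho_G)$, $k\ge0$. For $\alpha\in(0,1)$, $\beta>-\alpha$, $\mathrm{ML}(\alpha,\beta)$ is the law on $(0,\infty)$ uniquely determined by the moments $\mathbb E(X^s)=\frac{\Gamma(s+\beta/\alpha+1)\Gamma(\beta+1)}{\Gamma(\alpha s+\beta+1)\Gamma(\beta/\alpha+1)}$. Convergence of all moments: the $s$-th moments converge to $\mathbb E(X^s)$ for every $s$.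
   Formalization: The equality in distribution is proved asymptotically (total variation distance tends to 0), since it fails for every finite n: X_n ≤ n while the Boltzmann law is unbounded and p > 0; convergence of X_n/(κ n^{λ_H}) to (1−Be(p))X in law and with all moments is added. *)

theory Defs
  imports "HOL-Probability.Probability"
begin

section \<open>Singular expansions\<close>

text \<open>
  The domain \<open>|z| < \<rho> + \<epsilon>\<close>, \<open>|arg (z - \<rho>)| > \<theta>\<close>. As \<open>Arg 0 = 0\<close>, the point \<open>\<rho>\<close> is excluded
  for \<open>\<theta> > 0\<close>. For \<open>\<theta> < pi / 2\<close> every other point of the disc \<open>|z| \<le> \<rho>\<close> belongs to it.
\<close>

definition delta_domain :: "real \<Rightarrow> real \<Rightarrow> real \<Rightarrow> complex set" where
  "delta_domain \<rho> \<epsilon> \<theta> = {z. cmod z < \<rho> + \<epsilon> \<and> \<theta> < \<bar>Arg (z - of_real \<rho>)\<bar>}"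

text \<open>
  \<open>f\<close> has the finite radius of convergence \<open>\<rho> > 0\<close>, the value \<open>\<tau> = f(\<rho>)\<close>, and its analytic
  continuation \<open>\<phi>\<close> satisfies
  \<open>\<phi>(z) = \<tau> + c (1 - z/\<rho>)\<^sup>\<lambda> (1 + o(1))\<close> as \<open>z \<rightarrow> \<rho>\<close> inside a domain as above. Holomorphy of \<open>\<phi>\<close>
  there contains the requirement that \<open>\<rho>\<close> is the only singularity on \<open>|z| \<le> \<rho>\<close>.
  The argument of \<open>1 - z/\<rho>\<close> stays away from \<open>\<plusminus>pi\<close>, so the principal branch of the power is meant.
\<close>

definition singular_expansion ::
  "real fps \<Rightarrow> real \<Rightarrow> real \<Rightarrow> real \<Rightarrow> real \<Rightarrow> bool" where
  "singular_expansion f \<rho> \<tau> c l \<longleftrightarrow>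
     0 < \<rho> \<and> fps_conv_radius f = ereal \<rho> \<and>
     (\<lambda>n. fps_nth f n * \<rho> ^ n) sums \<tau> \<and> c \<noteq> 0 \<and>
     (\<exists>\<epsilon> \<theta> \<phi>. 0 < \<epsilon> \<and> 0 < \<theta> \<and> \<theta> < pi / 2 \<and>
        \<phi> holomorphic_on delta_domain \<rho> \<epsilon> \<theta> \<and>
        (\<forall>z. cmod z < \<rho> \<longrightarrow> (\<lambda>n. of_real (fps_nth f n) * z ^ n) sums \<phi> z) \<and>
        ((\<lambda>z. (\<phi> z - of_real \<tau>) / (1 - z / of_real \<rho>) powr of_real l) \<longlongrightarrow> of_real c)
          (at (of_real \<rho>) within delta_domain \<rho> \<epsilon> \<theta>))"

section \<open>Extended composition schemes\<close>

text \<open>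
  \<open>F(z,u) = G(u H(z)) M(z)\<close> as a power series in \<open>u\<close> whose coefficients are power series in \<open>z\<close>:
  \<open>[z\<^sup>n u\<^sup>k] F(z,u) = fps_nth (fps_nth (ext_scheme G H M) k) n\<close>.
\<close>

definition ext_scheme :: "real fps \<Rightarrow> real fps \<Rightarrow> real fps \<Rightarrow> real fps fps" where
  "ext_scheme G H M =
     (Abs_fps (\<lambda>k. fps_const (fps_nth G k)) oo (fps_X * fps_const H)) * fps_const M"

text \<open>\<open>F(z,1)\<close>; the composition is the intended one when \<open>H(0) = 0\<close>.\<close>

definition ext_scheme_at_1 :: "real fps \<Rightarrow> real fps \<Rightarrow> real fps \<Rightarrow> real fps" where
  "ext_scheme_at_1 G H M = (G oo H) * M"

text \<open>
  The law of \<open>X\<^sub>n\<close>. It is meaningful only if \<open>[z\<^sup>n] F(z,1) \<noteq> 0\<close>; otherwise \<^const>\<open>embed_pmf\<close> yields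
  an unspecified law. See \<open>pmf_core_size\<close> below.
\<close>

definition core_size :: "real fps \<Rightarrow> real fps \<Rightarrow> real fps \<Rightarrow> nat \<Rightarrow> nat pmf" where
  "core_size G H M n =
     embed_pmf (\<lambda>k. fps_nth (fps_nth (ext_scheme G H M) k) n / fps_nth (ext_scheme_at_1 G H M) n)"

definition boltzmann :: "real fps \<Rightarrow> real \<Rightarrow> nat pmf" where
  "boltzmann G \<rho> = embed_pmf (\<lambda>k. fps_nth G k * \<rho> ^ k / (\<Sum>j. fps_nth G j * \<rho> ^ j))"

section \<open>Probability laws and convergence\<close>

definition is_mittag_leffler :: "real \<Rightarrow> real \<Rightarrow> real measure \<Rightarrow> bool" where
  "is_mittag_leffler \<alpha> \<beta> L \<longleftrightarrow>
     prob_space L \<and> sets L = sets borel \<and> measure L {0<..} = 1 \<and>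
     (\<forall>s::nat. has_bochner_integral L (\<lambda>x. x ^ s)
        (Gamma (real s + \<beta> / \<alpha> + 1) * Gamma (\<beta> + 1) /
         (Gamma (\<alpha> * real s + \<beta> + 1) * Gamma (\<beta> / \<alpha> + 1))))"

text \<open>The law of \<open>Be(p) * B + (1 - Be(p)) * Z\<close> with independent \<open>Be(p)\<close>, \<open>B\<close>, \<open>Z\<close>.\<close>

definition bernoulli_mixture :: "real \<Rightarrow> nat pmf \<Rightarrow> nat pmf \<Rightarrow> nat pmf" where
  "bernoulli_mixture p B Z =
     map_pmf (\<lambda>(e, b, z). of_bool e * b + (1 - of_bool e) * z)
       (pair_pmf (bernoulli_pmf p) (pair_pmf B Z))"

text \<open>The law of \<open>(1 - Be(p)) * X\<close> with \<open>X\<close> of law \<open>L\<close> independent of \<open>Be(p)\<close>.\<close>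

definition bernoulli_thinned :: "real \<Rightarrow> real measure \<Rightarrow> real measure" where
  "bernoulli_thinned p L =
     distr (measure_pmf (bernoulli_pmf p) \<Otimes>\<^sub>M L) borel (\<lambda>(e, x). (1 - of_bool e) * x)"

text \<open>
  The decomposition \<open>X\<^sub>n = Be(p) * B + (1 - Be(p)) * Z\<^sub>n\<close> with fixed \<open>p > 0\<close> and Boltzmann
  distributed \<open>B\<close> cannot be an exact equality of laws for finite \<open>n\<close>: \<open>X\<^sub>n \<le> n\<close>, while \<open>B\<close> is unbounded.
  It is an asymptotic one, measured in total variation. That distance does not see moments
  (\<open>B\<close> has infinite ones), so moments of \<open>X\<^sub>n\<close> have to be compared separately, with those
  of \<open>(1 - Be(p)) * X\<close>.
\<close>

definition total_variation :: "'a pmf \<Rightarrow> 'a pmf \<Rightarrow> real" where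
  "total_variation P Q = (SUP A. \<bar>measure_pmf.prob P A - measure_pmf.prob Q A\<bar>)"

definition converges_with_moments :: "(nat \<Rightarrow> real measure) \<Rightarrow> real measure \<Rightarrow> bool" where
  "converges_with_moments \<mu> L \<longleftrightarrow>
     weak_conv_m \<mu> L \<and>
     (\<forall>s::nat. (\<forall>\<^sub>F n in sequentially. integrable (\<mu> n) (\<lambda>x. x ^ s)) \<and>
        integrable L (\<lambda>x. x ^ s) \<and>
        (\<lambda>n. \<integral>x. x ^ s \<partial>\<mu> n) \<longlonglongrightarrow> (\<integral>x. x ^ s \<partial>L))"

definition rescaled :: "real \<Rightarrow> nat pmf \<Rightarrow> real measure" where
  "rescaled a P = distr (measure_pmf P) borel (\<lambda>k. real k / a)"

section \<open>The laws have the intended weights\<close>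

lemma ext_scheme_nth:
  "fps_nth (fps_nth (ext_scheme G H M) k) n = fps_nth G k * fps_nth (H ^ k * M) n"
proof -
  have "Abs_fps (\<lambda>k. fps_const (fps_nth G k)) oo (fps_X * fps_const H) =
      Abs_fps (\<lambda>k. H ^ k * fps_const (fps_nth G k))"
    by (subst mult.commute, subst fps_compose_linear) simp
  then show ?thesis
    by (simp add: ext_scheme_def mult.assoc mult.left_commute[of "H ^ k"])
qed

lemma fps_nth_power_nonneg:
  fixes H :: "real fps"
  assumes "\<And>i. 0 \<le> fps_nth H i"
  shows "0 \<le> fps_nth (H ^ k) n"
  using assms by (induction k arbitrary: n) (auto simp: fps_mult_nth intro!: sum_nonneg)

lemma fps_nth_power_mult_eq_0:
  fixes H M :: "real fps"
  assumes "fps_nth H 0 = 0" "n < k"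
  shows "fps_nth (H ^ k * M) n = 0"
  using assms startsby_zero_power_prefix[of H k] by (simp add: fps_mult_nth)

lemma ext_scheme_at_1_nth:
  assumes "fps_nth H 0 = 0"
  shows "fps_nth (ext_scheme_at_1 G H M) n =
    (\<Sum>k\<le>n. fps_nth (fps_nth (ext_scheme G H M) k) n)"
proof -
  have *: "fps_nth (G oo H) i = (\<Sum>k\<le>n. fps_nth G k * fps_nth (H ^ k) i)" if "i \<le> n" for i
    unfolding fps_compose_nth
    using assms that startsby_zero_power_prefix[of H]
    by (intro sum.mono_neutral_left) auto
  have "fps_nth (ext_scheme_at_1 G H M) n =
      (\<Sum>i=0..n. (\<Sum>k\<le>n. fps_nth G k * fps_nth (H ^ k) i) * fps_nth M (n - i))"
    unfolding ext_scheme_at_1_def fps_mult_nth by (intro sum.cong) (auto simp: *)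
  also have "\<dots> = (\<Sum>k\<le>n. fps_nth G k * fps_nth (H ^ k * M) n)"
    unfolding fps_mult_nth sum_distrib_left sum_distrib_right
    by (subst sum.swap) (simp add: mult.assoc)
  finally show ?thesis by (simp add: ext_scheme_nth)
qed

lemma pmf_core_size:
  assumes "\<And>i. 0 \<le> fps_nth G i" "\<And>i. 0 \<le> fps_nth H i" "\<And>i. 0 \<le> fps_nth M i"
    and "fps_nth H 0 = 0" "fps_nth (ext_scheme_at_1 G H M) n \<noteq> 0"
  shows "pmf (core_size G H M n) k =
    fps_nth (fps_nth (ext_scheme G H M) k) n / fps_nth (ext_scheme_at_1 G H M) n"
proof -
  let ?a = "\<lambda>k. fps_nth (fps_nth (ext_scheme G H M) k) n"
  let ?b = "fps_nth (ext_scheme_at_1 G H M) n"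
  have nn: "0 \<le> ?a k" for k
    using assms(1-3) fps_nth_power_nonneg[OF assms(2)]
    by (auto simp: ext_scheme_nth fps_mult_nth intro!: mult_nonneg_nonneg sum_nonneg)
  have b: "?b = (\<Sum>k\<le>n. ?a k)" using assms(4) by (rule ext_scheme_at_1_nth)
  then have b0: "0 < ?b" using assms(5) nn by (simp add: sum_nonneg order_less_le)
  have "(\<integral>\<^sup>+k. ennreal (?a k / ?b) \<partial>count_space UNIV) =
      (\<integral>\<^sup>+k. ennreal (?a k / ?b) \<partial>count_space {..n})"
    by (intro nn_integral_count_space_eq)
       (auto simp: ext_scheme_nth fps_nth_power_mult_eq_0[OF assms(4)])
  also have "\<dots> = (\<Sum>k\<le>n. ennreal (?a k / ?b))"
    by (simp add: nn_integral_count_space_finite)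
  also have "\<dots> = ennreal (\<Sum>k\<le>n. ?a k / ?b)"
    using nn b0 by (intro sum_ennreal) auto
  also have "\<dots> = 1"
    using b b0 by (simp add: sum_divide_distrib[symmetric])
  finally show ?thesis
    unfolding core_size_def using nn b0 by (intro pmf_embed_pmf) auto
qed

lemma pmf_boltzmann:
  assumes "\<And>i. 0 \<le> fps_nth G i" "0 \<le> \<rho>" "(\<lambda>k. fps_nth G k * \<rho> ^ k) sums \<tau>" "\<tau> \<noteq> 0"
  shows "pmf (boltzmann G \<rho>) k = fps_nth G k * \<rho> ^ k / \<tau>"
proof -
  have nn: "0 \<le> fps_nth G k * \<rho> ^ k" for k using assms(1,2) by simp
  have "0 \<le> \<tau>" using sums_le[OF _ sums_zero assms(3)] nn by blast
  then have pos: "0 < \<tau>" using assms(4) by simp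
  have eq: "(\<Sum>j. fps_nth G j * \<rho> ^ j) = \<tau>" using assms(3) by (rule sums_unique[symmetric])
  have "(\<lambda>k. fps_nth G k * \<rho> ^ k / \<tau>) sums (\<tau> / \<tau>)" using assms(3) by (rule sums_divide)
  then have "(\<Sum>k. ennreal (fps_nth G k * \<rho> ^ k / \<tau>)) = ennreal 1"
    using nn pos by (subst suminf_ennreal_eq[where x=1]) auto
  then show ?thesis
    unfolding boltzmann_def eq using nn pos
    by (intro pmf_embed_pmf) (auto simp: nn_integral_count_space_nat)
qed

end

theory Submission
  imports Defs "HOL-Complex_Analysis.Complex_Analysis"
begin

text \<open>
  Rescaling reduces the radii of convergence to \<open>1\<close>, and everything takes place in the open unit disc.
  A function \<open>f\<close> is of type \<open>(a, c)\<close> there if \<open>f(z) = c (1 - z)\<^sup>a (1 + o(1))\<close> as \<open>z \<rightarrow> 1\<close>, with the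
  global bound \<open>O(|1 - z|\<^sup>a)\<close>, and if its derivatives behave accordingly. By Cauchy's inequality this
  follows from the expansion in a domain with an opening angle. Unlike that domain, the
  notion is stable under products and under composition \<open>\<phi>(H(z))\<close> with \<open>H\<close> mapping the disc into
  itself. It gives the coefficient asymptotics by a Darboux argument: after subtracting
  \<open>c (1 - z)\<^sup>a\<close>, the third derivative is \<open>o(|1 - z|\<^sup>a\<^sup>-\<^sup>3)\<close>, and \<open>|1 - z|\<^sup>-\<^sup>2\<close> is integrated over the circle
  \<open>|z| = 1 - 1/n\<close> as a Poisson kernel.

  The \<open>s\<close>-th moment of the core size is a quotient of coefficients of \<open>(\<theta>\<^sup>sG)(H(z)) M(z)\<close> and of
  \<open>G(H(z)) M(z)\<close> with \<open>\<theta> = w d/dw\<close>, so the rescaled moments converge to \<open>1 - p\<close> times the Mittag-Leffler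
  moments (\<open>s \<ge> 1\<close>). These grow slowly enough to determine the law, and all weak convergences
  follow by the method of moments. For fixed \<open>k\<close> the probabilities tend to \<open>p\<close> times the Boltzmann
  weights; \<open>Z\<^sub>n\<close> is \<open>X\<^sub>n\<close> conditioned on \<open>X\<^sub>n > K\<^sub>n\<close> for a slowly growing \<open>K\<^sub>n\<close>.

  The Mittag-Leffler law itself is obtained as a limit of core sizes of schemes with \<open>M = 1\<close> (hence
  \<open>p = 0\<close>). That it has no atom at \<open>0\<close> follows from a bounded moment of negative order, which is compared with
  a scheme of larger exponent \<open>\<lambda>\<^sub>G\<close>.
\<close>

section \<open>Singular types on the unit disc\<close>

text \<open>After rescaling, \<open>G\<close>, \<open>H\<close> and \<open>M\<close> have the
  exponents \<open>a\<close>, \<open>l\<close> and \<open>l * a\<close>, and the mixture comes from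
  the identity \<open>G(H) M - \<tau>\<^sub>G \<tau>\<^sub>M = (G(H) - \<tau>\<^sub>G) M +
  \<tau>\<^sub>G (M - \<tau>\<^sub>M)\<close>. By confluence both terms on the right are of order
  \<open>(1 - z)^(l a)\<close>. Nonnegative coefficients make \<open>c\<^sub>G\<close>,
  \<open>c\<^sub>H\<close>, \<open>c\<^sub>M\<close> negative, so the terms cannot cancel, and their
  shares of the sum are \<open>1 - p\<close> and \<open>p\<close>. Fixed core sizes see the second
  term only: they are governed by \<open>H^k M\<close>, where the singularity of \<open>M\<close>
  dominates because \<open>l * a < l\<close>. Moments of order \<open>s \<ge> 1\<close> see the
  first term only: applying \<open>z d/dz\<close> to \<open>G\<close> at least once removes the
  constant \<open>\<tau>\<^sub>G\<close> and leaves the negative exponent \<open>a - s\<close>,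
  against which \<open>M\<close> counts through its value \<open>\<tau>\<^sub>M\<close> alone. The
  Boltzmann part lives on bounded core sizes and thus shows up in the rescaled limit merely as an
  atom at \<open>0\<close>.\<close>

lemma norm_powr_of_real:
  fixes z :: complex
  assumes "z \<noteq> 0"
  shows "cmod (z powr of_real a) = cmod z powr a"
  using assms by (simp add: powr_def norm_exp_eq_Re)

lemma Re_less_1_unit_disc: "z \<in> ball 0 1 \<Longrightarrow> Re z < 1"
  using complex_Re_le_cmod[of z] by simp

lemma one_minus_nonzero_unit_disc: "(z::complex) \<in> ball 0 1 \<Longrightarrow> 1 - z \<noteq> (0::complex)"
  by auto

lemma one_minus_not_nonpos_unit_disc:
  fixes z :: complex
  assumes "z \<in> ball 0 1"
  shows "1 - z \<notin> \<real>\<^sub>\<le>\<^sub>0"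
  using Re_less_1_unit_disc[OF assms] by (auto simp: complex_nonpos_Reals_iff)

lemma eventually_unit_disc: "eventually (\<lambda>z. z \<in> ball 0 1) (at (1::complex) within ball 0 1)"
  by (simp add: eventually_at_filter)

text \<open>The limit controls \<open>f\<close> near \<open>1\<close> only. The bound on the whole
  disc is what remains of analyticity at the other boundary points; it makes estimates uniform on
  circles approaching the unit circle. The value \<open>c = 0\<close> is allowed and turns the limit
  into a little-o statement.\<close>

definition sing_lim :: "real \<Rightarrow> real \<Rightarrow> (complex \<Rightarrow> complex) \<Rightarrow> bool" where
  "sing_lim a c f \<longleftrightarrow> f holomorphic_on ball 0 1 \<and>
     (\<exists>C. \<forall>z\<in>ball 0 1. cmod (f z) \<le> C * cmod (1 - z) powr a) \<and>
     ((\<lambda>z. f z / (1 - z) powr of_real a) \<longlongrightarrow> of_real c) (at 1 within ball 0 1)"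

lemma sing_limI:
  assumes "f holomorphic_on ball 0 1"
    and "\<And>z. z \<in> ball 0 1 \<Longrightarrow> cmod (f z) \<le> C * cmod (1 - z) powr a"
    and "((\<lambda>z. f z / (1 - z) powr of_real a) \<longlongrightarrow> of_real c) (at 1 within ball 0 1)"
  shows "sing_lim a c f"
  using assms unfolding sing_lim_def by blast

text \<open>The pair \<open>(a - 1, - a * c)\<close> belongs to the derivative of the model function
  \<open>c (1 - z)^a\<close>. For \<open>a = 0\<close> it carries the coefficient \<open>0\<close>,
  so that constants fit in.\<close>

primrec sing_type :: "nat \<Rightarrow> real \<Rightarrow> real \<Rightarrow> (complex \<Rightarrow> complex) \<Rightarrow> bool" where
  "sing_type 0 a c f \<longleftrightarrow> sing_lim a c f"
| "sing_type (Suc N) a c f \<longleftrightarrow> sing_lim a c f \<and> sing_type N (a - 1) (- a * c) (deriv f)"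

lemma sing_type_imp_sing_lim: "sing_type N a c f \<Longrightarrow> sing_lim a c f"
  by (cases N) auto

lemma sing_type_holomorphic: "sing_type N a c f \<Longrightarrow> f holomorphic_on ball 0 1"
  using sing_type_imp_sing_lim sing_lim_def by blast

lemma sing_type_pred: "sing_type (Suc N) a c f \<Longrightarrow> sing_type N a c f"
proof (induction N arbitrary: a c f)
  case (Suc N)
  have "sing_type N (a - 1) (- a * c) (deriv f)"
    using Suc.prems by (intro Suc.IH) simp
  then show ?case using Suc.prems by simp
qed simp

lemma sing_lim_cong:
  assumes "\<And>z. z \<in> ball 0 1 \<Longrightarrow> f z = g z"
  shows "sing_lim a c f \<longleftrightarrow> sing_lim a c g"
proof -
  have "((\<lambda>z. f z / (1 - z) powr of_real a) \<longlongrightarrow> of_real c) (at 1 within ball 0 1) \<longleftrightarrow>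
      ((\<lambda>z. g z / (1 - z) powr of_real a) \<longlongrightarrow> of_real c) (at 1 within ball 0 1)"
    by (intro filterlim_cong refl eventually_mono[OF eventually_unit_disc]) (simp only: assms)
  moreover have "f holomorphic_on ball 0 1 \<longleftrightarrow> g holomorphic_on ball 0 1"
    by (rule holomorphic_cong[OF refl assms])
  ultimately show ?thesis unfolding sing_lim_def using assms by auto
qed

lemma deriv_cong_unit_disc:
  assumes "\<And>z. z \<in> ball 0 1 \<Longrightarrow> f z = g z" "z \<in> ball 0 1"
  shows "deriv f z = (deriv g z :: complex)"
  using assms(2)
  by (intro deriv_cong_ev refl eventually_mono[OF eventually_nhds_in_open[of "ball 0 1"]])
     (auto simp: assms(1))

lemma sing_type_cong:
  assumes "\<And>z. z \<in> ball 0 1 \<Longrightarrow> f z = g z"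
  shows "sing_type N a c f \<longleftrightarrow> sing_type N a c g"
  using assms
proof (induction N arbitrary: a c f g)
  case 0
  show ?case unfolding sing_type.simps by (rule sing_lim_cong) (rule 0)
next
  case (Suc N)
  have "sing_lim a c f \<longleftrightarrow> sing_lim a c g"
    by (rule sing_lim_cong) (rule Suc.prems)
  moreover have "sing_type N (a - 1) (- a * c) (deriv f) \<longleftrightarrow> sing_type N (a - 1) (- a * c) (deriv g)"
    by (rule Suc.IH) (rule deriv_cong_unit_disc[OF Suc.prems])
  ultimately show ?case by simp
qed

lemma sing_type_zero: "sing_type N a 0 (\<lambda>_. 0)"
proof (induction N arbitrary: a)
  case 0
  show ?case by (auto simp: sing_lim_def intro!: exI[of _ 0])
next
  case (Suc N)
  have "sing_lim a 0 (\<lambda>_. 0)" by (auto simp: sing_lim_def intro!: exI[of _ 0])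
  then show ?case using Suc[of "a - 1"] by simp
qed

lemma sing_type_const: "sing_type N 0 c (\<lambda>_. of_real c)"
proof -
  have "sing_lim 0 c (\<lambda>_. of_real c)"
  proof (rule sing_limI)
    show "cmod (of_real c) \<le> \<bar>c\<bar> * cmod (1 - z) powr 0" if "z \<in> ball 0 1" for z
      using one_minus_nonzero_unit_disc[OF that] by simp
    show "((\<lambda>z. of_real c / (1 - z) powr of_real 0) \<longlongrightarrow> of_real c) (at (1::complex) within ball 0 1)"
      using one_minus_nonzero_unit_disc
      by (intro tendsto_eventually eventually_mono[OF eventually_unit_disc]) simp
  qed auto
  then show ?thesis
    using sing_type_zero by (cases N) auto
qed

lemma sing_lim_add:
  assumes "sing_lim a c f" "sing_lim a d g"
  shows "sing_lim a (c + d) (\<lambda>z. f z + g z)"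
proof -
  obtain C D where C: "\<forall>z\<in>ball 0 1. cmod (f z) \<le> C * cmod (1 - z) powr a"
    and D: "\<forall>z\<in>ball 0 1. cmod (g z) \<le> D * cmod (1 - z) powr a"
    using assms unfolding sing_lim_def by blast
  have "cmod (f z + g z) \<le> (C + D) * cmod (1 - z) powr a" if "z \<in> ball 0 1" for z
    using norm_triangle_ineq[of "f z" "g z"] bspec[OF C that] bspec[OF D that]
    by (simp add: algebra_simps)
  moreover have "((\<lambda>z. (f z + g z) / (1 - z) powr of_real a) \<longlongrightarrow> of_real (c + d)) (at 1 within ball 0 1)"
    using assms unfolding sing_lim_def add_divide_distrib of_real_add by (intro tendsto_add) auto
  moreover have "(\<lambda>z. f z + g z) holomorphic_on ball 0 1"
    using assms unfolding sing_lim_def by (intro holomorphic_intros) auto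
  ultimately show ?thesis
    by (intro sing_limI)
qed

lemma deriv_add_unit_disc:
  assumes "f holomorphic_on ball 0 1" "g holomorphic_on ball 0 1" "z \<in> ball 0 1"
  shows "deriv (\<lambda>z. f z + g z) z = deriv f z + deriv g z"
  using assms by (intro deriv_add) (auto intro: holomorphic_on_imp_differentiable_at)

lemma deriv_mult_unit_disc:
  assumes "f holomorphic_on ball 0 1" "g holomorphic_on ball 0 1" "z \<in> ball 0 1"
  shows "deriv (\<lambda>z. f z * g z) z = f z * deriv g z + deriv f z * g z"
  using assms by (intro deriv_mult) (auto intro: holomorphic_on_imp_differentiable_at)

lemma sing_type_add:
  assumes "sing_type N a c f" "sing_type N a d g"
  shows "sing_type N a (c + d) (\<lambda>z. f z + g z)"
  using assms
proof (induction N arbitrary: a c d f g)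
  case 0
  then show ?case using sing_lim_add by simp
next
  case (Suc N)
  have "sing_type N (a - 1) (- a * c + - a * d) (\<lambda>z. deriv f z + deriv g z)"
    using Suc.prems by (intro Suc.IH) auto
  moreover have "sing_type N (a - 1) (- a * c + - a * d) (\<lambda>z. deriv f z + deriv g z) \<longleftrightarrow>
      sing_type N (a - 1) (- a * (c + d)) (deriv (\<lambda>z. f z + g z))"
    using deriv_add_unit_disc[OF sing_type_holomorphic[OF Suc.prems(1)] sing_type_holomorphic[OF Suc.prems(2)]]
    by (subst sing_type_cong[of "\<lambda>z. deriv f z + deriv g z" "deriv (\<lambda>z. f z + g z)"])
       (auto simp: algebra_simps)
  ultimately show ?case using Suc.prems sing_lim_add by simp
qed

lemma sing_lim_mult:
  assumes "sing_lim a c f" "sing_lim b d g"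
  shows "sing_lim (a + b) (c * d) (\<lambda>z. f z * g z)"
proof -
  obtain C D where C: "\<forall>z\<in>ball 0 1. cmod (f z) \<le> C * cmod (1 - z) powr a"
    and D: "\<forall>z\<in>ball 0 1. cmod (g z) \<le> D * cmod (1 - z) powr b"
    using assms unfolding sing_lim_def by blast
  have "cmod (f z * g z) \<le> (C * D) * cmod (1 - z) powr (a + b)" if "z \<in> ball 0 1" for z
  proof -
    have "cmod (f z) * cmod (g z) \<le> (C * cmod (1 - z) powr a) * (D * cmod (1 - z) powr b)"
      using bspec[OF C that] bspec[OF D that] 
      by (intro mult_mono) (auto intro: order_trans[OF norm_ge_zero])
    then show ?thesis by (simp add: norm_mult powr_add mult_ac)
  qed
  moreover have "((\<lambda>z. (f z * g z) / (1 - z) powr of_real (a + b)) \<longlongrightarrow> of_real (c * d)) (at 1 within ball 0 1)"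
  proof -
    have "((\<lambda>z. (f z / (1 - z) powr of_real a) * (g z / (1 - z) powr of_real b)) \<longlongrightarrow> 
        of_real c * of_real d) (at 1 within ball 0 1)"
      using assms unfolding sing_lim_def by (intro tendsto_mult) auto
    then show ?thesis by (simp add: powr_add)
  qed
  moreover have "(\<lambda>z. f z * g z) holomorphic_on ball 0 1"
    using assms unfolding sing_lim_def by (intro holomorphic_intros) auto
  ultimately show ?thesis
    by (intro sing_limI)
qed

text \<open>Leibniz' rule: in each term of the derivative one factor is differentiated and the other
  one gives up one order by \<open>sing_type_pred\<close>. The coefficients add up to
  \<open>- (a + b) * (c * d)\<close>.\<close>

lemma sing_type_mult:
  assumes "sing_type N a c f" "sing_type N b d g"
  shows "sing_type N (a + b) (c * d) (\<lambda>z. f z * g z)"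
  using assms
proof (induction N arbitrary: a b c d f g)
  case 0
  then show ?case using sing_lim_mult by simp
next
  case (Suc N)
  have "sing_type N (a + (b - 1)) (c * (- b * d)) (\<lambda>z. f z * deriv g z)"
    by (rule Suc.IH) (use Suc.prems sing_type_pred[OF Suc.prems(1)] in auto)
  moreover have "sing_type N ((a - 1) + b) ((- a * c) * d) (\<lambda>z. deriv f z * g z)"
    by (rule Suc.IH) (use Suc.prems sing_type_pred[OF Suc.prems(2)] in auto)
  ultimately have "sing_type N (a + b - 1) (c * (- b * d) + (- a * c) * d)
      (\<lambda>z. f z * deriv g z + deriv f z * g z)"
    by (intro sing_type_add) (simp_all add: algebra_simps)
  also have "?this \<longleftrightarrow> sing_type N (a + b - 1) (c * (- b * d) + (- a * c) * d) (deriv (\<lambda>z. f z * g z))"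
    using deriv_mult_unit_disc[OF sing_type_holomorphic[OF Suc.prems(1)] sing_type_holomorphic[OF Suc.prems(2)]]
    by (intro sing_type_cong) auto
  finally show ?case using Suc.prems sing_lim_mult by (simp add: algebra_simps)
qed

lemma sing_type_cmult:
  assumes "sing_type N a c f"
  shows "sing_type N a (k * c) (\<lambda>z. of_real k * f z)"
  using sing_type_mult[OF sing_type_const assms] by simp

lemma sing_type_diff:
  assumes "sing_type N a c f" "sing_type N a d g"
  shows "sing_type N a (c - d) (\<lambda>z. f z - g z)"
  using sing_type_add[OF assms(1) sing_type_cmult[OF assms(2), of "- 1"]] by simp

lemma tendsto_norm_one_minus_powr:
  assumes "0 < e"
  shows "((\<lambda>z. cmod (1 - z) powr e) \<longlongrightarrow> 0) (at 1 within ball 0 1)"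
proof -
  have "((\<lambda>z::complex. cmod (1 - z)) \<longlongrightarrow> cmod (1 - 1)) (at 1 within ball 0 1)"
    by (intro tendsto_intros)
  then show ?thesis using assms
    by (intro tendsto_zero_powrI[where b=e]) auto
qed

text \<open>The factor \<open>|1 - z|^(a - b)\<close> tends to \<open>0\<close> at \<open>1\<close>
  and is at most \<open>2^(a - b)\<close> on the disc. Terms of higher exponent can thus be absorbed
  in sums, which are formed for equal exponents.\<close>

lemma sing_lim_weaken:
  assumes "sing_lim a c f" "b < a"
  shows "sing_lim b 0 f"
proof -
  obtain C where C: "\<forall>z\<in>ball 0 1. cmod (f z) \<le> C * cmod (1 - z) powr a"
    using assms unfolding sing_lim_def by blast
  have split: "cmod (1 - z) powr a = cmod (1 - z) powr (a - b) * cmod (1 - z) powr b" for z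
    by (simp add: powr_add[symmetric])
  have "cmod (f z) \<le> (\<bar>C\<bar> * 2 powr (a - b)) * cmod (1 - z) powr b" if "z \<in> ball 0 1" for z
  proof -
    have "cmod (1 - z) \<le> 2" using norm_triangle_ineq4[of 1 z] that by simp
    then have "cmod (1 - z) powr (a - b) \<le> 2 powr (a - b)" 
      using assms by (intro powr_mono2) auto
    then have "C * cmod (1 - z) powr (a - b) \<le> \<bar>C\<bar> * 2 powr (a - b)"
      by (intro mult_mono) auto
    then have "C * cmod (1 - z) powr (a - b) * cmod (1 - z) powr b \<le> \<bar>C\<bar> * 2 powr (a - b) * cmod (1 - z) powr b"
      by (intro mult_right_mono) auto
    then show ?thesis using bspec[OF C that] split[of z] by (simp add: mult.assoc)
  qed
  moreover have "((\<lambda>z. f z / (1 - z) powr of_real b) \<longlongrightarrow> of_real 0) (at 1 within ball 0 1)"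
  proof -
    have "((\<lambda>z. norm (f z / (1 - z) powr of_real a) * cmod (1 - z) powr (a - b)) \<longlongrightarrow> cmod (of_real c) * 0) (at 1 within ball 0 1)"
      using assms unfolding sing_lim_def
      by (intro tendsto_mult tendsto_norm tendsto_norm_one_minus_powr) auto
    then have "((\<lambda>z. norm (f z / (1 - z) powr of_real a) * cmod (1 - z) powr (a - b)) \<longlongrightarrow> 0) (at 1 within ball 0 1)"
      by simp
    then have "((\<lambda>z. cmod (f z / (1 - z) powr of_real b)) \<longlongrightarrow> 0) (at 1 within ball 0 1)"
      by (rule Lim_transform_eventually[OF _ eventually_mono[OF eventually_unit_disc]])
         (use one_minus_nonzero_unit_disc in \<open>simp add: norm_divide norm_powr_of_real powr_diff\<close>)
    then show ?thesis using tendsto_norm_zero_iff by auto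
  qed
  ultimately show ?thesis
    using assms unfolding sing_lim_def by blast
qed

lemma sing_type_weaken:
  assumes "sing_type N a c f" "b < a"
  shows "sing_type N b 0 f"
  using assms
proof (induction N arbitrary: a b c f)
  case 0
  then show ?case using sing_lim_weaken by simp
next
  case (Suc N)
  have "sing_type N (b - 1) 0 (deriv f)"
    using Suc.prems by (intro Suc.IH[of "a - 1"]) auto
  then show ?case using Suc.prems sing_lim_weaken by auto
qed

lemma sing_type_powr: "sing_type N a 1 (\<lambda>z. (1 - z) powr of_real a)"
proof (induction N arbitrary: a)
  case 0
  have bd: "cmod ((1 - z) powr complex_of_real a) \<le> 1 * cmod (1 - z) powr a" if "z \<in> ball 0 1" for z
    using one_minus_nonzero_unit_disc[OF that] by (simp add: norm_powr_of_real)
  have hol: "(\<lambda>z. (1 - z) powr complex_of_real a) holomorphic_on ball 0 1"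
    using one_minus_not_nonpos_unit_disc by (intro holomorphic_intros) blast
  have lim: "((\<lambda>z. (1 - z) powr complex_of_real a / (1 - z) powr of_real a) \<longlongrightarrow> of_real 1)
      (at 1 within ball 0 1)"
    using one_minus_nonzero_unit_disc
    by (intro tendsto_eventually eventually_mono[OF eventually_unit_disc]) auto
  show ?case using sing_limI[OF hol bd lim] by simp
next
  case (Suc N)
  have "((\<lambda>z. (1 - z) powr of_real a) has_field_derivative (of_real (- a) * (1 - z) powr (of_real (a - 1)))) (at z)"
    if "z \<in> ball 0 1" for z :: complex
    using one_minus_not_nonpos_unit_disc[OF that] by (auto intro!: derivative_eq_intros)
  then have d: "deriv (\<lambda>z. (1 - z) powr of_real a) z = of_real (- a) * (1 - z) powr (of_real (a - 1))"
    if "z \<in> ball 0 1" for z :: complex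
    using that DERIV_imp_deriv by blast
  have "sing_type N (a - 1) (- a * 1) (\<lambda>z. of_real (- a) * (1 - z) powr (of_real (a - 1)))"
    by (intro sing_type_cmult Suc)
  also have "?this \<longleftrightarrow> sing_type N (a - 1) (- a * 1) (deriv (\<lambda>z. (1 - z) powr of_real a))"
    using d by (intro sing_type_cong) simp
  finally show ?case using sing_type_imp_sing_lim[OF Suc] by simp
qed

text \<open>Writing \<open>z = 1 - (1 - z)\<close> exhibits the identity as a constant plus a term
  of exponent \<open>1\<close>, which is weakened to exponent \<open>0\<close>.\<close>

lemma sing_type_ident: "sing_type N 0 1 (\<lambda>z. z)"
proof -
  have "sing_type N 1 1 (\<lambda>z. 1 - z)"
    using sing_type_powr[of N 1] one_minus_nonzero_unit_disc
    by (subst sing_type_cong[where g = "\<lambda>z. (1 - z) powr of_real 1"]) (auto simp: powr_to_1)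
  then have "sing_type N 0 0 (\<lambda>z. 1 - z)" by (rule sing_type_weaken) simp
  from sing_type_diff[OF sing_type_const[of N 1] this] show ?thesis by simp
qed

lemma sing_type_power:
  assumes "sing_type N 0 c f"
  shows "sing_type N 0 (c ^ k) (\<lambda>z. f z ^ k)"
proof (induction k)
  case 0
  show ?case using sing_type_const[of N 1] by simp
next
  case (Suc k)
  then show ?case using sing_type_mult[OF assms Suc] by simp
qed

section \<open>Composition with a self-map of the disc\<close>

lemma powr_quotient_half_planes:
  fixes w v :: complex
  assumes "0 < Re w" "0 < Re v" "0 < \<alpha>" "\<alpha> \<le> 1"
  shows "w powr of_real a / v powr of_real (\<alpha> * a) = (w / v powr of_real \<alpha>) powr of_real a"
proof -
  have nz: "w \<noteq> 0" "v \<noteq> 0" using assms by auto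
  \<comment> \<open>Both arguments are below \<open>pi / 2\<close> in absolute value, and
    \<open>\<alpha> \<le> 1\<close> does not enlarge that of \<open>v\<close>. The argument of the
    quotient stays within \<open>pi\<close>, so no branch of the logarithm is crossed.\<close>
  have 1: "\<bar>Im (Ln w)\<bar> < pi / 2" "\<bar>Im (Ln v)\<bar> < pi / 2"
    using assms nz Re_Ln_pos_lt by blast+
  have "\<bar>\<alpha> * Im (Ln v)\<bar> \<le> \<bar>Im (Ln v)\<bar>" 
    using assms by (simp add: abs_mult mult_left_le_one_le)
  then have 2: "- pi < Im (Ln w - of_real \<alpha> * Ln v)" "Im (Ln w - of_real \<alpha> * Ln v) \<le> pi"
    using 1 by auto
  have "Ln (exp (Ln w - of_real \<alpha> * Ln v)) = Ln w - of_real \<alpha> * Ln v"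
    using 2 by (rule Ln_exp)
  moreover have "exp (Ln w - of_real \<alpha> * Ln v) = w / v powr of_real \<alpha>"
    using nz by (simp add: powr_def exp_diff)
  ultimately have "Ln (w / v powr of_real \<alpha>) = Ln w - of_real \<alpha> * Ln v" by simp
  moreover have "w / v powr of_real \<alpha> \<noteq> 0" using nz by simp
  ultimately have "(w / v powr of_real \<alpha>) powr of_real a = exp (of_real a * (Ln w - of_real \<alpha> * Ln v))"
    unfolding powr_def by simp
  then show ?thesis using nz by (simp add: powr_def exp_diff[symmetric] right_diff_distrib mult_ac)
qed

text \<open>For \<open>a \<ge> 0\<close> the bound on \<open>|1 - H|^a\<close> needs the upper
  estimate of \<open>|1 - H|\<close>; for \<open>a < 0\<close>, which arises after differentiation,
  it needs the lower estimate with \<open>m\<close>. The constant \<open>B powr a + m powr a\<close>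
  serves both cases. For the limit, the quotient is split at
  \<open>(1 - H z) powr a\<close>.\<close>

lemma sing_lim_compose:
  assumes \<phi>: "sing_lim a c \<phi>" and holH: "H holomorphic_on ball 0 1"
    and maps: "\<And>z. z \<in> ball 0 1 \<Longrightarrow> H z \<in> ball 0 1"
    and H: "sing_lim \<alpha> b (\<lambda>z. 1 - H z)" and \<alpha>: "0 < \<alpha>" "\<alpha> \<le> 1" and b: "0 < b"
    and m: "0 < m" "\<And>z. z \<in> ball 0 1 \<Longrightarrow> m * cmod (1 - z) powr \<alpha> \<le> cmod (1 - H z)"
  shows "sing_lim (\<alpha> * a) (c * b powr a) (\<lambda>z. \<phi> (H z))"
proof -
  have nz: "1 - H z \<noteq> 0" if "z \<in> ball 0 1" for z
    using one_minus_nonzero_unit_disc[OF maps[OF that]] .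
  have hol: "(\<lambda>z. \<phi> (H z)) holomorphic_on ball 0 1"
    using holomorphic_on_compose_gen[OF holH, of \<phi> "ball 0 1"] \<phi> maps
    unfolding sing_lim_def o_def by blast
  obtain C where C: "\<forall>z\<in>ball 0 1. cmod (\<phi> z) \<le> C * cmod (1 - z) powr a"
    using \<phi> unfolding sing_lim_def by blast
  obtain B where B: "\<forall>z\<in>ball 0 1. cmod (1 - H z) \<le> B * cmod (1 - z) powr \<alpha>"
    using H unfolding sing_lim_def by blast
  have B0: "0 < B" using bspec[OF B, of 0] nz[of 0] norm_ge_zero[of "1 - H 0"]
    by (auto simp del: norm_ge_zero simp: less_le)
  have comp: "cmod (1 - H z) powr a \<le> (B powr a + m powr a) * cmod (1 - z) powr (\<alpha> * a)"
    if z: "z \<in> ball 0 1" for z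
  proof (cases "0 \<le> a")
    case True
    have "cmod (1 - H z) powr a \<le> (B * cmod (1 - z) powr \<alpha>) powr a"
      using bspec[OF B z] True by (intro powr_mono2) auto
    also have "\<dots> = B powr a * cmod (1 - z) powr (\<alpha> * a)"
      using B0 by (simp add: powr_mult powr_powr)
    finally show ?thesis by (simp add: distrib_right add_increasing2)
  next
    case False
    have "cmod (1 - H z) powr a \<le> (m * cmod (1 - z) powr \<alpha>) powr a"
      using m(2)[OF z] m(1) False one_minus_nonzero_unit_disc[OF z] nz[OF z]
      by (intro powr_mono2') auto
    also have "\<dots> = m powr a * cmod (1 - z) powr (\<alpha> * a)"
      using m(1) by (simp add: powr_mult powr_powr)
    finally show ?thesis by (simp add: distrib_right add_increasing)
  qed
  have "cmod (\<phi> (H z)) \<le> (\<bar>C\<bar> * (B powr a + m powr a)) * cmod (1 - z) powr (\<alpha> * a)"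
    if z: "z \<in> ball 0 1" for z
  proof -
    have "cmod (\<phi> (H z)) \<le> C * cmod (1 - H z) powr a"
      using C maps[OF z] by blast
    also have "\<dots> \<le> \<bar>C\<bar> * ((B powr a + m powr a) * cmod (1 - z) powr (\<alpha> * a))"
      using comp[OF z] by (intro mult_mono) auto
    finally show ?thesis by (simp add: mult.assoc)
  qed
  moreover have "((\<lambda>z. \<phi> (H z) / (1 - z) powr of_real (\<alpha> * a)) \<longlongrightarrow> of_real (c * b powr a)) (at 1 within ball 0 1)"
  proof -
    have limK: "((\<lambda>z. (1 - H z) / (1 - z) powr of_real \<alpha>) \<longlongrightarrow> of_real b) (at 1 within ball 0 1)"
      using H unfolding sing_lim_def by blast
    have "sing_lim 0 0 (\<lambda>z. 1 - H z)" using sing_lim_weaken[OF H] \<alpha> by blast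
    then have "((\<lambda>z. (1 - H z) / (1 - z) powr of_real 0) \<longlongrightarrow> 0) (at 1 within ball 0 1)"
      unfolding sing_lim_def by simp
    then have "((\<lambda>z. 1 - H z) \<longlongrightarrow> 0) (at 1 within ball 0 1)"
      by (rule Lim_transform_eventually[OF _ eventually_mono[OF eventually_unit_disc]])
         (use one_minus_nonzero_unit_disc in auto)
    from tendsto_diff[OF tendsto_const[of 1] this]
    have "((\<lambda>z. H z) \<longlongrightarrow> 1) (at 1 within ball 0 1)" by simp
    then have "filterlim H (at 1 within ball 0 1) (at 1 within ball 0 1)"
      unfolding filterlim_at using maps nz
      by (auto intro!: eventually_mono[OF eventually_unit_disc])
    moreover have "((\<lambda>z. \<phi> z / (1 - z) powr of_real a) \<longlongrightarrow> of_real c) (at 1 within ball 0 1)"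
      using \<phi> unfolding sing_lim_def by blast
    ultimately have 1: "((\<lambda>z. \<phi> (H z) / (1 - H z) powr of_real a) \<longlongrightarrow> of_real c) (at 1 within ball 0 1)"
      by (rule filterlim_compose[rotated])
    have 2: "((\<lambda>z. ((1 - H z) / (1 - z) powr of_real \<alpha>) powr of_real a) \<longlongrightarrow> (of_real b) powr of_real a) (at 1 within ball 0 1)"
      using b by (intro tendsto_powr_complex limK tendsto_const) auto
    have "((\<lambda>z. \<phi> (H z) / (1 - H z) powr of_real a * ((1 - H z) / (1 - z) powr of_real \<alpha>) powr of_real a)
       \<longlongrightarrow> of_real c * (of_real b) powr of_real a) (at 1 within ball 0 1)"
      by (intro tendsto_mult 1 2)
    also have "of_real c * (of_real b :: complex) powr of_real a = of_real (c * b powr a)"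
      using b by (simp add: powr_of_real)
    finally show ?thesis
    proof (rule Lim_transform_eventually[OF _ eventually_mono[OF eventually_unit_disc]])
      fix z :: complex assume z: "z \<in> ball 0 1"
      have "0 < Re (1 - H z)" "0 < Re (1 - z)"
        using Re_less_1_unit_disc[OF maps[OF z]] Re_less_1_unit_disc[OF z] by auto
      from powr_quotient_half_planes[OF this \<alpha>, of a, symmetric] nz[OF z]
      show "\<phi> (H z) / (1 - H z) powr of_real a * ((1 - H z) / (1 - z) powr of_real \<alpha>) powr of_real a = 
         \<phi> (H z) / (1 - z) powr of_real (\<alpha> * a)" by simp
    qed
  qed
  ultimately show ?thesis using hol unfolding sing_lim_def by blast
qed

text \<open>Chain rule: the induction hypothesis is applied to \<open>deriv \<phi>\<close> with
  exponent \<open>a - 1\<close>, and the factor \<open>deriv H\<close> contributes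
  \<open>\<alpha> - 1\<close>, which together give \<open>\<alpha> * a - 1\<close>.\<close>

lemma sing_type_compose:
  assumes \<phi>: "sing_type N a c \<phi>" and holH: "H holomorphic_on ball 0 1"
    and maps: "\<And>z. z \<in> ball 0 1 \<Longrightarrow> H z \<in> ball 0 1"
    and H: "sing_type N \<alpha> b (\<lambda>z. 1 - H z)" and \<alpha>: "0 < \<alpha>" "\<alpha> \<le> 1" and b: "0 < b"
    and m: "0 < m" "\<And>z. z \<in> ball 0 1 \<Longrightarrow> m * cmod (1 - z) powr \<alpha> \<le> cmod (1 - H z)"
  shows "sing_type N (\<alpha> * a) (c * b powr a) (\<lambda>z. \<phi> (H z))"
  using \<phi> H
proof (induction N arbitrary: a c \<phi>)
  case 0
  then show ?case using sing_lim_compose[OF _ holH maps _ \<alpha> b m] by simp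
next
  case (Suc N)
  have hol\<phi>: "\<phi> holomorphic_on ball 0 1" using Suc.prems sing_type_holomorphic by blast
  have dH: "deriv (\<lambda>z. 1 - H z) z = - deriv H z" if "z \<in> ball 0 1" for z
  proof -
    have "H field_differentiable at z" 
      using holH that holomorphic_on_imp_differentiable_at by blast
    then have "((\<lambda>z. 1 - H z) has_field_derivative 0 - deriv H z) (at z)"
      by (intro derivative_intros field_differentiable_derivI)
    then show ?thesis using DERIV_imp_deriv by fastforce
  qed
  have "sing_type N (\<alpha> * (a - 1)) (- a * c * b powr (a - 1)) (\<lambda>z. deriv \<phi> (H z))"
    by (rule Suc.IH) (use Suc.prems sing_type_pred[OF Suc.prems(2)] in auto)
  moreover have "sing_type N (\<alpha> - 1) (\<alpha> * b) (deriv H)"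
  proof -
    have "sing_type N (\<alpha> - 1) (- \<alpha> * b) (deriv (\<lambda>z. 1 - H z))" using Suc.prems by simp
    from sing_type_cmult[OF this, of "-1"] show ?thesis
      using dH by (subst sing_type_cong[where g = "\<lambda>z. of_real (-1) * deriv (\<lambda>z. 1 - H z) z"]) auto
  qed
  ultimately have "sing_type N (\<alpha> * (a - 1) + (\<alpha> - 1)) (- a * c * b powr (a - 1) * (\<alpha> * b)) (\<lambda>z. deriv \<phi> (H z) * deriv H z)"
    by (rule sing_type_mult)
  also have "\<alpha> * (a - 1) + (\<alpha> - 1) = \<alpha> * a - 1" by (simp add: algebra_simps)
  also have "- a * c * b powr (a - 1) * (\<alpha> * b) = - (\<alpha> * a) * (c * b powr a)"
    using b by (simp add: powr_diff)
  also have "sing_type N (\<alpha> * a - 1) (- (\<alpha> * a) * (c * b powr a)) (\<lambda>z. deriv \<phi> (H z) * deriv H z) \<longleftrightarrow>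
     sing_type N (\<alpha> * a - 1) (- (\<alpha> * a) * (c * b powr a)) (deriv (\<lambda>z. \<phi> (H z)))"
  proof (rule sing_type_cong)
    fix z :: complex assume z: "z \<in> ball 0 1"
    have "\<phi> field_differentiable at (H z)" "H field_differentiable at z"
      using hol\<phi> holH maps[OF z] z holomorphic_on_imp_differentiable_at by blast+
    then show "deriv \<phi> (H z) * deriv H z = deriv (\<lambda>z. \<phi> (H z)) z"
      using deriv_chain[of H z \<phi>] by (simp add: o_def)
  qed
  finally show ?case
    using sing_lim_compose[OF sing_type_imp_sing_lim[OF Suc.prems(1)] holH maps sing_type_imp_sing_lim[OF Suc.prems(2)] \<alpha> b m]
    by simp
qed

section \<open>Transfer to coefficients\<close>

text \<open>On the circle \<open>du = 2 pi i u dt\<close>, so that division by \<open>2 pi i\<close>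
  leaves the factor \<open>u\<close> and an ordinary integral over the unit interval.\<close>

lemma has_contour_integral_circlepath_0_imp_has_integral:
  assumes "(f has_contour_integral (2 * of_real pi * \<i> * I)) (circlepath 0 r)"
  shows "((\<lambda>t. f (circlepath 0 r t) * circlepath 0 r t) has_integral I) {0..1}"
proof -
  have "((\<lambda>t. 1 / (2 * of_real pi * \<i>) *
        (f (circlepath 0 r t) * vector_derivative (circlepath 0 r) (at t within {0..1})))
      has_integral (1 / (2 * of_real pi * \<i>) * (2 * of_real pi * \<i> * I))) {0..1}"
    using assms unfolding has_contour_integral_def by (rule has_integral_mult_right)
  moreover have "1 / (2 * of_real pi * \<i>) *
        (f (circlepath 0 r t) * vector_derivative (circlepath 0 r) (at t within {0..1})) =
      f (circlepath 0 r t) * circlepath 0 r t" if "t \<in> {0..1}" for t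
    using that by (subst vector_derivative_circlepath01) (simp_all add: circlepath mult.left_commute[of _ \<i>])
  ultimately show ?thesis
    by (subst has_integral_cong[symmetric]) simp_all
qed

lemma cmod_circlepath_0: "0 \<le> r \<Longrightarrow> cmod (circlepath 0 r t) = r"
  by (simp add: circlepath norm_mult)

lemma cnj_circlepath_0:
  assumes "0 < r"
  shows "of_real (r^2) / circlepath 0 r t = cnj (circlepath 0 r t)"
  using complex_norm_square[of "circlepath 0 r t"] cmod_circlepath_0[of r t] assms
  by (auto simp: field_simps)

text \<open>The value of the Poisson integral, by Cauchy's formula: on the circle \<open>|u| = r\<close> the conjugate
  of \<open>u\<close> is \<open>r\<^sup>2/u\<close>.\<close>

lemma poisson_integral:
  assumes r: "0 < r" "r < 1"
  shows "((\<lambda>t. 1 / (cmod (1 - circlepath 0 r t))\<^sup>2) has_integral (1 / (1 - r\<^sup>2))) {0..1}"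
proof -
  let ?g = "circlepath 0 r"
  have r2: "r\<^sup>2 < r" using r by (simp add: power2_eq_square)
  have hol: "(\<lambda>u. 1 / (1 - u)) holomorphic_on cball 0 r"
    using r by (intro holomorphic_intros) auto
  \<comment> \<open>On the circle \<open>u |1 - u|^2 = (1 - u)(u - r^2)\<close>; the only pole
    inside is \<open>r^2\<close>, since \<open>r^2 < r < 1\<close>.\<close>
  have "((\<lambda>u. (1 / (1 - u)) / (u - of_real (r\<^sup>2))) has_contour_integral 
      (2 * of_real pi * \<i> * (1 / (1 - of_real (r\<^sup>2))))) (circlepath 0 r)"
    using r2 by (intro Cauchy_integral_circlepath_simple hol) (simp add: norm_power del: of_real_power)
  then have "((\<lambda>t. (1 / (1 - ?g t)) / (?g t - of_real (r\<^sup>2)) * ?g t) has_integral (1 / (1 - of_real (r\<^sup>2)))) {0..1}"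
    by (rule has_contour_integral_circlepath_0_imp_has_integral)
  also have "(\<lambda>t. (1 / (1 - ?g t)) / (?g t - of_real (r\<^sup>2)) * ?g t) = (\<lambda>t. of_real (1 / (cmod (1 - ?g t))\<^sup>2))"
  proof
    fix t
    have nz: "?g t \<noteq> 0" using cmod_circlepath_0[of r t] r by auto
    have "?g t - of_real (r\<^sup>2) = ?g t * (1 - of_real (r^2) / ?g t)" using nz by (simp add: field_simps)
    also have "\<dots> = ?g t * cnj (1 - ?g t)" using cnj_circlepath_0[OF r(1), of t] by simp
    finally have eq: "?g t - of_real (r\<^sup>2) = ?g t * cnj (1 - ?g t)" .
    have "of_real (1 / (cmod (1 - ?g t))\<^sup>2) = 1 / ((1 - ?g t) * cnj (1 - ?g t))"
      unfolding complex_norm_square[symmetric] by simp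
    then show "(1 / (1 - ?g t)) / (?g t - of_real (r\<^sup>2)) * ?g t = of_real (1 / (cmod (1 - ?g t))\<^sup>2)"
      unfolding eq using nz by simp
  qed
  also have "(1 / (1 - of_real (r\<^sup>2))) = complex_of_real (1 / (1 - r\<^sup>2))" by simp
  finally have "((\<lambda>t. Re (of_real (1 / (cmod (1 - ?g t))\<^sup>2))) has_integral Re (of_real (1 / (1 - r\<^sup>2)))) {0..1}"
    by (rule has_integral_Re)
  then show ?thesis by (simp only: Re_complex_of_real)
qed

text \<open>Cauchy's formula on the circle. A pointwise maximum of \<open>1/|1 - z|^2\<close> would
  cost \<open>1/(1 - r)^2\<close>, whereas its mean over the circle costs only
  \<open>1/(1 - r^2)\<close>.\<close>

lemma fps_coeff_bound:
  assumes hol: "f holomorphic_on ball 0 1" and F: "f has_fps_expansion F" and r: "0 < r" "r < 1"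
    and bound: "\<And>z. cmod z = r \<Longrightarrow> cmod (f z) \<le> A / (cmod (1 - z))\<^sup>2 + B"
  shows "cmod (fps_nth F n) * r ^ n \<le> A / (1 - r\<^sup>2) + B"
proof -
  let ?g = "circlepath 0 r"
  have sub: "cball 0 r \<subseteq> ball (0::complex) 1" using r by auto
  have "((\<lambda>u. f u / (u - 0) ^ Suc n) has_contour_integral ((2 * pi * \<i>) / (fact n) * (deriv ^^ n) f 0)) (circlepath 0 r)"
    using hol sub r
    by (intro Cauchy_has_contour_integral_higher_derivative_circlepath holomorphic_on_imp_continuous_on)
       (auto intro: holomorphic_on_subset)
  then have "((\<lambda>u. f u / (u - 0) ^ Suc n) has_contour_integral (2 * of_real pi * \<i> * fps_nth F n)) (circlepath 0 r)"
    by (simp add: fps_nth_fps_expansion[OF F])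
  then have "((\<lambda>t. f (?g t) / (?g t - 0) ^ Suc n * ?g t) has_integral (fps_nth F n)) {0..1}"
    by (rule has_contour_integral_circlepath_0_imp_has_integral)
  moreover have "f (?g t) / (?g t - 0) ^ Suc n * ?g t = f (?g t) / ?g t ^ n" for t
    using cmod_circlepath_0[of r t] r by (auto simp: field_simps)
  ultimately have 1: "((\<lambda>t. f (?g t) / ?g t ^ n) has_integral (fps_nth F n)) {0..1}" by simp
  have 2: "((\<lambda>t. (A * (1 / (cmod (1 - ?g t))\<^sup>2) + B) / r ^ n) has_integral ((A * (1 / (1 - r\<^sup>2)) + B) / r ^ n)) {0..1}"
    using has_integral_const_real[of B 0 1]
    by (intro has_integral_divide has_integral_add has_integral_mult_right poisson_integral r) auto
  have "norm (integral {0..1} (\<lambda>t. f (?g t) / ?g t ^ n)) \<le> integral {0..1} (\<lambda>t. (A * (1 / (cmod (1 - ?g t))\<^sup>2) + B) / r ^ n)"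
  proof (rule integral_norm_bound_integral)
    show "norm (f (?g t) / ?g t ^ n) \<le> (A * (1 / (cmod (1 - ?g t))\<^sup>2) + B) / r ^ n" for t
      using bound[of "?g t"] cmod_circlepath_0[of r t] r
      by (simp add: norm_divide norm_power divide_right_mono)
  qed (use 1 2 in blast)+
  then have "cmod (fps_nth F n) \<le> (A / (1 - r\<^sup>2) + B) / r ^ n"
    unfolding integral_unique[OF 1] integral_unique[OF 2] by simp
  then show ?thesis using r by (simp add: field_simps)
qed

text \<open>Near \<open>1\<close> the limit supplies the small factor. At distance at least
  \<open>d\<close> from \<open>1\<close> the global bound is a constant, because
  \<open>|1 - z|^a \<le> d^a\<close> for \<open>a \<le> 0\<close>.\<close>

lemma sing_lim_0_bound:
  assumes "sing_lim a 0 g" "0 < \<epsilon>" "a \<le> 0"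
  obtains B where "\<And>z. z \<in> ball 0 1 \<Longrightarrow> cmod (g z) \<le> \<epsilon> * cmod (1 - z) powr a + B"
proof -
  obtain C where C: "\<forall>z\<in>ball 0 1. cmod (g z) \<le> C * cmod (1 - z) powr a"
    using assms unfolding sing_lim_def by blast
  have "((\<lambda>z. g z / (1 - z) powr of_real a) \<longlongrightarrow> 0) (at 1 within ball 0 1)"
    using assms unfolding sing_lim_def by simp
  then obtain d where d: "0 < d" 
    "\<And>z. z \<in> ball 0 1 \<Longrightarrow> z \<noteq> 1 \<Longrightarrow> dist z 1 < d \<Longrightarrow> dist (g z / (1 - z) powr of_real a) 0 < \<epsilon>"
    using assms(2) unfolding tendsto_iff eventually_at by metis
  show ?thesis
  proof (rule that[of "\<bar>C\<bar> * d powr a"])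
    fix z :: complex assume z: "z \<in> ball 0 1"
    show "cmod (g z) \<le> \<epsilon> * cmod (1 - z) powr a + \<bar>C\<bar> * d powr a"
    proof (cases "dist z 1 < d")
      case True
      have "cmod (g z) / cmod (1 - z) powr a < \<epsilon>"
        using d(2)[OF z _ True] one_minus_nonzero_unit_disc[OF z]
        by (auto simp: norm_divide norm_powr_of_real)
      then have "cmod (g z) \<le> \<epsilon> * cmod (1 - z) powr a"
        using one_minus_nonzero_unit_disc[OF z] by (simp add: divide_less_eq)
      then show ?thesis by (simp add: add_increasing2)
    next
      case False
      have "cmod (g z) \<le> \<bar>C\<bar> * cmod (1 - z) powr a"
        using bspec[OF C z] by (rule order_trans) (intro mult_right_mono, auto)
      also have "\<dots> \<le> \<bar>C\<bar> * d powr a"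
        using False d(1) assms(3)
        by (intro mult_left_mono powr_mono2') (auto simp: dist_norm norm_minus_commute)
      finally show ?thesis using assms(2) by (simp add: add_increasing)
    qed
  qed
qed

text \<open>The limit is \<open>1/e\<close>, and \<open>e \<le> 3\<close> leaves room for
  \<open>1/4\<close>.\<close>

lemma eventually_quarter_le_power: "eventually (\<lambda>n. 1 / 4 \<le> (1 - 1 / real n) ^ n) sequentially"
proof -
  have "(\<lambda>n. (1 + (-1) / real n) ^ n) \<longlonglongrightarrow> exp (-1)"
    by (rule tendsto_exp_limit_sequentially)
  moreover have "1 / 4 < exp (-1::real)"
    using exp_le by (simp add: exp_minus field_simps)
  ultimately have "eventually (\<lambda>n. 1 / 4 < (1 + (-1) / real n) ^ n) sequentially"
    by (rule order_tendstoD(1))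
  then show ?thesis by (rule eventually_mono) simp
qed

text \<open>Why three derivatives: the exponent is split as \<open>a - 3 = (a - 1) - 2\<close>. As
  \<open>a - 1 < 0\<close>, the first factor is largest at distance \<open>1 - r\<close> from
  \<open>1\<close>; the second is the Poisson kernel. Two derivatives would leave the positive
  exponent \<open>a\<close> when \<open>0 < a < 1\<close>, from which nothing is gained. With
  \<open>1 - r = 1/N\<close> the third derivative has coefficients \<open>o(N^(2 - a))\<close>, and
  the three factors of order \<open>N\<close> from differentiation bring this down to
  \<open>o(N^(- a - 1))\<close>.\<close>

lemma transfer_o:
  assumes f: "sing_type 3 a 0 f" and F: "f has_fps_expansion F" and a: "a < 1"
  shows "(\<lambda>n. cmod (fps_nth F n) * real n powr (a + 1)) \<longlonglongrightarrow> 0"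
proof -
  define g where "g = deriv (deriv (deriv f))"
  define G where "G = fps_deriv (fps_deriv (fps_deriv F))"
  have g: "sing_lim (a - 3) 0 g"
    using f by (simp add: numeral_3_eq_3 g_def)
  have hol: "g holomorphic_on ball 0 1" using g unfolding sing_lim_def by blast
  have G: "g has_fps_expansion G"
    unfolding g_def G_def by (intro has_fps_expansion_deriv F)
  have Gn: "fps_nth G n = of_nat ((n + 1) * (n + 2) * (n + 3)) * fps_nth F (n + 3)" for n
    by (simp add: G_def algebra_simps numeral_3_eq_3)
  show ?thesis
  proof (rule order_tendstoI)
    fix e :: real assume "e < 0"
    then show "eventually (\<lambda>n. e < cmod (fps_nth F n) * real n powr (a + 1)) sequentially"
      by (intro always_eventually allI) (auto intro: less_le_trans)
  next
    fix e :: real assume e: "0 < e"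
    \<comment> \<open>The final bound is \<open>36 * \<epsilon> = e / 2\<close> plus a null
      sequence. Here \<open>36 = 4 * 9\<close>, with \<open>4\<close> from
      \<open>r^n \<ge> 1/4\<close> and \<open>9\<close> from
      \<open>(n + 1)(n + 2)(n + 3) \<ge> N^3 / 9\<close> for \<open>N = n + 3\<close>.\<close>
    define \<epsilon> where "\<epsilon> = e / 72"
    have \<epsilon>: "0 < \<epsilon>" using e by (simp add: \<epsilon>_def)
    obtain B where B: "\<And>z. z \<in> ball 0 1 \<Longrightarrow> cmod (g z) \<le> \<epsilon> * cmod (1 - z) powr (a - 3) + B"
      using sing_lim_0_bound[OF g \<epsilon>] a by (metis diff_le_0_iff_le less_eq_real_def less_trans one_less_numeral_iff semiring_norm(77))
    have main: "cmod (fps_nth F N) * real N powr (a + 1) \<le> 36 * \<epsilon> + 36 * \<bar>B\<bar> * real N powr (a - 2)"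
      if N: "3 < N" "1 / 4 \<le> (1 - 1 / real N) ^ N" for N
    proof -
      define n where "n = N - 3"
      have Nn: "N = n + 3" "n > 0" using N by (auto simp: n_def)
      define r where "r = 1 - 1 / real N"
      have r: "0 < r" "r < 1" using N by (auto simp: r_def)
      have "cmod (fps_nth G n) * r ^ n \<le> (\<epsilon> * (1 - r) powr (a - 1)) / (1 - r\<^sup>2) + \<bar>B\<bar>"
      proof (rule fps_coeff_bound[OF hol G r])
        fix z :: complex assume z: "cmod z = r"
        have ge: "1 - r \<le> cmod (1 - z)" using norm_triangle_ineq2[of 1 z] z by simp
        have pos: "0 < cmod (1 - z)" using ge r by linarith
        have "cmod (1 - z) powr (a - 3) = cmod (1 - z) powr (a - 1) * cmod (1 - z) powr (-2)"
          by (simp add: powr_add[symmetric])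
        also have "\<dots> = cmod (1 - z) powr (a - 1) / (cmod (1 - z))\<^sup>2"
          using pos by (simp add: powr_minus_divide)
        also have "\<dots> \<le> (1 - r) powr (a - 1) / (cmod (1 - z))\<^sup>2"
          using ge r a by (intro divide_right_mono powr_mono2') auto
        finally have "\<epsilon> * cmod (1 - z) powr (a - 3) \<le> \<epsilon> * ((1 - r) powr (a - 1) / (cmod (1 - z))\<^sup>2)"
          using \<epsilon> by (intro mult_left_mono) auto
        then show "cmod (g z) \<le> (\<epsilon> * (1 - r) powr (a - 1)) / (cmod (1 - z))\<^sup>2 + \<bar>B\<bar>"
          using B[of z] z r by auto
      qed
      also have "\<dots> \<le> (\<epsilon> * (1 - r) powr (a - 1)) / (1 - r) + \<bar>B\<bar>"
        using r \<epsilon> power_strict_decreasing[of 1 2 r]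
        by (intro add_right_mono divide_left_mono) (auto intro!: mult_pos_pos)
      also have "(\<epsilon> * (1 - r) powr (a - 1)) / (1 - r) = \<epsilon> * (1 - r) powr (a - 2)"
      proof -
        have "(1 - r) powr (a - 1) = (1 - r) powr (a - 2) * (1 - r) powr 1"
          using r by (subst powr_add[symmetric]) simp
        then show ?thesis using r by simp
      qed
      also have "(1 - r) powr (a - 2) = real N powr (2 - a)"
      proof -
        have "1 - r = inverse (real N)" by (simp add: r_def divide_inverse)
        then show ?thesis by (simp add: inverse_powr powr_minus[symmetric])
      qed
      finally have 1: "cmod (fps_nth G n) * r ^ n \<le> \<epsilon> * real N powr (2 - a) + \<bar>B\<bar>" .
      have "1 / 4 \<le> r ^ N" using N(2) by (simp add: r_def)
      also have "\<dots> \<le> r ^ n" using r by (intro power_decreasing) (auto simp: Nn)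
      finally have "cmod (fps_nth G n) * (1 / 4) \<le> cmod (fps_nth G n) * r ^ n"
        by (intro mult_left_mono) auto
      from order_trans[OF this 1] have "cmod (fps_nth G n) \<le> 4 * (\<epsilon> * real N powr (2 - a) + \<bar>B\<bar>)"
        by simp
      moreover have "cmod (fps_nth G n) = real ((n + 1) * (n + 2) * (n + 3)) * cmod (fps_nth F N)"
        unfolding Gn norm_mult norm_of_nat Nn ..
      moreover have "real N ^ 3 / 9 \<le> real ((n + 1) * (n + 2) * (n + 3))"
        by (simp add: Nn power3_eq_cube algebra_simps)
      ultimately have 2: "real N ^ 3 / 9 * cmod (fps_nth F N) \<le> 4 * (\<epsilon> * real N powr (2 - a) + \<bar>B\<bar>)"
        by (smt (verit) mult_right_mono norm_ge_zero)
      have "cmod (fps_nth F N) * real N powr (a + 1) = real N powr (a - 2) * (real N ^ 3 * cmod (fps_nth F N))"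
      proof -
        have "real N powr (a + 1) = real N powr (a - 2) * real N powr (real 3)"
          by (subst powr_add[symmetric]) (simp add: add.commute)
        also have "real N powr (real 3) = real N ^ 3" using N by (subst powr_realpow) auto
        finally show ?thesis by simp
      qed
      also have "\<dots> \<le> real N powr (a - 2) * (36 * (\<epsilon> * real N powr (2 - a) + \<bar>B\<bar>))"
        using 2 by (intro mult_left_mono) auto
      also have "\<dots> = 36 * \<epsilon> * (real N powr (a - 2) * real N powr (2 - a)) + 36 * \<bar>B\<bar> * real N powr (a - 2)"
        by (simp add: algebra_simps)
      also have "real N powr (a - 2) * real N powr (2 - a) = 1"
        using N by (simp add: powr_add[symmetric])
      finally show ?thesis by simp
    qed
    have "(\<lambda>N. 36 * \<epsilon> + 36 * \<bar>B\<bar> * real N powr (a - 2)) \<longlonglongrightarrow> 36 * \<epsilon> + 36 * \<bar>B\<bar> * 0"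
      using a by (intro tendsto_intros tendsto_neg_powr filterlim_real_sequentially) auto
    then have "eventually (\<lambda>N. 36 * \<epsilon> + 36 * \<bar>B\<bar> * real N powr (a - 2) < e) sequentially"
      by (rule order_tendstoD) (use e in \<open>simp add: \<epsilon>_def\<close>)
    then show "eventually (\<lambda>n. cmod (fps_nth F n) * real n powr (a + 1) < e) sequentially"
      using eventually_quarter_le_power eventually_gt_at_top[of 3]
      by eventually_elim (use main in \<open>blast intro: le_less_trans\<close>)
  qed
qed

lemma has_fps_expansion_one_minus_powr:
  "(\<lambda>z. (1 - z) powr c) has_fps_expansion Abs_fps (\<lambda>n. (-1) ^ n * ((c :: complex) gchoose n))"
proof -
  have "((\<lambda>z. (1 + z) powr c) \<circ> (\<lambda>z. - z)) has_fps_expansion (fps_binomial c oo (- fps_X))"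
    by (intro has_fps_expansion_compose has_fps_expansion_binomial_complex has_fps_expansion_minus
        has_fps_expansion_fps_X) auto
  moreover have "fps_binomial c oo (- fps_X) = Abs_fps (\<lambda>n. (-1) ^ n * (c gchoose n))"
    using fps_compose_linear[of "fps_binomial c" "-1"]
    by (simp add: fps_binomial_def flip: fps_const_neg)
  ultimately show ?thesis by (simp add: o_def)
qed

text \<open>The reciprocal \<open>rGamma\<close> is used because it is entire: for a natural number
  \<open>a\<close> it vanishes, as do the coefficients of the polynomial from some index on.\<close>

lemma one_minus_powr_coeff_asymptotic:
  "(\<lambda>n. (-1) ^ n * (of_real a gchoose n) * of_real (real n powr (a + 1))) \<longlonglongrightarrow> complex_of_real (rGamma (- a))"
proof -
  have "(\<lambda>n. (complex_of_real a gchoose n) / ((-1)^n / exp ((of_real a+1) * of_real (ln (real n))))) \<longlonglongrightarrow>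
           inverse (Gamma (- complex_of_real a))"
    by (rule gbinomial_asymptotic)
  also have "inverse (Gamma (- complex_of_real a)) = of_real (rGamma (- a))"
    by (simp add: rGamma_inverse_Gamma[symmetric] rGamma_complex_of_real[symmetric])
  finally show ?thesis
  proof (rule Lim_transform_eventually)
    show "eventually (\<lambda>n. (complex_of_real a gchoose n) / ((-1)^n / exp ((of_real a+1) * of_real (ln (real n)))) =
       (-1) ^ n * (of_real a gchoose n) * of_real (real n powr (a + 1))) sequentially"
      using eventually_gt_at_top[of 0]
    proof eventually_elim
      case (elim n)
      have "exp ((of_real a+1) * of_real (ln (real n))) = complex_of_real (real n powr (a + 1))"
        using elim by (simp add: powr_def exp_of_real[symmetric])
      moreover have "inverse ((-1) ^ n) = ((-1) ^ n :: complex)"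
        by (metis inverse_1 inverse_minus_eq power_inverse)
      ultimately show ?case by (simp add: divide_inverse)
    qed
  qed
qed

theorem transfer:
  assumes f: "sing_type 3 a c f" and F: "f has_fps_expansion F" and a: "a < 1"
  shows "(\<lambda>n. fps_nth F n * of_real (real n powr (a + 1))) \<longlonglongrightarrow> of_real (c * rGamma (- a))"
proof -
  define P where "P = Abs_fps (\<lambda>n. (-1) ^ n * (complex_of_real a gchoose n))"
  have "sing_type 3 a (c - c * 1) (\<lambda>z. f z - of_real c * (1 - z) powr of_real a)"
    by (intro sing_type_diff f sing_type_cmult sing_type_powr)
  then have "sing_type 3 a 0 (\<lambda>z. f z - of_real c * (1 - z) powr of_real a)" by simp
  moreover have "(\<lambda>z. f z - of_real c * (1 - z) powr of_real a) has_fps_expansion (F - fps_const (of_real c) * P)"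
    unfolding P_def
    by (intro has_fps_expansion_diff has_fps_expansion_cmult_left F has_fps_expansion_one_minus_powr)
  ultimately have "(\<lambda>n. cmod (fps_nth (F - fps_const (of_real c) * P) n) * real n powr (a + 1)) \<longlonglongrightarrow> 0"
    using a by (rule transfer_o)
  then have 1: "(\<lambda>n. fps_nth (F - fps_const (of_real c) * P) n * of_real (real n powr (a + 1))) \<longlonglongrightarrow> 0"
    by (subst tendsto_norm_zero_iff[symmetric]) (simp add: norm_mult)
  have "(\<lambda>n. of_real c * (fps_nth P n * of_real (real n powr (a + 1)))) \<longlonglongrightarrow> of_real c * of_real (rGamma (- a))"
    unfolding P_def using one_minus_powr_coeff_asymptotic[of a] by (intro tendsto_mult tendsto_const) simp
  from tendsto_add[OF 1 this] show ?thesis by (simp add: algebra_simps)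
qed

section \<open>From sectors to the unit disc\<close>

text \<open>The cosine is even and decreasing on \<open>[0, pi]\<close>. The resulting inequality is
  homogeneous in \<open>z - \<rho>\<close>, hence compatible with rescaling, and being strict it
  excludes \<open>z = \<rho>\<close> without a separate clause.\<close>

lemma delta_domain_iff:
  assumes "0 < \<theta>" "\<theta> < pi / 2"
  shows "z \<in> delta_domain \<rho> \<epsilon> \<theta> \<longleftrightarrow>
    cmod z < \<rho> + \<epsilon> \<and> Re (z - of_real \<rho>) < cos \<theta> * cmod (z - of_real \<rho>)"
proof (cases "z - of_real \<rho> = 0")
  case True
  then show ?thesis using assms by (simp add: delta_domain_def Arg_zero)
next
  case False
  define w where "w = z - of_real \<rho>"
  have w: "w \<noteq> 0" using False by (simp add: w_def)
  have "\<theta> < \<bar>Arg w\<bar> \<longleftrightarrow> cos \<bar>Arg w\<bar> < cos \<theta>"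
    using assms Arg_bounded[of w] by (intro cos_mono_less_eq[symmetric]) auto
  also have "cos \<bar>Arg w\<bar> = Re w / cmod w" using cos_Arg[OF w] by (simp add: abs_if)
  also have "Re w / cmod w < cos \<theta> \<longleftrightarrow> Re w < cos \<theta> * cmod w"
    using w by (simp add: divide_less_eq)
  finally show ?thesis by (simp add: delta_domain_def w_def)
qed

text \<open>With coefficient \<open>0\<close> the recursion for derivatives keeps \<open>0\<close>,
  so it unfolds into separate statements about the higher derivatives.\<close>

lemma sing_type_0I:
  assumes "\<And>j. j \<le> N \<Longrightarrow> sing_lim (a - real j) 0 ((deriv ^^ j) f)"
  shows "sing_type N a 0 f"
  using assms
proof (induction N arbitrary: a f)
  case 0
  then show ?case using 0[of 0] by simp
next
  case (Suc N)
  have "sing_type N (a - 1) 0 (deriv f)"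
  proof (rule Suc.IH)
    fix j assume "j \<le> N"
    then show "sing_lim (a - 1 - real j) 0 ((deriv ^^ j) (deriv f))"
      using Suc.prems[of "Suc j"] by (simp add: funpow_swap1 algebra_simps)
  qed
  then show ?case using Suc.prems[of 0] by simp
qed

text \<open>Since the opening angle of the removed sector is less than \<open>pi\<close>, every point \<open>z\<close> of the unit
  disc is the centre of a disc of radius proportional to \<open>|1 - z|\<close> inside the domain, so that
  Cauchy's inequality transfers a bound on a function to its derivatives.\<close>

lemma sing_lim_deriv_of_sector:
  fixes e :: "complex \<Rightarrow> complex" and E :: "complex set" and \<epsilon> \<kappa> l :: real
  defines "E \<equiv> {z. cmod z < 1 + \<epsilon> \<and> Re (z - 1) < \<kappa> * cmod (z - 1)}"
  assumes \<epsilon>: "0 < \<epsilon>" and \<kappa>: "0 < \<kappa>" "\<kappa> < 1" and l: "0 < l"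
    and hol: "e holomorphic_on E"
    and lim: "((\<lambda>z. e z / (1 - z) powr of_real l) \<longlongrightarrow> 0) (at 1 within E)"
  shows "sing_lim (l - real j) 0 ((deriv ^^ j) e)"
proof -
  \<comment> \<open>Discs of radius \<open>\<eta> |1 - z|\<close> are used. As
    \<open>|1 - z| \<le> 2\<close>, the bound \<open>\<epsilon> / 4\<close> keeps them within
    modulus \<open>1 + \<epsilon> / 2\<close>. The bound \<open>\<kappa> / 4\<close>, together with
    \<open>1 - \<eta> \<ge> 1/2\<close>, keeps them in the cone of slope
    \<open>\<kappa> / 2\<close>.\<close>
  define \<eta> where "\<eta> = min (\<epsilon> / 4) (\<kappa> / 4)"
  have \<eta>: "0 < \<eta>" "\<eta> \<le> \<epsilon> / 4" "\<eta> \<le> \<kappa> / 4" "\<eta> < 1 / 4" using \<epsilon> \<kappa> by (auto simp: \<eta>_def)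
  \<comment> \<open>A closed shrinking of \<open>E\<close>: with a disc around \<open>1\<close> cut
    out it is a compact subset of \<open>E\<close>. So \<open>e\<close> is bounded there, while near
    \<open>1\<close> the limit takes over.\<close>
  define S where "S = {z. cmod z \<le> 1 + \<epsilon> / 2 \<and> Re (z - 1) \<le> \<kappa> / 2 * cmod (z - 1)}"
  have S_E: "z \<in> E" if "z \<in> S" "z \<noteq> 1" for z
  proof -
    have "\<kappa> / 2 * cmod (z - 1) < \<kappa> * cmod (z - 1)" using that \<kappa> by simp
    then show ?thesis using that \<epsilon> unfolding S_def E_def by auto
  qed
  have D_neg: "Re (z - 1) \<le> 0" if "z \<in> ball 0 1" for z
    using Re_less_1_unit_disc[OF that] by simp
  have near: "(1 - \<eta>) * cmod (1 - z) \<le> cmod (1 - u)" "cmod (1 - u) \<le> (1 + \<eta>) * cmod (1 - z)"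
    if "u \<in> cball z (\<eta> * cmod (1 - z))" for u z
  proof -
    have d: "cmod (z - u) \<le> \<eta> * cmod (1 - z)" using that by (simp add: dist_norm)
    show "cmod (1 - u) \<le> (1 + \<eta>) * cmod (1 - z)"
      using norm_triangle_ineq[of "1 - z" "z - u"] d by (simp add: algebra_simps)
    show "(1 - \<eta>) * cmod (1 - z) \<le> cmod (1 - u)"
      using norm_triangle_ineq4[of "1 - u" "z - u"] d by (simp add: algebra_simps)
  qed
  have cb_S: "cball z (\<eta> * cmod (1 - z)) \<subseteq> S - {1}" if z: "z \<in> ball 0 1" for z
  proof
    fix u assume u: "u \<in> cball z (\<eta> * cmod (1 - z))"
    have z1: "0 < cmod (1 - z)" using one_minus_nonzero_unit_disc[OF z] by simp
    have d: "cmod (u - z) \<le> \<eta> * cmod (1 - z)" using u by (simp add: dist_norm norm_minus_commute)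
    have "cmod (1 - z) \<le> 2" using norm_triangle_ineq4[of 1 z] z by simp
    then have "\<eta> * cmod (1 - z) \<le> \<epsilon> / 4 * 2" using \<eta> \<epsilon> by (intro mult_mono) auto
    then have 1: "cmod u \<le> 1 + \<epsilon> / 2"
      using norm_triangle_ineq[of z "u - z"] d z by simp
    have lower: "(1 - \<eta>) * cmod (1 - z) \<le> cmod (u - 1)" using near[OF u] by (simp add: norm_minus_commute)
    have "Re (u - 1) = Re (z - 1) + Re (u - z)" by simp
    also have "\<dots> \<le> \<eta> * cmod (1 - z)" using D_neg[OF z] complex_Re_le_cmod[of "u - z"] d by linarith
    also have "\<dots> \<le> \<kappa> / 2 * ((1 - \<eta>) * cmod (1 - z))"
    proof -
      have "\<kappa> * (1 / 2) \<le> \<kappa> * (1 - \<eta>)" using \<eta> \<kappa> by (intro mult_left_mono) auto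
      with \<eta>(3) have "\<eta> \<le> (\<kappa> * (1 - \<eta>)) / 2" by linarith
      then have "\<eta> \<le> \<kappa> / 2 * (1 - \<eta>)" by simp
      then have "\<eta> * cmod (1 - z) \<le> \<kappa> / 2 * (1 - \<eta>) * cmod (1 - z)" by (intro mult_right_mono) auto
      then show ?thesis by (simp add: mult.assoc)
    qed
    also have "\<dots> \<le> \<kappa> / 2 * cmod (u - 1)" using lower \<kappa> by (intro mult_left_mono) auto
    finally have 2: "Re (u - 1) \<le> \<kappa> / 2 * cmod (u - 1)" .
    have "0 < (1 - \<eta>) * cmod (1 - z)" using \<eta> z1 by (intro mult_pos_pos) auto
    with lower have "u \<noteq> 1" by auto
    with 1 2 show "u \<in> S - {1}" unfolding S_def by auto
  qed
  have small: "\<exists>d>0. \<forall>u\<in>S - {1}. cmod (1 - u) < d \<longrightarrow> cmod (e u) \<le> \<delta> * cmod (1 - u) powr l" if \<delta>: "0 < \<delta>" for \<delta>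
  proof -
    obtain d where d: "0 < d" 
      "\<And>u. u \<in> E \<Longrightarrow> u \<noteq> 1 \<Longrightarrow> dist u 1 < d \<Longrightarrow> dist (e u / (1 - u) powr of_real l) 0 < \<delta>"
      using lim \<delta> unfolding tendsto_iff eventually_at by metis
    show ?thesis
    proof (intro exI[of _ d] conjI d(1) ballI impI)
      fix u assume u: "u \<in> S - {1}" "cmod (1 - u) < d"
      have "cmod (e u) / cmod (1 - u) powr l < \<delta>"
        using d(2)[of u] S_E[of u] u by (auto simp: norm_divide norm_powr_of_real dist_norm norm_minus_commute)
      then show "cmod (e u) \<le> \<delta> * cmod (1 - u) powr l" using u by (auto simp: divide_less_eq)
    qed
  qed
  obtain C where C: "0 \<le> C" "\<And>u. u \<in> S - {1} \<Longrightarrow> cmod (e u) \<le> C * cmod (1 - u) powr l"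
  proof -
    obtain d where d: "0 < d" "\<And>u. u \<in> S - {1} \<Longrightarrow> cmod (1 - u) < d \<Longrightarrow> cmod (e u) \<le> 1 * cmod (1 - u) powr l"
      using small[of 1] by auto
    have "closed S"
      unfolding S_def by (intro closed_Collect_conj closed_Collect_le continuous_intros)
    moreover have "bounded S" unfolding S_def bounded_iff by auto
    ultimately have "compact (S - ball 1 d)"
      by (simp add: compact_eq_bounded_closed closed_Diff bounded_diff)
    moreover have "S - ball 1 d \<subseteq> E" using S_E d(1) by force
    then have "continuous_on (S - ball 1 d) e"
      using holomorphic_on_imp_continuous_on[OF hol] continuous_on_subset by blast
    ultimately have "bounded (e ` (S - ball 1 d))"
      by (intro compact_imp_bounded compact_continuous_image)
    then obtain K where "\<forall>x\<in>e ` (S - ball 1 d). cmod x \<le> K"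
      unfolding bounded_iff by blast
    then have K: "\<And>u. u \<in> S - ball 1 d \<Longrightarrow> cmod (e u) \<le> K" by blast
    show ?thesis
    proof (rule that[of "1 + \<bar>K\<bar> / d powr l"])
      fix u assume u: "u \<in> S - {1}"
      show "cmod (e u) \<le> (1 + \<bar>K\<bar> / d powr l) * cmod (1 - u) powr l"
      proof (cases "cmod (1 - u) < d")
        case True
        then show ?thesis using d(2)[OF u True] by (simp add: distrib_right add_increasing2)
      next
        case False
        have "cmod (e u) \<le> \<bar>K\<bar> / d powr l * d powr l"
          using K[of u] u False d(1) by (auto simp: dist_norm)
        also have "\<dots> \<le> \<bar>K\<bar> / d powr l * cmod (1 - u) powr l"
          using False d(1) l by (intro mult_left_mono powr_mono2) auto
        finally show ?thesis by (simp add: distrib_right add_increasing)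
      qed
    qed auto
  qed
  \<comment> \<open>The factor \<open>fact j / \<eta>^j\<close> comes from Cauchy's inequality at
    radius \<open>\<eta> |1 - z|\<close>, and \<open>2 powr l\<close> from
    \<open>|1 - u| \<le> 2 |1 - z|\<close> on that disc.\<close>
  define K where "K = fact j * 2 powr l / \<eta> ^ j"
  have K0: "0 < K" using \<eta> by (simp add: K_def)
  have est: "cmod ((deriv ^^ j) e z) \<le> K * \<delta> * cmod (1 - z) powr (l - real j)"
    if z: "z \<in> ball 0 1" and \<delta>: "0 \<le> \<delta>"
      and b: "\<And>u. u \<in> cball z (\<eta> * cmod (1 - z)) \<Longrightarrow> cmod (e u) \<le> \<delta> * cmod (1 - u) powr l" for z \<delta>
  proof -
    let ?R = "\<eta> * cmod (1 - z)"
    have z1: "0 < cmod (1 - z)" using one_minus_nonzero_unit_disc[OF z] by simp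
    have R: "0 < ?R" using \<eta> z1 by simp
    have sub: "cball z ?R \<subseteq> E" using cb_S[OF z] S_E by blast
    have "cmod ((deriv ^^ j) e z) \<le> fact j * (\<delta> * (2 * cmod (1 - z)) powr l) / ?R ^ j"
    proof (rule Cauchy_inequality[OF _ _ R])
      show "e holomorphic_on ball z ?R" using hol sub ball_subset_cball holomorphic_on_subset by blast
      show "continuous_on (cball z ?R) e"
        using holomorphic_on_imp_continuous_on[OF hol] sub continuous_on_subset by blast
      fix u assume "cmod (z - u) = ?R"
      then have u: "u \<in> cball z ?R" by (simp add: dist_norm)
      have "(1 + \<eta>) * cmod (1 - z) \<le> 2 * cmod (1 - z)" using \<eta> by (intro mult_right_mono) auto
      then have "cmod (1 - u) powr l \<le> (2 * cmod (1 - z)) powr l"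
        using near(2)[OF u] l by (intro powr_mono2) auto
      then show "cmod (e u) \<le> \<delta> * (2 * cmod (1 - z)) powr l"
        using b[OF u] mult_left_mono[OF _ \<delta>] by (meson order_trans)
    qed
    also have "\<dots> = K * \<delta> * (cmod (1 - z) powr l / cmod (1 - z) ^ j)"
      by (simp add: K_def powr_mult power_mult_distrib)
    also have "cmod (1 - z) powr l / cmod (1 - z) ^ j = cmod (1 - z) powr (l - real j)"
      using z1 by (simp add: powr_diff powr_realpow)
    finally show ?thesis .
  qed
  show ?thesis
  proof (rule sing_limI)
    have "ball 0 1 \<subseteq> E"
    proof
      fix z :: complex assume z: "z \<in> ball 0 1"
      have "z \<in> cball z (\<eta> * cmod (1 - z))" using \<eta> by simp
      then show "z \<in> E" using cb_S[OF z] S_E by blast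
    qed
    then show "(deriv ^^ j) e holomorphic_on ball 0 1"
      using hol by (intro holomorphic_higher_deriv) (auto intro: holomorphic_on_subset)
    show "cmod ((deriv ^^ j) e z) \<le> K * C * cmod (1 - z) powr (l - real j)" if "z \<in> ball 0 1" for z
      using est[OF that C(1)] C(2) cb_S[OF that] by blast
    show "((\<lambda>z. (deriv ^^ j) e z / (1 - z) powr of_real (l - real j)) \<longlongrightarrow> of_real 0) (at 1 within ball 0 1)"
      unfolding tendsto_iff
    proof (intro allI impI)
      fix r :: real assume r: "0 < r"
      have \<delta>: "0 < r / (2 * K)" using r K0 by simp
      from small[OF this] obtain d where d: "0 < d"
        "\<And>u. u \<in> S - {1} \<Longrightarrow> cmod (1 - u) < d \<Longrightarrow> cmod (e u) \<le> r / (2 * K) * cmod (1 - u) powr l"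
        by blast
      show "\<forall>\<^sub>F z in at 1 within ball 0 1. dist ((deriv ^^ j) e z / (1 - z) powr of_real (l - real j)) (of_real 0) < r"
        unfolding eventually_at
      proof (intro exI[of _ "d / 2"] conjI ballI impI)
        show "0 < d / 2" using d by simp
        fix z :: complex assume z: "z \<in> ball 0 1" "z \<noteq> 1 \<and> dist z 1 < d / 2"
        have z1: "0 < cmod (1 - z)" using one_minus_nonzero_unit_disc[OF z(1)] by simp
        have zd: "cmod (1 - z) < d / 2" using z by (simp add: dist_norm norm_minus_commute)
        have "cmod ((deriv ^^ j) e z) \<le> K * (r / (2 * K)) * cmod (1 - z) powr (l - real j)"
        proof (rule est[OF z(1)])
          fix u assume u: "u \<in> cball z (\<eta> * cmod (1 - z))"
          have "(1 + \<eta>) * cmod (1 - z) \<le> 2 * cmod (1 - z)" using \<eta> by (intro mult_right_mono) auto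
          then have "cmod (1 - u) < d" using near(2)[OF u] zd by linarith
          then show "cmod (e u) \<le> r / (2 * K) * cmod (1 - u) powr l"
            using d(2) cb_S[OF z(1)] u by blast
        qed (use \<delta> in simp)
        then have "cmod ((deriv ^^ j) e z) / cmod (1 - z) powr (l - real j) \<le> r / 2"
          using K0 z1 by (simp add: divide_le_eq)
        also have "r / 2 < r" using r by simp
        finally have "cmod ((deriv ^^ j) e z) / cmod (1 - z) powr (l - real j) < r" .
        moreover have "1 - z \<noteq> 0" using z1 by auto
        ultimately show "dist ((deriv ^^ j) e z / (1 - z) powr of_real (l - real j)) (of_real 0) < r"
          using norm_powr_of_real[of "1 - z" "l - real j"] by (simp add: norm_divide)
      qed
    qed
  qed
qed

definition cfps :: "real fps \<Rightarrow> complex fps" where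
  "cfps f = Abs_fps (\<lambda>n. of_real (fps_nth f n))"

lemma cfps_nth [simp]: "fps_nth (cfps f) n = of_real (fps_nth f n)"
  by (simp add: cfps_def)

text \<open>Besides the variable the values are scaled, because the inner series has to take the
  value \<open>1\<close> at its singularity \<open>1\<close>.\<close>

definition rescale :: "real \<Rightarrow> real \<Rightarrow> real fps \<Rightarrow> real fps" where
  "rescale a \<rho> f = Abs_fps (\<lambda>n. a * fps_nth f n * \<rho> ^ n)"

lemma rescale_nth [simp]: "fps_nth (rescale a \<rho> f) n = a * fps_nth f n * \<rho> ^ n"
  by (simp add: rescale_def)

text \<open>Only the remainder \<open>e\<close> after subtraction of \<open>c (1 - z)^l\<close> goes
  through Cauchy's inequality; the derivatives of the power itself are explicit and are added
  back.\<close>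

lemma singular_expansion_imp_sing_type:
  assumes f: "singular_expansion f \<rho> \<tau> c l" and l: "0 < l"
  shows "1 \<le> fps_conv_radius (cfps (rescale 1 \<rho> f))"
    and "sing_type N l c (\<lambda>z. eval_fps (cfps (rescale 1 \<rho> f)) z - of_real \<tau>)"
proof -
  let ?F = "cfps (rescale 1 \<rho> f)"
  from f obtain \<epsilon> \<theta> \<phi> where \<rho>: "0 < \<rho>" and \<epsilon>: "0 < \<epsilon>" and \<theta>: "0 < \<theta>" "\<theta> < pi / 2"
    and hol: "\<phi> holomorphic_on delta_domain \<rho> \<epsilon> \<theta>"
    and sums: "\<And>z. cmod z < \<rho> \<Longrightarrow> (\<lambda>n. of_real (fps_nth f n) * z ^ n) sums \<phi> z"
    and lim: "((\<lambda>z. (\<phi> z - of_real \<tau>) / (1 - z / of_real \<rho>) powr of_real l) \<longlongrightarrow> of_real c)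
          (at (of_real \<rho>) within delta_domain \<rho> \<epsilon> \<theta>)"
    unfolding singular_expansion_def by blast
  have sums': "(\<lambda>n. fps_nth ?F n * z ^ n) sums \<phi> (of_real \<rho> * z)" if "z \<in> ball 0 1" for z
  proof -
    have "cmod (of_real \<rho> * z) < \<rho>" using that \<rho> by (simp add: norm_mult)
    from sums[OF this] show ?thesis by (simp add: power_mult_distrib mult_ac)
  qed
  show "1 \<le> fps_conv_radius ?F"
    unfolding fps_conv_radius_def
  proof (rule conv_radius_geI_ex)
    fix r :: real assume "0 < r" "ereal r < 1"
    then have "of_real r \<in> ball (0::complex) 1" "norm (of_real r :: complex) = r"
      by (auto simp: one_ereal_def)
    then show "\<exists>z. norm z = r \<and> summable (\<lambda>n. fps_nth ?F n * z ^ n)"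
      using sums_summable[OF sums'] by blast
  qed
  define \<kappa> where "\<kappa> = cos \<theta>"
  have \<kappa>: "0 < \<kappa>" "\<kappa> < 1" unfolding \<kappa>_def using \<theta> cos_gt_zero[of \<theta>] cos_monotone_0_pi[of 0 \<theta>] pi_gt_zero
    by (auto simp del: pi_gt_zero)
  define E where "E = {z. cmod z < 1 + \<epsilon> / \<rho> \<and> Re (z - 1) < \<kappa> * cmod (z - 1)}"
  have E_iff: "z \<in> E \<longleftrightarrow> of_real \<rho> * z \<in> delta_domain \<rho> \<epsilon> \<theta>" for z
  proof -
    have "of_real \<rho> * z - of_real \<rho> = of_real \<rho> * (z - 1)" by (simp add: algebra_simps)
    then have "cmod (of_real \<rho> * z - of_real \<rho>) = \<rho> * cmod (z - 1)" 
      "Re (of_real \<rho> * z - of_real \<rho>) = \<rho> * Re (z - 1)"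
      using \<rho> by (simp_all only: norm_mult norm_of_real) simp_all
    moreover have "\<rho> * Re (z - 1) < \<kappa> * (\<rho> * cmod (z - 1)) \<longleftrightarrow> Re (z - 1) < \<kappa> * cmod (z - 1)"
      using \<rho> by (simp only: mult.left_commute[of \<kappa> \<rho>] mult_less_cancel_left_pos)
    moreover have "\<rho> * cmod z < \<rho> + \<epsilon> \<longleftrightarrow> cmod z < 1 + \<epsilon> / \<rho>"
      using \<rho> by (simp add: field_simps)
    ultimately show ?thesis
      unfolding delta_domain_iff[OF \<theta>] E_def mem_Collect_eq \<kappa>_def norm_mult
      using \<rho> by simp
  qed
  define e where "e = (\<lambda>z. \<phi> (of_real \<rho> * z) - of_real \<tau> - of_real c * (1 - z) powr of_real l)"
  \<comment> \<open>Since \<open>\<kappa> < 1\<close>, the cone condition fails on the ray from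
    \<open>1\<close> to infinity, and the principal power is holomorphic on
    \<open>E\<close>.\<close>
  have E_slit: "1 - z \<notin> \<real>\<^sub>\<le>\<^sub>0" if "z \<in> E" for z
  proof
    assume "1 - z \<in> \<real>\<^sub>\<le>\<^sub>0"
    then have z: "Im z = 0" "1 \<le> Re z" by (auto simp: complex_nonpos_Reals_iff)
    then have "z - 1 = of_real (Re z - 1)" by (simp add: complex_eq_iff)
    then have "cmod (z - 1) = Re z - 1" using z by (metis abs_of_nonneg diff_ge_0_iff_ge norm_of_real)
    then have "Re z - 1 < \<kappa> * (Re z - 1)" using that unfolding E_def by simp
    moreover have "\<kappa> * (Re z - 1) \<le> 1 * (Re z - 1)" using z \<kappa> by (intro mult_right_mono) auto
    ultimately show False by simp
  qed
  have "(\<lambda>z. \<phi> (of_real \<rho> * z)) holomorphic_on E"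
    using holomorphic_on_compose_gen[of "\<lambda>z. of_real \<rho> * z" E \<phi> "delta_domain \<rho> \<epsilon> \<theta>"] hol E_iff
    by (auto simp: o_def image_subset_iff intro!: holomorphic_intros)
  then have hol_e: "e holomorphic_on E"
    unfolding e_def using E_slit by (intro holomorphic_intros) auto
  have "((\<lambda>z. e z / (1 - z) powr of_real l) \<longlongrightarrow> 0) (at 1 within E)"
  proof -
    have ev: "eventually (\<lambda>z. z \<in> E \<and> z \<noteq> 1) (at 1 within E)" by (simp add: eventually_at_filter)
    have "((\<lambda>z. of_real \<rho> * z) \<longlongrightarrow> of_real \<rho> * 1) (at 1 within E)" by (intro tendsto_intros)
    then have "filterlim (\<lambda>z. of_real \<rho> * z) (at (of_real \<rho>) within delta_domain \<rho> \<epsilon> \<theta>) (at 1 within E)"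
      unfolding filterlim_at using E_iff \<rho> by (auto intro!: eventually_mono[OF ev])
    from filterlim_compose[OF lim this]
    have "((\<lambda>z. (\<phi> (of_real \<rho> * z) - of_real \<tau>) / (1 - z) powr of_real l - of_real c) \<longlongrightarrow> of_real c - of_real c) (at 1 within E)"
      using \<rho> by (intro tendsto_diff tendsto_const) simp
    then have "((\<lambda>z. (\<phi> (of_real \<rho> * z) - of_real \<tau>) / (1 - z) powr of_real l - of_real c) \<longlongrightarrow> 0) (at 1 within E)"
      by simp
    then show ?thesis
    proof (rule Lim_transform_eventually[OF _ eventually_mono[OF ev]])
      fix z assume "z \<in> E \<and> z \<noteq> 1"
      then have "(1 - z) powr of_real l \<noteq> 0" by simp
      then show "(\<phi> (of_real \<rho> * z) - of_real \<tau>) / (1 - z) powr of_real l - of_real c = e z / (1 - z) powr of_real l"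
        by (simp add: e_def diff_divide_distrib)
    qed
  qed
  then have "sing_lim (l - real j) 0 ((deriv ^^ j) e)" for j
    using \<epsilon> \<rho> \<kappa> l hol_e unfolding E_def
    by (intro sing_lim_deriv_of_sector[where \<epsilon> = "\<epsilon> / \<rho>" and \<kappa> = \<kappa>]) auto
  then have "sing_type N l 0 e" by (intro sing_type_0I)
  from sing_type_add[OF this sing_type_cmult[OF sing_type_powr, of N l c]]
  have "sing_type N l c (\<lambda>z. e z + of_real c * (1 - z) powr of_real l)" by simp
  also have "?this \<longleftrightarrow> sing_type N l c (\<lambda>z. eval_fps ?F z - of_real \<tau>)"
  proof (rule sing_type_cong)
    fix z :: complex assume z: "z \<in> ball 0 1"
    show "e z + of_real c * (1 - z) powr of_real l = eval_fps ?F z - of_real \<tau>"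
      using sums_unique[OF sums'[OF z]] by (simp add: e_def eval_fps_def)
  qed
  finally show "sing_type N l c (\<lambda>z. eval_fps ?F z - of_real \<tau>)" .
qed

section \<open>The method of moments\<close>

text \<open>By Levy's theorem it suffices to compare characteristic functions. Both are replaced by
  Taylor polynomials of one fixed order \<open>N\<close>; the error is controlled by the
  \<open>N\<close>-th moment, which converges too, so the estimate is uniform for large
  \<open>n\<close>. The growth condition makes the error small for every \<open>t\<close>.\<close>

theorem weak_conv_m_of_moments:
  fixes M :: "nat \<Rightarrow> real measure" and L :: "real measure" and m :: "nat \<Rightarrow> real"
  assumes M: "\<And>n. real_distribution (M n)" and L: "real_distribution L"
    and int: "\<And>s. eventually (\<lambda>n. integrable (M n) (\<lambda>x. x ^ s)) sequentially"
    and lim: "\<And>s. (\<lambda>n. \<integral>x. x ^ s \<partial>M n) \<longlonglongrightarrow> m s"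
    and Lint: "\<And>s. integrable L (\<lambda>x. x ^ s)" and Lmom: "\<And>s. (\<integral>x. x ^ s \<partial>L) = m s"
    and growth: "\<And>t. (\<lambda>s. m s * t ^ s / fact s) \<longlonglongrightarrow> 0"
  shows "weak_conv_m M L"
proof (rule levy_continuity[OF M L])
  fix t :: real
  show "(\<lambda>n. char (M n) t) \<longlonglongrightarrow> char L t"
    unfolding tendsto_iff
  proof (intro allI impI)
    fix \<epsilon> :: real assume \<epsilon>: "0 < \<epsilon>"
    have "eventually (\<lambda>s. m s * \<bar>t\<bar> ^ s / fact s < \<epsilon> / 8) sequentially"
      using growth[of "\<bar>t\<bar>"] by (rule order_tendstoD) (use \<epsilon> in simp)
    then obtain S where S: "\<And>s. S \<le> s \<Longrightarrow> m s * \<bar>t\<bar> ^ s / fact s < \<epsilon> / 8"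
      unfolding eventually_sequentially by blast
    \<comment> \<open>An even order turns the absolute moment in the Taylor error into a moment.
      That error carries a factor \<open>2\<close>, hence \<open>\<epsilon> / 8\<close> for a share
      of \<open>\<epsilon> / 4\<close>.\<close>
    define N where "N = 2 * S"
    have N: "even N" "m N * \<bar>t\<bar> ^ N / fact N < \<epsilon> / 8" using S[of N] by (auto simp: N_def)
    have abs: "\<bar>x\<bar> ^ N = x ^ N" for x :: real using N(1) by (rule power_even_abs)
    define a where "a = (\<lambda>k. (\<i> * of_real t) ^ k / fact k)"
    define P where "P = (\<lambda>n. \<Sum>k\<le>N. a k * of_real (\<integral>x. x ^ k \<partial>M n))"
    define Q where "Q = (\<Sum>k\<le>N. a k * of_real (m k))"
    have PQ: "P \<longlonglongrightarrow> Q" unfolding P_def Q_def by (intro tendsto_intros lim)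
    have LQ: "cmod (char L t - Q) < \<epsilon> / 4"
    proof -
      have "cmod (char L t - Q) \<le> (2 * \<bar>t\<bar> ^ N / fact N) * m N"
        using real_distribution.char_approx1[OF L Lint, where n = N and t = t] by (simp add: Q_def a_def Lmom abs)
      also have "(2 * \<bar>t\<bar> ^ N / fact N) * m N = 2 * (m N * \<bar>t\<bar> ^ N / fact N)" by simp
      finally show ?thesis using N(2) by linarith
    qed
    have "(\<lambda>n. (2 * \<bar>t\<bar> ^ N / fact N) * (\<integral>x. x ^ N \<partial>M n)) \<longlonglongrightarrow> (2 * \<bar>t\<bar> ^ N / fact N) * m N"
      by (intro tendsto_intros lim)
    then have "eventually (\<lambda>n. (2 * \<bar>t\<bar> ^ N / fact N) * (\<integral>x. x ^ N \<partial>M n) < \<epsilon> / 4) sequentially"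
    proof (rule order_tendstoD)
      have "(2 * \<bar>t\<bar> ^ N / fact N) * m N = 2 * (m N * \<bar>t\<bar> ^ N / fact N)" by simp
      then show "(2 * \<bar>t\<bar> ^ N / fact N) * m N < \<epsilon> / 4" using N(2) by linarith
    qed
    moreover have "eventually (\<lambda>n. dist (P n) Q < \<epsilon> / 4) sequentially"
      using tendstoD[OF PQ, of "\<epsilon> / 4"] \<epsilon> by simp
    moreover have "eventually (\<lambda>n. \<forall>s\<in>{..N}. integrable (M n) (\<lambda>x. x ^ s)) sequentially"
      using int by (intro eventually_ball_finite) auto
    ultimately show "eventually (\<lambda>n. dist (char (M n) t) (char L t) < \<epsilon>) sequentially"
    proof eventually_elim
      case (elim n)
      have "cmod (char (M n) t - P n) \<le> (2 * \<bar>t\<bar> ^ N / fact N) * (\<integral>x. x ^ N \<partial>M n)"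
        using real_distribution.char_approx1[OF M, where n = N and t = t] elim(3) by (simp add: P_def a_def abs)
      then have "cmod (char (M n) t - P n) < \<epsilon> / 4" using elim(1) by linarith
      then have "cmod ((char (M n) t - P n) + (P n - Q)) < \<epsilon> / 2"
        using elim(2) norm_triangle_ineq[of "char (M n) t - P n" "P n - Q"] by (simp add: dist_norm)
      then have "cmod ((char (M n) t - Q) - (char L t - Q)) < \<epsilon>"
        using LQ norm_triangle_ineq4[of "char (M n) t - Q" "char L t - Q"] \<epsilon> by simp
      then show ?case by (simp add: dist_norm)
    qed
  qed
qed

lemma tight_of_bounded_expectation:
  fixes M :: "nat \<Rightarrow> real measure"
  assumes M: "\<And>n. real_distribution (M n)" and nn: "\<And>n. AE x in M n. 0 \<le> x"
    and int: "\<And>n. integrable (M n) (\<lambda>x. x)" and B: "\<And>n. (\<integral>x. x \<partial>M n) \<le> B"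
  shows "tight M"
  unfolding tight_def
proof (intro conjI allI impI M)
  fix \<epsilon> :: real assume \<epsilon>: "0 < \<epsilon>"
  \<comment> \<open>Chosen for Markov's inequality; the summand \<open>1\<close> makes
    \<open>b\<close> positive and the estimate strict. The left endpoint \<open>-1\<close> is used
    because the half-open interval has to contain \<open>0\<close>.\<close>
  define b where "b = (\<bar>B\<bar> + 1) / \<epsilon>"
  have b: "0 < b" using \<epsilon> by (simp add: b_def)
  have "1 - \<epsilon> < measure (M n) {-1<..b}" for n
  proof -
    interpret real_distribution "M n" by (rule M)
    have "prob {x \<in> space (M n). b \<le> x} \<le> (\<integral>x. x \<partial>M n) / b"
      by (rule integral_Markov_inequality_measure[OF int _ nn b, where A = "{}", simplified])
    also have "\<dots> \<le> \<bar>B\<bar> / b" using B[of n] b by (intro divide_right_mono) auto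
    also have "\<dots> < \<epsilon>"
    proof -
      have "\<bar>B\<bar> < \<epsilon> * b" using \<epsilon> by (simp add: b_def)
      then show ?thesis using b by (simp add: divide_less_eq)
    qed
    finally have 1: "prob {b..} < \<epsilon>" by (simp add: atLeast_def)
    have "1 = prob UNIV" using prob_space by simp
    also have "\<dots> \<le> prob ({-1<..b} \<union> {b..} \<union> {..-1})"
      by (intro finite_measure_mono) auto
    also have "\<dots> \<le> prob ({-1<..b} \<union> {b..}) + prob {..-1}"
      by (intro measure_Un_le) auto
    also have "\<dots> \<le> prob {-1<..b} + prob {b..} + prob {..-1}"
      by (intro add_right_mono measure_Un_le) auto
    also have "prob {..-1} = 0"
      using nn[of n] by (intro prob_eq_0[THEN iffD2] ) (auto elim!: eventually_mono)
    finally show ?thesis using 1 by simp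
  qed
  then show "\<exists>a b. a < b \<and> (\<forall>n. 1 - \<epsilon> < measure (M n) {a<..b})"
    using b by (intro exI[of _ "-1"] exI[of _ b]) auto
qed

text \<open>Bounded first moments give tightness and thus a weakly convergent subsequence. Powers
  are unbounded, so weak convergence alone does not carry moments over; they are truncated at
  \<open>A\<close>, at a cost of at most the next moment divided by \<open>A\<close>, uniformly in
  \<open>n\<close>.\<close>

theorem moment_limit_exists:
  fixes M :: "nat \<Rightarrow> real measure" and m :: "nat \<Rightarrow> real"
  assumes M: "\<And>n. real_distribution (M n)" and nn: "\<And>n. AE x in M n. 0 \<le> x"
    and int: "\<And>n s. integrable (M n) (\<lambda>x. x ^ s)"
    and lim: "\<And>s. (\<lambda>n. \<integral>x. x ^ s \<partial>M n) \<longlonglongrightarrow> m s"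
  obtains L r where "strict_mono r" "real_distribution L" "weak_conv_m (M \<circ> r) L" "AE x in L. 0 \<le> x"
    "\<And>s. has_bochner_integral L (\<lambda>x. x ^ s) (m s)"
proof -
  obtain B where B: "\<And>n. (\<integral>x. x \<partial>M n) \<le> B"
  proof -
    have "Bseq (\<lambda>n. \<integral>x. x ^ 1 \<partial>M n)" using lim[of 1] by (rule convergent_imp_Bseq[OF convergentI])
    then show ?thesis using that unfolding Bseq_def by (auto simp: abs_le_iff)
  qed
  have "tight M"
    by (rule tight_of_bounded_expectation[OF M nn _ B]) (use int[of _ 1] in simp)
  from tight_imp_convergent_subsubsequence[OF this strict_mono_id]
  obtain r L where r: "strict_mono r" and L: "real_distribution L" and w: "weak_conv_m (M \<circ> r) L"
    by (auto simp: o_def)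
  interpret L: real_distribution L by (rule L)
  have Mr: "real_distribution ((M \<circ> r) n)" for n using M by simp
  have conv: "(\<lambda>n. \<integral>x. f x \<partial>(M (r n))) \<longlonglongrightarrow> (\<integral>x. f x \<partial>L)"
    if "\<And>x. isCont f x" "\<And>x. \<bar>f x\<bar> \<le> C" for f :: "real \<Rightarrow> real" and C
    using weak_conv_imp_integral_bdd_continuous_conv[OF Mr L w that(1), of C] that(2) by simp
  have Lnn: "AE x in L. 0 \<le> x"
  proof -
    \<comment> \<open>A bounded continuous test function that is positive exactly on the negative
      numbers.\<close>
    define f where "f = (\<lambda>x::real. min 1 (max 0 (- x)))"
    have "(\<lambda>n. \<integral>x. f x \<partial>(M (r n))) \<longlonglongrightarrow> (\<integral>x. f x \<partial>L)"
      by (rule conv[of f 1]) (auto simp: f_def intro!: continuous_intros)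
    moreover have "(\<integral>x. f x \<partial>(M (r n))) = 0" for n
    proof -
      have "(\<integral>x. f x \<partial>(M (r n))) = (\<integral>x. 0 \<partial>(M (r n)))"
      proof (rule integral_cong_AE)
        show "AE x in M (r n). f x = 0" using nn[of "r n"] by eventually_elim (simp add: f_def)
        interpret real_distribution "M (r n)" by (rule M)
        show "f \<in> borel_measurable (M (r n))" unfolding f_def by measurable
      qed simp
      then show ?thesis by simp
    qed
    ultimately have "(\<integral>x. f x \<partial>L) = 0" by (simp add: LIMSEQ_const_iff)
    moreover have "integrable L f"
      by (rule L.integrable_const_bound[where B=1]) (auto simp: f_def)
    ultimately have "AE x in L. f x = 0"
      by (subst (asm) integral_nonneg_eq_0_iff_AE) (auto simp: f_def)
    then show ?thesis by eventually_elim (auto simp: f_def min_def max_def split: if_splits)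
  qed
  have "has_bochner_integral L (\<lambda>x. x ^ s) (m s)" for s
  proof -
    \<comment> \<open>Clamping to \<open>[0, A]\<close> before taking the power gives bounded
      continuous functions that increase to \<open>x ^ s\<close> for \<open>x \<ge> 0\<close> as
      \<open>A\<close> grows.\<close>
    define h where "h = (\<lambda>A x::real. (max 0 (min x A)) ^ s)"
    have hb: "\<bar>h A x\<bar> \<le> \<bar>A\<bar> ^ s" for A x
      unfolding h_def power_abs by (intro power_mono) auto
    have hL: "(\<lambda>n. \<integral>x. h A x \<partial>(M (r n))) \<longlonglongrightarrow> (\<integral>x. h A x \<partial>L)" for A
      by (rule conv[OF _ hb]) (auto simp: h_def intro!: continuous_intros)
    have close: "\<bar>m s - (\<integral>x. h A x \<partial>L)\<bar> \<le> m (Suc s) / A" if A: "0 < A" for A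
    proof -
      have "\<bar>(\<integral>x. x ^ s \<partial>(M (r n))) - (\<integral>x. h A x \<partial>(M (r n)))\<bar> \<le> (\<integral>x. x ^ Suc s \<partial>(M (r n))) / A" for n
      proof -
        interpret Mn: real_distribution "M (r n)" by (rule M)
        have ih: "integrable (M (r n)) (h A)"
          by (rule Mn.integrable_const_bound[where B="\<bar>A\<bar> ^ s"]) (use hb in \<open>auto simp: h_def\<close>)
        have "(\<integral>x. x ^ s \<partial>(M (r n))) - (\<integral>x. h A x \<partial>(M (r n))) = (\<integral>x. x ^ s - h A x \<partial>(M (r n)))"
          using int ih by simp
        also have "\<bar>\<dots>\<bar> \<le> (\<integral>x. \<bar>x ^ s - h A x\<bar> \<partial>(M (r n)))"
          by (rule integral_abs_bound)
        also have "\<dots> \<le> (\<integral>x. x ^ Suc s / A \<partial>(M (r n)))"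
        proof (rule integral_mono_AE)
          show "AE x in M (r n). \<bar>x ^ s - h A x\<bar> \<le> x ^ Suc s / A"
            using nn[of "r n"]
          proof eventually_elim
            case (elim x)
            show ?case
            proof (cases "x \<le> A")
              case True
              then show ?thesis using elim A by (simp add: h_def)
            next
              case False
              have "A ^ s \<le> x ^ s" using False A by (intro power_mono) auto
              moreover have "A * x ^ s \<le> x * x ^ s" using False elim by (intro mult_right_mono) auto
              then have "x ^ s \<le> x ^ Suc s / A" using A by (simp add: le_divide_eq mult.commute)
              moreover have "0 \<le> A ^ s" using A by simp
              ultimately have "\<bar>x ^ s - A ^ s\<bar> \<le> x ^ Suc s / A" by linarith
              moreover have "h A x = A ^ s" using False A by (simp add: h_def)
              ultimately show ?thesis by simp
            qed
          qed
          show "integrable (M (r n)) (\<lambda>x. \<bar>x ^ s - h A x\<bar>)" using int ih by auto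
          show "integrable (M (r n)) (\<lambda>x. x ^ Suc s / A)" by (intro integrable_divide int)
        qed
        finally show ?thesis by simp
      qed
      moreover have "(\<lambda>n. \<bar>(\<integral>x. x ^ s \<partial>(M (r n))) - (\<integral>x. h A x \<partial>(M (r n)))\<bar>) \<longlonglongrightarrow> \<bar>m s - (\<integral>x. h A x \<partial>L)\<bar>"
        using LIMSEQ_subseq_LIMSEQ[OF lim r] by (intro tendsto_intros hL) (simp add: o_def)
      moreover have "(\<lambda>n. (\<integral>x. x ^ Suc s \<partial>(M (r n))) / A) \<longlonglongrightarrow> m (Suc s) / A"
        using LIMSEQ_subseq_LIMSEQ[OF lim r, of "Suc s"] A by (intro tendsto_intros) (auto simp: o_def)
      ultimately show ?thesis by (intro LIMSEQ_le) auto
    qed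
    have lim_h: "(\<lambda>i. \<integral>x. h (real (Suc i)) x \<partial>L) \<longlonglongrightarrow> m s"
    proof (rule LIM_zero_cancel, rule tendsto_rabs_zero_cancel,
        rule tendsto_sandwich[where f = "\<lambda>_. 0"])
      show "eventually (\<lambda>i. \<bar>(\<integral>x. h (real (Suc i)) x \<partial>L) - m s\<bar> \<le> m (Suc s) / real (Suc i)) sequentially"
        using close[of "real (Suc _)"] by (intro always_eventually allI) (simp add: abs_minus_commute)
      show "(\<lambda>i. m (Suc s) / real (Suc i)) \<longlonglongrightarrow> 0"
        by (rule LIMSEQ_Suc[OF lim_const_over_n])
    qed auto
    have int_h: "integrable L (h A)" for A
      by (rule L.integrable_const_bound[where B="\<bar>A\<bar> ^ s"]) (use hb in \<open>auto simp: h_def\<close>)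
    have mono_h: "AE x in L. mono (\<lambda>i. h (real (Suc i)) x)"
      by (intro always_eventually allI monoI) (auto simp: h_def intro!: power_mono)
    have lim_h': "AE x in L. (\<lambda>i. h (real (Suc i)) x) \<longlonglongrightarrow> x ^ s"
      using Lnn
    proof eventually_elim
      case (elim x)
      show ?case
      proof (rule tendsto_eventually)
        have "eventually (\<lambda>i. x \<le> real i) sequentially"
          by (meson eventually_sequentiallyI le_trans of_nat_le_iff real_arch_simple order_trans)
        then show "eventually (\<lambda>i. h (real (Suc i)) x = x ^ s) sequentially"
          by eventually_elim (use elim in \<open>auto simp: h_def\<close>)
      qed
    qed
    have meas: "(\<lambda>x. x ^ s) \<in> borel_measurable L" by simp
    show ?thesis
      unfolding has_bochner_integral_iff
      using integrable_monotone_convergence[OF int_h mono_h lim_h' lim_h meas]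
        integral_monotone_convergence[OF int_h mono_h lim_h' lim_h meas] by blast
  qed
  with r L w Lnn show ?thesis by (rule that)
qed

text \<open>A tent function lies between the indicators of \<open>{0}\<close> and of the interval of
  radius \<open>\<delta>\<close>. The uniform bound passes to the weak limit through it, and then
  \<open>\<delta>\<close> tends to \<open>0\<close>.\<close>

lemma no_atom_at_0:
  fixes M :: "nat \<Rightarrow> real measure"
  assumes M: "\<And>n. real_distribution (M n)" and L: "real_distribution L" and w: "weak_conv_m M L"
    and \<epsilon>: "0 < \<epsilon>" and C: "\<And>n \<delta>. 0 < \<delta> \<Longrightarrow> measure (M n) {-\<delta><..<\<delta>} \<le> C * \<delta> powr \<epsilon>"
  shows "measure L {0} = 0"
proof -
  interpret L: real_distribution L by (rule L)
  have *: "measure L {0} \<le> C * \<delta> powr \<epsilon>" if \<delta>: "0 < \<delta>" for \<delta>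
  proof -
    define f where "f = (\<lambda>x::real. max 0 (1 - \<bar>x\<bar> / \<delta>))"
    have f01: "0 \<le> f x" "f x \<le> 1" "\<bar>f x\<bar> \<le> 1" for x using \<delta> by (auto simp: f_def)
    have fi: "integrable N f" if "real_distribution N" for N
    proof -
      interpret real_distribution N by fact
      show ?thesis by (rule integrable_const_bound[where B=1]) (use f01 in \<open>auto simp: f_def\<close>)
    qed
    have "(\<lambda>n. \<integral>x. f x \<partial>(M n)) \<longlonglongrightarrow> (\<integral>x. f x \<partial>L)"
      by (rule weak_conv_imp_integral_bdd_continuous_conv[OF M L w, where B=1])
         (use \<delta> f01 in \<open>auto simp: f_def intro!: continuous_intros\<close>)
    moreover have "(\<integral>x. f x \<partial>(M n)) \<le> C * \<delta> powr \<epsilon>" for n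
    proof -
      interpret Mn: real_distribution "M n" by (rule M)
      have "(\<integral>x. f x \<partial>(M n)) \<le> (\<integral>x. indicator {-\<delta><..<\<delta>} x \<partial>(M n))"
      proof (rule integral_mono)
        show "integrable (M n) (indicator {-\<delta><..<\<delta>} :: real \<Rightarrow> real)"
          by (simp add: integrable_indicator_iff less_top[symmetric])
        show "f x \<le> indicator {-\<delta><..<\<delta>} x" for x
          using \<delta> f01[of x] by (auto simp: f_def indicator_def le_divide_eq abs_less_iff)
      qed (rule fi[OF M])
      also have "\<dots> = measure (M n) {-\<delta><..<\<delta>}" by simp
      finally show ?thesis using C[OF \<delta>, of n] by simp
    qed
    ultimately have "(\<integral>x. f x \<partial>L) \<le> C * \<delta> powr \<epsilon>"
      by (intro LIMSEQ_le_const2) auto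
    moreover have "(\<integral>x. indicator {0} x \<partial>L) \<le> (\<integral>x. f x \<partial>L)"
    proof (rule integral_mono)
      show "integrable L (indicator {0} :: real \<Rightarrow> real)"
        by (simp add: integrable_indicator_iff less_top[symmetric])
      show "indicator {0} x \<le> f x" for x
        using f01[of x] by (auto simp: f_def indicator_def)
    qed (rule fi[OF L])
    ultimately show ?thesis by simp
  qed
  have "((\<lambda>\<delta>. C * \<delta> powr \<epsilon>) \<longlongrightarrow> C * 0) (at_right 0)"
    using \<epsilon> by (intro tendsto_intros tendsto_zero_powrI[where b=\<epsilon>]) (auto intro: eventually_mono[OF eventually_at_right_less])
  then have "measure L {0} \<le> C * 0"
    by (rule tendsto_lowerbound) (auto simp: eventually_at_right_field * intro!: exI[of _ 1])
  then show ?thesis using measure_nonneg[of L "{0}"] by simp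
qed

section \<open>Coefficients of compositions\<close>

lemma cfps_mult: "cfps (f * g) = cfps f * cfps g"
  by (simp add: fps_eq_iff fps_mult_nth)

lemma cfps_1: "cfps 1 = 1"
  by (simp add: fps_eq_iff)

lemma cfps_power: "cfps (f ^ k) = cfps f ^ k"
  by (induction k) (simp_all add: cfps_1 cfps_mult)

lemma cfps_compose: "cfps (f oo g) = cfps f oo cfps g"
  by (simp add: fps_eq_iff fps_compose_nth cfps_power[symmetric])

text \<open>All \<open>N\<close> are required because the \<open>s\<close>-th moment consumes
  \<open>s\<close> derivatives before the three of the transfer.\<close>

definition fps_sing :: "real fps \<Rightarrow> real \<Rightarrow> real \<Rightarrow> real \<Rightarrow> bool" where
  "fps_sing f \<tau> c l \<longleftrightarrow> 1 \<le> fps_conv_radius (cfps f) \<and>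
     (\<forall>N. sing_type N l c (\<lambda>z. eval_fps (cfps f) z - of_real \<tau>))"

lemma fps_sing_expansion:
  assumes "fps_sing f \<tau> c l"
  shows "eval_fps (cfps f) has_fps_expansion cfps f"
proof (rule eval_fps_has_fps_expansion)
  have "(0::ereal) < 1" by simp
  then show "0 < fps_conv_radius (cfps f)"
    using assms unfolding fps_sing_def by (meson less_le_trans)
qed

lemma fps_sing_sing_type_0:
  assumes "fps_sing f \<tau> c l" "0 < l"
  shows "sing_type N 0 \<tau> (eval_fps (cfps f))"
proof -
  have "sing_type N 0 0 (\<lambda>z. eval_fps (cfps f) z - of_real \<tau>)"
    using assms by (intro sing_type_weaken[of N l c]) (auto simp: fps_sing_def)
  from sing_type_add[OF this sing_type_const[of N \<tau>]] show ?thesis by simp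
qed

text \<open>The value \<open>\<tau>\<close> at the singular point affects the coefficient of index
  \<open>0\<close> only.\<close>

lemma real_transfer:
  assumes F: "\<phi> has_fps_expansion cfps f" and \<phi>: "sing_type 3 a c (\<lambda>z. \<phi> z - of_real \<tau>)" and a: "a < 1"
  shows "(\<lambda>n. fps_nth f n * real n powr (a + 1)) \<longlonglongrightarrow> c * rGamma (- a)"
proof -
  have "(\<lambda>z. \<phi> z - of_real \<tau>) has_fps_expansion cfps f - fps_const (of_real \<tau>)"
    by (intro has_fps_expansion_diff F has_fps_expansion_const)
  from transfer[OF \<phi> this a]
  have "(\<lambda>n. fps_nth (cfps f - fps_const (of_real \<tau>)) n * of_real (real n powr (a + 1))) \<longlonglongrightarrow> complex_of_real (c * rGamma (- a))" .
  then have "(\<lambda>n. complex_of_real (fps_nth f n * real n powr (a + 1))) \<longlonglongrightarrow> complex_of_real (c * rGamma (- a))"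
    by (rule Lim_transform_eventually) (auto intro: eventually_mono[OF eventually_gt_at_top[of 0]])
  then show ?thesis by (simp only: tendsto_of_real_iff)
qed

lemma rGamma_neg:
  assumes "0 < l" "l < 1"
  shows "rGamma (- l :: real) < 0"
proof -
  have "rGamma (- l) = - l * rGamma (1 - l)" using rGamma_plus1[of "- l"] by simp
  moreover have "0 < rGamma (1 - l)" using assms Gamma_real_pos[of "1 - l"] by (simp add: rGamma_inverse_Gamma)
  ultimately show ?thesis using assms by (simp add: mult_neg_pos)
qed

lemma fps_sing_coeff_asymptotic:
  assumes "fps_sing f \<tau> c l" "l < 1"
  shows "(\<lambda>n. fps_nth f n * real n powr (l + 1)) \<longlonglongrightarrow> c * rGamma (- l)"
  using assms by (intro real_transfer[OF fps_sing_expansion]) (auto simp: fps_sing_def)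

lemma eventually_pos_of_powr_limit:
  assumes "(\<lambda>n. f n * real n powr a) \<longlonglongrightarrow> L" "0 < L"
  shows "eventually (\<lambda>n. 0 < f n) sequentially"
  using order_tendstoD(1)[OF assms] by eventually_elim (metis mult_le_0_iff not_less powr_ge_zero)

text \<open>The limit \<open>c * rGamma (- l)\<close> of nonnegative terms is nonnegative, and the
  Gamma function is negative on \<open>(-1, 0)\<close>.\<close>

lemma fps_sing_nonneg_imp_c_neg:
  assumes "fps_sing f \<tau> c l" "0 < l" "l < 1" "c \<noteq> 0" "\<And>n. 0 \<le> fps_nth f n"
  shows "c < 0"
proof -
  have "0 \<le> c * rGamma (- l)"
    by (rule tendsto_lowerbound[OF fps_sing_coeff_asymptotic[OF assms(1,3)]])
       (auto intro!: always_eventually simp: assms(5))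
  then show ?thesis using rGamma_neg[OF assms(2,3)] assms(4) by (auto simp: zero_le_mult_iff)
qed

section \<open>The inner series and compositions with it\<close>

locale inner_series =
  fixes H :: "real fps" and l c :: real
  assumes nonneg: "\<And>n. 0 \<le> fps_nth H n" and H0: "fps_nth H 0 = 0"
    and sums_1: "(\<lambda>n. fps_nth H n) sums 1"
    and l: "0 < l" "l < 1" and c: "c \<noteq> 0" and sing: "fps_sing H 1 c l"
begin

abbreviation h :: "complex \<Rightarrow> complex" where "h \<equiv> eval_fps (cfps H)"

lemma c_neg: "c < 0"
  using fps_sing_nonneg_imp_c_neg[OF sing l c nonneg] .

lemma h_sums: "z \<in> ball 0 1 \<Longrightarrow> (\<lambda>n. of_real (fps_nth H n) * z ^ n) sums h z"
proof -
  assume z: "z \<in> ball 0 1"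
  have "ereal (norm z) < 1" using z by (simp add: one_ereal_def)
  then have "ereal (norm z) < fps_conv_radius (cfps H)"
    using sing unfolding fps_sing_def by (meson less_le_trans)
  from sums_eval_fps[OF this] show ?thesis by simp
qed

lemma h_holomorphic: "h holomorphic_on ball 0 1"
  using sing_type_holomorphic[OF fps_sing_sing_type_0[OF sing l(1)]] .

text \<open>As \<open>H(0) = 0\<close>, every term contains a factor \<open>z\<close>. Hence
  \<open>|h z| \<le> |z|\<close>, and the strict inequality survives.\<close>

lemma h_maps:
  assumes "z \<in> ball 0 1"
  shows "h z \<in> ball 0 1"
proof -
  have b: "norm (of_real (fps_nth H n) * z ^ n) \<le> fps_nth H n * norm z" for n
  proof (cases n)
    case (Suc m)
    have "norm z ^ Suc m \<le> norm z" using assms by (simp add: mult_left_le power_le_one)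
    then show ?thesis using nonneg[of n] by (simp add: norm_mult norm_power Suc mult_left_mono)
  qed (simp add: H0)
  have s: "(\<lambda>n. fps_nth H n * norm z) sums (1 * norm z)" by (intro sums_mult2 sums_1)
  have "norm (h z) \<le> 1 * norm z"
    unfolding sums_unique[OF h_sums[OF assms]] sums_unique[OF s]
    by (rule norm_suminf_le[OF b sums_summable[OF s]])
  then show ?thesis using assms by simp
qed

lemma K_sing_type: "sing_type N l (- c) (\<lambda>z. 1 - h z)"
proof -
  have "sing_type N l c (\<lambda>z. h z - of_real 1)" using sing by (simp add: fps_sing_def)
  from sing_type_cmult[OF this, of "-1"] show ?thesis by simp
qed

text \<open>Two consecutive coefficients of \<open>H\<close> are positive, so \<open>1 - H(z)\<close> vanishes in the closed disc at
  \<open>z = 1\<close> only.\<close>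

lemma h_lower_bound: "\<exists>m>0. \<forall>z\<in>ball 0 1. m * cmod (1 - z) powr l \<le> cmod (1 - h z)"
proof -
  have "0 < c * rGamma (- l)" using c_neg rGamma_neg[OF l] by (simp add: mult_neg_neg)
  then have "eventually (\<lambda>n. 0 < fps_nth H n) sequentially"
    using eventually_pos_of_powr_limit[OF fps_sing_coeff_asymptotic[OF sing l(2)]] by blast
  then obtain n0 where n0: "\<And>n. n0 \<le> n \<Longrightarrow> 0 < fps_nth H n" unfolding eventually_sequentially by blast
  define n where "n = Suc n0"
  \<comment> \<open>Two of the nonnegative terms of \<open>Re (1 - h z)\<close>. Unlike
    \<open>h\<close>, which is considered on the open disc, \<open>q\<close> is a polynomial
    expression and attains its minimum on compact parts of the closed disc.\<close>
  define q where "q z = fps_nth H n * (1 - Re (z ^ n)) + fps_nth H (Suc n) * (1 - Re (z ^ Suc n))" for z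
  have Hn: "0 < fps_nth H n" "0 < fps_nth H (Suc n)" using n0 by (auto simp: n_def)
  have Re_le: "Re (z ^ k) \<le> 1" if "cmod z \<le> 1" for z k
    using complex_Re_le_cmod[of "z ^ k"] that by (simp add: norm_power power_le_one order_trans)
  have q_le: "q z \<le> cmod (1 - h z)" if z: "z \<in> ball 0 1" for z
  proof -
    have 1: "(\<lambda>k. fps_nth H k - fps_nth H k * Re (z ^ k)) sums (1 - Re (h z))"
      using sums_diff[OF sums_1 sums_Re[OF h_sums[OF z]]] by simp
    have "(\<Sum>k\<in>{n, Suc n}. fps_nth H k - fps_nth H k * Re (z ^ k)) \<le> (\<Sum>k. fps_nth H k - fps_nth H k * Re (z ^ k))"
      using sums_summable[OF 1]
    proof (rule sum_le_suminf)
      show "0 \<le> fps_nth H k - fps_nth H k * Re (z ^ k)" for k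
        using mult_left_mono[OF Re_le[of z k] nonneg[of k]] z by simp
    qed simp
    then have "q z \<le> Re (1 - h z)"
      using sums_unique[OF 1] by (simp add: q_def right_diff_distrib)
    then show ?thesis using complex_Re_le_cmod[of "1 - h z"] by linarith
  qed
  have q_pos: "0 < q z" if z: "cmod z \<le> 1" "z \<noteq> 1" for z
  proof (rule ccontr)
    assume "\<not> 0 < q z"
    moreover have "0 \<le> fps_nth H n * (1 - Re (z ^ n))" "0 \<le> fps_nth H (Suc n) * (1 - Re (z ^ Suc n))"
      using Re_le[OF z(1), of n] Re_le[OF z(1), of "Suc n"] Hn
      by (auto intro!: mult_nonneg_nonneg simp del: power_Suc)
    ultimately have "fps_nth H n * (1 - Re (z ^ n)) = 0" "fps_nth H (Suc n) * (1 - Re (z ^ Suc n)) = 0"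
      unfolding q_def by linarith+
    then have Re1: "Re (z ^ n) = 1" "Re (z ^ Suc n) = 1" using Hn by auto
    have eq1: "w = 1" if "Re w = 1" "cmod w \<le> 1" for w
    proof -
      have "(Re w)\<^sup>2 + (Im w)\<^sup>2 \<le> 1" using that(2) by (simp add: cmod_def)
      then show ?thesis using that(1) by (simp add: complex_eq_iff)
    qed
    \<comment> \<open>Consecutive exponents are coprime, so this forces
      \<open>z = 1\<close>.\<close>
    have "z ^ n = 1" "z ^ Suc n = 1"
      using Re1 z(1) by (auto intro!: eq1 simp: norm_power power_le_one simp del: power_Suc)
    then show False using z(2) by simp
  qed
  have "((\<lambda>z. cmod ((1 - h z) / (1 - z) powr of_real l)) \<longlongrightarrow> cmod (of_real (- c))) (at 1 within ball 0 1)"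
    using sing_type_imp_sing_lim[OF K_sing_type] unfolding sing_lim_def by (intro tendsto_norm) blast
  then have "eventually (\<lambda>z. - c / 2 < cmod ((1 - h z) / (1 - z) powr of_real l)) (at 1 within ball 0 1)"
    by (rule order_tendstoD) (use c_neg in simp)
  then obtain d where d: "0 < d" "\<And>z. z \<in> ball 0 1 \<Longrightarrow> z \<noteq> 1 \<Longrightarrow> dist z 1 < d \<Longrightarrow>
      - c / 2 < cmod ((1 - h z) / (1 - z) powr of_real l)"
    unfolding eventually_at by metis
  have comp: "compact (cball 0 1 - ball (1::complex) d)"
    by (simp add: compact_diff)
  obtain k where k: "0 < k" "\<And>z. z \<in> cball 0 1 - ball 1 d \<Longrightarrow> k \<le> q z"
  proof (cases "cball 0 1 - ball (1::complex) d = {}")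
    case True
    show ?thesis using that[of 1] unfolding True by simp
  next
    case False
    have "continuous_on (cball 0 1 - ball 1 d) q" unfolding q_def by (intro continuous_intros)
    from continuous_attains_inf[OF comp False this]
    obtain w where w: "w \<in> cball 0 1 - ball 1 d" "\<And>z. z \<in> cball 0 1 - ball 1 d \<Longrightarrow> q w \<le> q z" by blast
    have "0 < q w" using w(1) d(1) by (intro q_pos) auto
    then show ?thesis using that w(2) by blast
  qed
  \<comment> \<open>The first value serves near \<open>1\<close>, where the quotient tends to
    \<open>- c\<close> in modulus; the second serves elsewhere, since
    \<open>|1 - z| \<le> 2\<close>.\<close>
  define m where "m = min (- c / 2) (k / 2 powr l)"
  have m: "0 < m" "m \<le> - c / 2" "m \<le> k / 2 powr l" using c_neg k(1) by (auto simp: m_def)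
  have "m * cmod (1 - z) powr l \<le> cmod (1 - h z)" if z: "z \<in> ball 0 1" for z
  proof (cases "dist z 1 < d")
    case True
    have z1: "1 - z \<noteq> 0" using one_minus_nonzero_unit_disc[OF z] .
    then have "- c / 2 < cmod (1 - h z) / cmod (1 - z) powr l"
      using d(2)[OF z _ True] by (auto simp: norm_divide norm_powr_of_real)
    then have "m \<le> cmod (1 - h z) / cmod (1 - z) powr l" using m by linarith
    then show ?thesis using z1 by (simp add: le_divide_eq)
  next
    case False
    have "cmod (1 - z) \<le> 2" using norm_triangle_ineq4[of 1 z] z by simp
    then have "m * cmod (1 - z) powr l \<le> k / 2 powr l * 2 powr l"
      using m l k(1) by (intro mult_mono powr_mono2) auto
    also have "\<dots> = k" by simp
    also have "k \<le> q z" using False z by (intro k(2)) (auto simp: dist_commute)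
    also have "\<dots> \<le> cmod (1 - h z)" by (rule q_le[OF z])
    finally show ?thesis .
  qed
  with m(1) show ?thesis by blast
qed

lemma compose_sing_type:
  assumes "sing_type N a d \<phi>"
  shows "sing_type N (l * a) (d * (- c) powr a) (\<lambda>z. \<phi> (h z))"
proof -
  obtain m where "0 < m" "\<And>z. z \<in> ball 0 1 \<Longrightarrow> m * cmod (1 - z) powr l \<le> cmod (1 - h z)"
    using h_lower_bound by blast
  then show ?thesis
    using assms c_neg l
    by (intro sing_type_compose[OF _ h_holomorphic h_maps K_sing_type, where m = m]) auto
qed

lemma h_expansion: "h has_fps_expansion cfps H"
  using fps_sing_expansion[OF sing] .

text \<open>Here the outer function is of type \<open>(a, d)\<close> itself, with no constant
  subtracted, as holds for the moment series. Therefore \<open>M\<close> enters only through its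
  value \<open>\<tau>\<close>.\<close>

lemma compose_coeff_asymptotic:
  assumes A: "\<phi> has_fps_expansion cfps A" and \<phi>: "sing_type 3 a d \<phi>" and a: "l * a < 1"
    and M: "fps_sing M \<tau> e k" "0 < k"
  shows "(\<lambda>n. fps_nth ((A oo H) * M) n * real n powr (l * a + 1)) \<longlonglongrightarrow>
    d * (- c) powr a * \<tau> * rGamma (- (l * a))"
proof (rule real_transfer[where \<tau> = 0])
  have "(\<phi> \<circ> h) has_fps_expansion (cfps A oo cfps H)"
    by (intro has_fps_expansion_compose A h_expansion) (simp add: H0)
  then show "(\<lambda>z. \<phi> (h z) * eval_fps (cfps M) z) has_fps_expansion cfps ((A oo H) * M)"
    unfolding cfps_mult cfps_compose o_def
    by (intro has_fps_expansion_mult fps_sing_expansion[OF M(1)])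
  have "sing_type 3 (l * a + 0) (d * (- c) powr a * \<tau>) (\<lambda>z. \<phi> (h z) * eval_fps (cfps M) z)"
    by (intro sing_type_mult compose_sing_type \<phi> fps_sing_sing_type_0[OF M])
  then show "sing_type 3 (l * a) (d * (- c) powr a * \<tau>) (\<lambda>z. \<phi> (h z) * eval_fps (cfps M) z - of_real 0)"
    by simp
qed (rule a)

lemma compose_coeff_asymptotic_confluent:
  assumes G: "fps_sing G \<tau>\<^sub>G c\<^sub>G a" "0 < a" "a < 1" and M: "fps_sing M \<tau>\<^sub>M c\<^sub>M (l * a)"
  shows "(\<lambda>n. fps_nth ((G oo H) * M) n * real n powr (l * a + 1)) \<longlonglongrightarrow>
    (c\<^sub>G * (- c) powr a * \<tau>\<^sub>M + \<tau>\<^sub>G * c\<^sub>M) * rGamma (- (l * a))"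
proof (rule real_transfer[where \<tau> = "\<tau>\<^sub>G * \<tau>\<^sub>M"])
  let ?g = "eval_fps (cfps G)" and ?m = "eval_fps (cfps M)"
  have la: "0 < l * a" using G l by simp
  have "(?g \<circ> h) has_fps_expansion (cfps G oo cfps H)"
    by (intro has_fps_expansion_compose fps_sing_expansion[OF G(1)] h_expansion) (simp add: H0)
  then show "(\<lambda>z. ?g (h z) * ?m z) has_fps_expansion cfps ((G oo H) * M)"
    unfolding cfps_mult cfps_compose o_def
    by (intro has_fps_expansion_mult fps_sing_expansion[OF M(1)])
  have "sing_type 3 a c\<^sub>G (\<lambda>z. ?g z - of_real \<tau>\<^sub>G)" using G by (simp add: fps_sing_def)
  from sing_type_mult[OF compose_sing_type[OF this] fps_sing_sing_type_0[OF M la]]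
  have "sing_type 3 (l * a) (c\<^sub>G * (- c) powr a * \<tau>\<^sub>M) (\<lambda>z. (?g (h z) - of_real \<tau>\<^sub>G) * ?m z)" by simp
  moreover have "sing_type 3 (l * a) (\<tau>\<^sub>G * c\<^sub>M) (\<lambda>z. of_real \<tau>\<^sub>G * (?m z - of_real \<tau>\<^sub>M))"
    using M by (intro sing_type_cmult) (simp add: fps_sing_def)
  ultimately have "sing_type 3 (l * a) (c\<^sub>G * (- c) powr a * \<tau>\<^sub>M + \<tau>\<^sub>G * c\<^sub>M)
     (\<lambda>z. (?g (h z) - of_real \<tau>\<^sub>G) * ?m z + of_real \<tau>\<^sub>G * (?m z - of_real \<tau>\<^sub>M))"
    by (rule sing_type_add)
  then show "sing_type 3 (l * a) (c\<^sub>G * (- c) powr a * \<tau>\<^sub>M + \<tau>\<^sub>G * c\<^sub>M)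
     (\<lambda>z. ?g (h z) * ?m z - of_real (\<tau>\<^sub>G * \<tau>\<^sub>M))"
    by (simp add: algebra_simps)
  show "l * a < 1" using G l mult_strict_mono[of l 1 a 1] by simp
qed

text \<open>Passing from \<open>k\<close> to \<open>k + 1\<close> adds \<open>(h - 1) h^k M\<close>.
  The factor \<open>h - 1\<close> has the exponent \<open>l > a\<close>, so the change is negligible
  and the limit does not depend on \<open>k\<close>.\<close>

lemma power_coeff_asymptotic:
  assumes M: "fps_sing M \<tau> e a" and a: "0 < a" "a < l"
  shows "(\<lambda>n. fps_nth (H ^ k * M) n * real n powr (a + 1)) \<longlonglongrightarrow> e * rGamma (- a)"
proof (rule real_transfer[where \<tau> = \<tau>])
  let ?m = "eval_fps (cfps M)"
  show "(\<lambda>z. h z ^ k * ?m z) has_fps_expansion cfps (H ^ k * M)"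
    unfolding cfps_mult cfps_power
    by (intro has_fps_expansion_mult has_fps_expansion_power h_expansion fps_sing_expansion[OF M])
  have m: "sing_type 3 a e (\<lambda>z. ?m z - of_real \<tau>)" using M by (simp add: fps_sing_def)
  have "sing_type 3 a 0 (\<lambda>z. 1 - h z)" by (rule sing_type_weaken[OF K_sing_type a(2)])
  from sing_type_cmult[OF this, of "-1"] have h1: "sing_type 3 a 0 (\<lambda>z. h z - 1)" by simp
  show "sing_type 3 a e (\<lambda>z. h z ^ k * ?m z - of_real \<tau>)"
  proof (induction k)
    case 0
    then show ?case using m by simp
  next
    case (Suc k)
    have "sing_type 3 0 \<tau> (\<lambda>z. h z ^ k * ?m z)"
      using sing_type_mult[OF sing_type_power[OF fps_sing_sing_type_0[OF sing l(1)], of 3 k] fps_sing_sing_type_0[OF M a(1)]]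
      by simp
    from sing_type_mult[OF h1 this] have "sing_type 3 a 0 (\<lambda>z. (h z - 1) * (h z ^ k * ?m z))" by simp
    from sing_type_add[OF Suc this] show ?case by (simp add: algebra_simps)
  qed
qed (use a l in simp)

end

section \<open>Moment series and the binomial series\<close>

definition moment_fps :: "nat \<Rightarrow> real fps \<Rightarrow> real fps" where
  "moment_fps s G = Abs_fps (\<lambda>k. real k ^ s * fps_nth G k)"

text \<open>Each application of \<open>z d/dz\<close> turns a type \<open>(b, e)\<close> into
  \<open>(b - 1, - b * e)\<close>; the factors multiply up to the Pochhammer symbol. The induction
  starts after one application, which is the point where the constant \<open>\<tau>\<close> has
  disappeared.\<close>

lemma moment_fps_sing_type:
  assumes G: "fps_sing G \<tau> d a"
  shows "\<exists>\<phi>. \<phi> has_fps_expansion cfps (moment_fps (Suc s) G) \<and>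
    (\<forall>N. sing_type N (a - real (Suc s)) (d * pochhammer (- a) (Suc s)) \<phi>)"
proof -
  have step: "sing_type N (b - 1) (- b * e) (\<lambda>z. z * deriv \<phi> z)"
    if "sing_type (Suc N) b e \<phi>" for N b e \<phi>
    using sing_type_mult[OF sing_type_ident[of N], of "b - 1" "- b * e" "deriv \<phi>"] that by simp
  have coeff: "cfps (moment_fps (Suc s) G) = fps_X * fps_deriv (cfps (moment_fps s G))" for s
    by (simp add: fps_eq_iff moment_fps_def mult_ac of_nat_diff)
  show ?thesis
  proof (induction s)
    case 0
    let ?g = "\<lambda>z. eval_fps (cfps G) z - of_real \<tau>"
    have "(\<lambda>z. z * deriv ?g z) has_fps_expansion fps_X * fps_deriv (cfps G - fps_const (of_real \<tau>))"
      by (intro has_fps_expansion_mult has_fps_expansion_deriv has_fps_expansion_diff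
          fps_sing_expansion[OF G] has_fps_expansion_const has_fps_expansion_fps_X)
    also have "fps_X * fps_deriv (cfps G - fps_const (of_real \<tau>)) = cfps (moment_fps (Suc 0) G)"
      by (simp add: coeff) (simp add: moment_fps_def cfps_def)
    finally have "(\<lambda>z. z * deriv ?g z) has_fps_expansion cfps (moment_fps (Suc 0) G)" .
    moreover have "sing_type N (a - 1) (- a * d) (\<lambda>z. z * deriv ?g z)" for N
      by (rule step) (use G in \<open>unfold fps_sing_def, blast\<close>)
    ultimately show ?case by (intro exI[of _ "\<lambda>z. z * deriv ?g z"]) (simp add: mult_ac)
  next
    case (Suc s)
    then obtain \<phi> where \<phi>: "\<phi> has_fps_expansion cfps (moment_fps (Suc s) G)"
      "\<And>N. sing_type N (a - real (Suc s)) (d * pochhammer (- a) (Suc s)) \<phi>" by blast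
    have "(\<lambda>z. z * deriv \<phi> z) has_fps_expansion cfps (moment_fps (Suc (Suc s)) G)"
      unfolding coeff[of "Suc s"]
      by (intro has_fps_expansion_mult has_fps_expansion_deriv \<phi> has_fps_expansion_fps_X)
    moreover have "sing_type N (a - real (Suc (Suc s))) (d * pochhammer (- a) (Suc (Suc s))) (\<lambda>z. z * deriv \<phi> z)" for N
    proof -
      have "a - real (Suc (Suc s)) = a - real (Suc s) - 1" by simp
      moreover have "d * pochhammer (- a) (Suc (Suc s)) = - (a - real (Suc s)) * (d * pochhammer (- a) (Suc s))"
        unfolding pochhammer_Suc[of _ "Suc s"] by simp
      ultimately show ?thesis using step[OF \<phi>(2)[of "Suc N"]] by (simp only:)
    qed
    ultimately show ?case by blast
  qed
qed

text \<open>The series of \<open>1 - (1 - z)^a\<close>, for \<open>0 < a < 1\<close> the generating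
  function of the Sibuya distribution.\<close>

definition binomial_fps :: "real \<Rightarrow> real fps" where
  "binomial_fps a = Abs_fps (\<lambda>k. if k = 0 then 0 else - pochhammer (- a) k / fact k)"

lemma binomial_fps_pos:
  assumes "0 < a" "a < 1" "0 < k"
  shows "0 < fps_nth (binomial_fps a) k"
proof -
  obtain j where j: "k = Suc j" using assms by (cases k) auto
  have "pochhammer (- a) k = - a * pochhammer (1 - a) j" by (simp add: j pochhammer_rec)
  moreover have "0 < pochhammer (1 - a) j" using assms by (intro pochhammer_pos) simp
  ultimately show ?thesis using assms by (simp add: binomial_fps_def)
qed

lemma fps_sing_binomial: "fps_sing (binomial_fps a) 1 (-1) a"
proof -
  let ?f = "\<lambda>z. 1 - (1 - z) powr complex_of_real a"
  have "?f has_fps_expansion 1 - Abs_fps (\<lambda>n. (-1) ^ n * (complex_of_real a gchoose n))"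
    by (intro has_fps_expansion_diff has_fps_expansion_1 has_fps_expansion_one_minus_powr)
  also have "1 - Abs_fps (\<lambda>n. (-1) ^ n * (complex_of_real a gchoose n)) = cfps (binomial_fps a)"
  proof -
    have "pochhammer (- complex_of_real a) n = of_real (pochhammer (- a) n)" for n
      by (simp only: pochhammer_of_real of_real_minus[symmetric])
    then show ?thesis by (auto simp: fps_eq_iff binomial_fps_def gbinomial_pochhammer)
  qed
  finally have F: "?f has_fps_expansion cfps (binomial_fps a)" .
  have hol: "?f holomorphic_on ball 0 1"
    using one_minus_not_nonpos_unit_disc by (intro holomorphic_intros) auto
  have "?f holomorphic_on eball 0 1" using hol by (simp add: eball_def one_ereal_def ball_def)
  from has_fps_expansion_imp_sums_complex[OF F this]
  have sums: "(\<lambda>n. fps_nth (cfps (binomial_fps a)) n * z ^ n) sums ?f z" if "z \<in> ball 0 1" for z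
    using that by (simp add: one_ereal_def)
  have "1 \<le> fps_conv_radius (cfps (binomial_fps a))"
    unfolding fps_conv_radius_def
  proof (rule conv_radius_geI_ex)
    fix r :: real assume "0 < r" "ereal r < 1"
    then have "of_real r \<in> ball (0::complex) 1" "norm (of_real r :: complex) = r"
      by (auto simp: one_ereal_def)
    then show "\<exists>z. norm z = r \<and> summable (\<lambda>n. fps_nth (cfps (binomial_fps a)) n * z ^ n)"
      using sums_summable[OF sums] by blast
  qed
  moreover have "eval_fps (cfps (binomial_fps a)) z = ?f z" if "z \<in> ball 0 1" for z
    using sums_unique[OF sums[OF that]] by (simp add: eval_fps_def)
  then have "sing_type N a (-1) (\<lambda>z. eval_fps (cfps (binomial_fps a)) z - of_real 1)" for N
    using sing_type_cmult[OF sing_type_powr[of N a], of "-1"]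
    by (subst sing_type_cong[where g = "\<lambda>z. of_real (-1) * (1 - z) powr of_real a"])
       auto
  ultimately show ?thesis by (simp add: fps_sing_def)
qed

text \<open>Singular coefficient \<open>0\<close> with any exponent: this lets \<open>M = 1\<close>
  count as confluent, with \<open>p = 0\<close>.\<close>

lemma fps_sing_1: "fps_sing 1 1 0 a"
  by (simp add: fps_sing_def cfps_1 sing_type_zero)

section \<open>Moments of the core size\<close>

lemma real_distribution_rescaled: "real_distribution (rescaled a P)"
  unfolding rescaled_def real_distribution_def real_distribution_axioms_def
  by (simp add: measure_pmf.prob_space_distr)

lemma AE_rescaled_nonneg: "0 \<le> a \<Longrightarrow> AE x in rescaled a P. 0 \<le> x"
  unfolding rescaled_def by (subst AE_distr_iff) (auto simp: AE_measure_pmf_iff)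

lemma rescaled_moments:
  assumes "set_pmf P \<subseteq> {..n}"
  shows "integrable (rescaled a P) (\<lambda>x. x ^ s)"
    and "(\<integral>x. x ^ s \<partial>rescaled a P) = (\<Sum>k\<le>n. pmf P k * (real k / a) ^ s)"
proof -
  have fin: "finite (set_pmf P)" using assms finite_subset by blast
  show "integrable (rescaled a P) (\<lambda>x. x ^ s)"
    unfolding rescaled_def
    by (subst integrable_distr_eq) (auto intro!: integrable_measure_pmf_finite fin)
  have "(\<integral>x. x ^ s \<partial>rescaled a P) = (\<integral>k. (real k / a) ^ s \<partial>measure_pmf P)"
    unfolding rescaled_def by (subst integral_distr) auto
  also have "\<dots> = (\<Sum>k\<le>n. pmf P k * (real k / a) ^ s)"
    using assms by (subst integral_measure_pmf[of "{..n}"]) auto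
  finally show "(\<integral>x. x ^ s \<partial>rescaled a P) = (\<Sum>k\<le>n. pmf P k * (real k / a) ^ s)" .
qed

lemma prob_eq_sum:
  assumes "set_pmf P \<subseteq> {..n::nat}"
  shows "measure_pmf.prob P S = (\<Sum>k\<le>n. pmf P k * indicator S k)"
proof -
  have "measure_pmf.prob P S = (\<integral>k. indicator S k \<partial>measure_pmf P)" by simp
  also have "\<dots> = (\<Sum>k\<le>n. pmf P k * indicator S k)"
    using assms by (subst integral_measure_pmf[of "{..n}"]) auto
  finally show ?thesis .
qed

lemma compose_nth_eq_sum:
  fixes G H M :: "real fps"
  assumes "fps_nth H 0 = 0"
  shows "fps_nth ((G oo H) * M) n = (\<Sum>k\<le>n. fps_nth G k * fps_nth (H ^ k * M) n)"
  using ext_scheme_at_1_nth[OF assms] by (simp add: ext_scheme_at_1_def ext_scheme_nth)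

section \<open>Moments of the Mittag-Leffler law and their growth\<close>

definition ml_moment :: "real \<Rightarrow> real \<Rightarrow> nat \<Rightarrow> real" where
  "ml_moment \<alpha> \<beta> s = Gamma (real s + \<beta> / \<alpha> + 1) * Gamma (\<beta> + 1) /
         (Gamma (\<alpha> * real s + \<beta> + 1) * Gamma (\<beta> / \<alpha> + 1))"

text \<open>Euler's integral is restricted to \<open>[A, 2 A]\<close>, and each factor of the
  integrand is replaced by its minimum there. As \<open>A\<close> is free, the Gamma function
  outgrows every geometric sequence.\<close>

lemma Gamma_exponential_lower_bound:
  fixes x A :: real
  assumes "1 \<le> x" "0 < A"
  shows "A powr x * exp (- 2 * A) \<le> Gamma x"
proof -
  let ?f = "\<lambda>t::real. t powr (x - 1) / exp t"
  have G: "(?f has_integral Gamma x) {0..}" by (rule Gamma_integral_real) (use assms in simp)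
  have int: "?f integrable_on {A..2 * A}"
    by (rule integrable_on_subinterval[of _ "{0..}"]) (use G assms in auto)
  have "A powr x * exp (- 2 * A) = A * (A powr (x - 1) * exp (- 2 * A))"
    using assms by (simp add: powr_diff)
  also have "\<dots> = integral {A..2 * A} (\<lambda>t. A powr (x - 1) * exp (- 2 * A))"
    using assms by simp
  also have "\<dots> \<le> integral {A..2 * A} ?f"
  proof (rule integral_le)
    show "A powr (x - 1) * exp (- 2 * A) \<le> ?f t" if "t \<in> {A..2 * A}" for t
      using that assms unfolding divide_inverse exp_minus[symmetric]
      by (intro mult_mono powr_mono2) auto
  qed (use int in auto)
  also have "\<dots> \<le> integral {0..} ?f"
    by (rule integral_subset_le) (use int G assms in auto)
  also have "\<dots> = Gamma x" by (rule integral_unique[OF G])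
  finally show ?thesis .
qed

lemma Gamma_add_nat:
  fixes x :: real
  assumes "0 < x"
  shows "Gamma (real s + x) = pochhammer x s * Gamma x"
proof -
  have "x \<notin> \<int>\<^sub>\<le>\<^sub>0" using assms by (auto elim!: nonpos_Ints_cases)
  then show ?thesis using pochhammer_Gamma[of x s] Gamma_real_pos[OF assms] by (simp add: add.commute)
qed

context
  fixes l a :: real
  assumes l: "0 < l" "l < 1" and a: "0 < a" "a < 1"
begin

lemma ml_moment_eq:
  "ml_moment l (- a * l) s = Gamma (real s + (1 - a)) * Gamma (1 - l * a) /
         (Gamma (l * real s + (1 - l * a)) * Gamma (1 - a))"
  using l by (simp add: ml_moment_def algebra_simps)

lemma la_less_1: "l * a < 1"
  using mult_strict_mono[of l 1 a 1] l a by simp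

lemma ml_moment_pos: "0 < ml_moment l (- a * l) s"
  unfolding ml_moment_eq using l a la_less_1
  by (intro mult_pos_pos divide_pos_pos Gamma_real_pos add_nonneg_pos) auto

lemma ml_moment_0: "ml_moment l (- a * l) 0 = 1"
proof -
  have "Gamma (1 - l * a) > 0" "Gamma (1 - a) > 0" using a la_less_1 by (auto intro: Gamma_real_pos)
  then show ?thesis unfolding ml_moment_eq by simp
qed

text \<open>This is the shape in which the transfer delivers the limit. The functional equation
  shifts the arguments by \<open>1\<close>, and the factors \<open>(s - a) / (- a)\<close>,
  \<open>l (s - a)\<close> and \<open>- l a\<close> that arise cancel.\<close>

lemma ml_moment_Suc:
  "ml_moment l (- a * l) (Suc s) = pochhammer (- a) (Suc s) * rGamma (l * (real (Suc s) - a)) / rGamma (- (l * a))"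
proof -
  let ?s = "real (Suc s)"
  have "Gamma (?s + (1 - a)) = pochhammer (1 - a) (Suc s) * Gamma (1 - a)"
    using a by (intro Gamma_add_nat) simp
  also have "pochhammer (1 - a) (Suc s) = pochhammer (- a) (Suc s) * (?s - a) / (- a)"
    using pochhammer_rec[of "- a" "Suc s"] pochhammer_Suc[of "- a" "Suc s"] a by (simp add: field_simps)
  finally have "Gamma (?s + (1 - a)) = pochhammer (- a) (Suc s) * (?s - a) / (- a) * Gamma (1 - a)" .
  moreover have "0 < Gamma (1 - a)" using a by (intro Gamma_real_pos) simp
  then have "Gamma (1 - a) \<noteq> 0" by linarith
  ultimately have 1: "Gamma (?s + (1 - a)) / Gamma (1 - a) = pochhammer (- a) (Suc s) * (?s - a) / (- a)"
    by (simp only: nonzero_mult_div_cancel_right not_False_eq_True)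
  have 2: "rGamma (l * (?s - a)) = l * (?s - a) * rGamma (l * ?s + (1 - l * a))"
    using rGamma_plus1[of "l * (?s - a)"] by (simp add: algebra_simps)
  have 3: "rGamma (- (l * a)) = - (l * a) * rGamma (1 - l * a)"
    using rGamma_plus1[of "- (l * a)"] by simp
  have "ml_moment l (- a * l) (Suc s) = (Gamma (?s + (1 - a)) / Gamma (1 - a)) * (rGamma (l * ?s + (1 - l * a)) / rGamma (1 - l * a))"
    unfolding ml_moment_eq by (simp add: rGamma_inverse_Gamma field_simps)
  also have "\<dots> = pochhammer (- a) (Suc s) * rGamma (l * (?s - a)) / rGamma (- (l * a))"
    unfolding 1 2 3 using a l by simp
  finally show ?thesis .
qed

text \<open>The factorial cancels in the growth condition, and
  \<open>Gamma (l * s + (1 - l * a))\<close> in the denominator then beats every geometric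
  sequence.\<close>

lemma ml_moment_le:
  "ml_moment l (- a * l) s \<le> fact s * Gamma (1 - l * a) / Gamma (l * real s + (1 - l * a))"
proof -
  have pos: "0 < Gamma (1 - a)" using a by (intro Gamma_real_pos) simp
  have "Gamma (real s + (1 - a)) = pochhammer (1 - a) s * Gamma (1 - a)"
    using a by (intro Gamma_add_nat) simp
  moreover have "pochhammer (1 - a) s \<le> fact s"
    unfolding pochhammer_fact pochhammer_prod using a by (intro prod_mono) auto
  ultimately have "Gamma (real s + (1 - a)) / Gamma (1 - a) \<le> fact s" using pos by simp
  moreover have "0 \<le> Gamma (1 - l * a) / Gamma (l * real s + (1 - l * a))"
  proof -
    have "0 \<le> l * real s" using l by simp
    then have "0 < l * real s + (1 - l * a)" using la_less_1 by linarith
    then show ?thesis using la_less_1 by (intro divide_nonneg_nonneg less_imp_le Gamma_real_pos) auto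
  qed
  ultimately have "Gamma (real s + (1 - a)) / Gamma (1 - a) * (Gamma (1 - l * a) / Gamma (l * real s + (1 - l * a)))
     \<le> fact s * (Gamma (1 - l * a) / Gamma (l * real s + (1 - l * a)))"
    by (intro mult_right_mono)
  then show ?thesis unfolding ml_moment_eq by (simp add: mult_ac)
qed

lemma ml_moment_growth: "(\<lambda>s. ml_moment l (- a * l) s * t ^ s / fact s) \<longlonglongrightarrow> 0"
proof -
  \<comment> \<open>Chosen so that \<open>|t| / T < 1\<close>; \<open>A = T powr (1 / l)\<close>
    then satisfies \<open>A powr (l * s) = T ^ s\<close>.\<close>
  define T where "T = 2 * \<bar>t\<bar> + 1"
  define A where "A = T powr (1 / l)"
  have T: "0 < T" by (simp add: T_def)
  have A: "0 < A" using T by (simp add: A_def)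
  have Als: "A powr (l * real s) = T ^ s" for s
    using T l by (simp add: A_def powr_powr powr_realpow)
  define K where "K = Gamma (1 - l * a) / (A powr (1 - l * a) * exp (- 2 * A))"
  have G0: "0 < Gamma (1 - l * a)" using la_less_1 by (intro Gamma_real_pos) simp
  have bound: "\<bar>ml_moment l (- a * l) s * t ^ s / fact s\<bar> \<le> K * (\<bar>t\<bar> / T) ^ s" if "1 \<le> s" for s
  proof -
    have "l * a \<le> l * 1" using l a by (intro mult_left_mono) auto
    also have "\<dots> \<le> l * real s" using l that by (intro mult_left_mono) auto
    finally have "1 \<le> l * real s + (1 - l * a)" by simp
    from Gamma_exponential_lower_bound[OF this A]
    have low: "T ^ s * (A powr (1 - l * a) * exp (- 2 * A)) \<le> Gamma (l * real s + (1 - l * a))"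
      by (simp add: powr_add Als mult.assoc)
    have lowpos: "0 < T ^ s * (A powr (1 - l * a) * exp (- 2 * A))" using T A by simp
    have "\<bar>ml_moment l (- a * l) s * t ^ s / fact s\<bar> = ml_moment l (- a * l) s * \<bar>t\<bar> ^ s / fact s"
      using ml_moment_pos[of s] by (simp add: abs_mult power_abs)
    also have "\<dots> \<le> (fact s * Gamma (1 - l * a) / Gamma (l * real s + (1 - l * a))) * \<bar>t\<bar> ^ s / fact s"
      by (intro divide_right_mono mult_right_mono ml_moment_le) auto
    also have "\<dots> = Gamma (1 - l * a) * \<bar>t\<bar> ^ s / Gamma (l * real s + (1 - l * a))" by simp
    also have "\<dots> \<le> Gamma (1 - l * a) * \<bar>t\<bar> ^ s / (T ^ s * (A powr (1 - l * a) * exp (- 2 * A)))"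
      using low lowpos G0 by (intro divide_left_mono mult_pos_pos[OF less_le_trans[OF lowpos low] lowpos]) auto
    also have "\<dots> = K * (\<bar>t\<bar> / T) ^ s" by (simp add: K_def power_divide)
    finally show ?thesis .
  qed
  have "\<bar>t\<bar> / T < 1" using T by (simp add: T_def)
  then have "(\<lambda>s. K * (\<bar>t\<bar> / T) ^ s) \<longlonglongrightarrow> K * 0"
    using T by (intro tendsto_intros LIMSEQ_realpow_zero) auto
  then have "(\<lambda>s. K * (\<bar>t\<bar> / T) ^ s) \<longlonglongrightarrow> 0" by simp
  moreover have "eventually (\<lambda>s. norm (ml_moment l (- a * l) s * t ^ s / fact s) \<le> K * (\<bar>t\<bar> / T) ^ s) sequentially"
    using eventually_ge_at_top[of 1] by eventually_elim (use bound in simp)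
  ultimately show ?thesis by (rule Lim_null_comparison[rotated])
qed

end

locale confluent_scheme = inner_series +
  fixes G M :: "real fps" and \<tau>\<^sub>G c\<^sub>G a \<tau>\<^sub>M c\<^sub>M :: real
  assumes G: "fps_sing G \<tau>\<^sub>G c\<^sub>G a" and a: "0 < a" "a < 1" and M: "fps_sing M \<tau>\<^sub>M c\<^sub>M (l * a)"
    and Gnn: "\<And>k. 0 \<le> fps_nth G k" and Mnn: "\<And>k. 0 \<le> fps_nth M k"
    and coeff_neg: "c\<^sub>G * (- c) powr a * \<tau>\<^sub>M + \<tau>\<^sub>G * c\<^sub>M < 0"
begin

definition total_coeff :: real where
  "total_coeff = c\<^sub>G * (- c) powr a * \<tau>\<^sub>M + \<tau>\<^sub>G * c\<^sub>M"

text \<open>The share of the singularity of \<open>G\<close> in the total leading coefficient, equal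
  to \<open>1 - p\<close>.\<close>

definition continuous_mass :: real where
  "continuous_mass = c\<^sub>G * (- c) powr a * \<tau>\<^sub>M / total_coeff"

lemma total_coeff_neg: "total_coeff < 0"
  using coeff_neg by (simp add: total_coeff_def)

lemma weight_asymptotic:
  "(\<lambda>n. fps_nth (ext_scheme_at_1 G H M) n * real n powr (l * a + 1)) \<longlonglongrightarrow> total_coeff * rGamma (- (l * a))"
  unfolding ext_scheme_at_1_def total_coeff_def by (rule compose_coeff_asymptotic_confluent[OF G a M])

lemma weight_limit_pos: "0 < total_coeff * rGamma (- (l * a))"
  using total_coeff_neg rGamma_neg[of "l * a"] la_less_1[OF l a] l a by (simp add: mult_neg_neg)

lemma eventually_weight_pos: "eventually (\<lambda>n. 0 < fps_nth (ext_scheme_at_1 G H M) n) sequentially"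
  using eventually_pos_of_powr_limit[OF weight_asymptotic weight_limit_pos] .

lemma pmf_core:
  assumes "0 < fps_nth (ext_scheme_at_1 G H M) n"
  shows "pmf (core_size G H M n) k = fps_nth G k * fps_nth (H ^ k * M) n / fps_nth (ext_scheme_at_1 G H M) n"
  using pmf_core_size[OF Gnn nonneg Mnn H0] assms by (simp add: ext_scheme_nth)

lemma set_pmf_core:
  assumes "0 < fps_nth (ext_scheme_at_1 G H M) n"
  shows "set_pmf (core_size G H M n) \<subseteq> {..n}"
proof
  fix k assume "k \<in> set_pmf (core_size G H M n)"
  then have "fps_nth (H ^ k * M) n \<noteq> 0" using pmf_core[OF assms, of k] by (auto simp: set_pmf_iff)
  then show "k \<in> {..n}" using fps_nth_power_mult_eq_0[OF H0, of n k M] by force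
qed

lemma core_moment_eq:
  assumes "0 < fps_nth (ext_scheme_at_1 G H M) n"
  shows "(\<integral>x. x ^ s \<partial>rescaled A (core_size G H M n)) =
    fps_nth ((moment_fps s G oo H) * M) n / fps_nth (ext_scheme_at_1 G H M) n / A ^ s"
  unfolding rescaled_moments(2)[OF set_pmf_core[OF assms]] compose_nth_eq_sum[OF H0] pmf_core[OF assms]
  by (simp add: sum_divide_distrib moment_fps_def power_divide mult_ac)

text \<open>The numerator is of order \<open>n^(l (s - a) - 1)\<close> and the weight of order
  \<open>n^(- l a - 1)\<close>, so their quotient grows like \<open>n^(l s)\<close>, exactly the
  normalisation. The powers of \<open>- c\<close> combine to \<open>(- c) powr a\<close>.\<close>

lemma core_moment_limit:
  "(\<lambda>n. \<integral>x. x ^ Suc s \<partial>rescaled (1 / (- c) * real n powr l) (core_size G H M n)) \<longlonglongrightarrow>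
     continuous_mass * ml_moment l (- a * l) (Suc s)"
proof -
  let ?W = "fps_nth (ext_scheme_at_1 G H M)"
  let ?N = "fps_nth ((moment_fps (Suc s) G oo H) * M)"
  let ?s = "real (Suc s)"
  obtain \<phi> where \<phi>: "\<phi> has_fps_expansion cfps (moment_fps (Suc s) G)"
    "sing_type 3 (a - ?s) (c\<^sub>G * pochhammer (- a) (Suc s)) \<phi>"
    using moment_fps_sing_type[OF G, of s] by blast
  have la: "0 < l * a" using l a by simp
  have "l * (a - ?s) \<le> 0" using l a by (intro mult_nonneg_nonpos) auto
  then have N: "(\<lambda>n. ?N n * real n powr (l * (a - ?s) + 1)) \<longlonglongrightarrow>
      (c\<^sub>G * pochhammer (- a) (Suc s)) * (- c) powr (a - ?s) * \<tau>\<^sub>M * rGamma (- (l * (a - ?s)))"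
    by (intro compose_coeff_asymptotic[OF \<phi> _ M la]) simp
  define R where "R = (c\<^sub>G * pochhammer (- a) (Suc s)) * (- c) powr (a - ?s) * \<tau>\<^sub>M * rGamma (- (l * (a - ?s))) / (total_coeff * rGamma (- (l * a)))"
  have "(\<lambda>n. (- c) ^ Suc s * ((?N n * real n powr (l * (a - ?s) + 1)) / (?W n * real n powr (l * a + 1)))) \<longlonglongrightarrow> (- c) ^ Suc s * R"
    unfolding R_def using weight_limit_pos by (intro tendsto_mult tendsto_const tendsto_divide N weight_asymptotic) auto
  also have "(- c) ^ Suc s * R = continuous_mass * ml_moment l (- a * l) (Suc s)"
  proof -
    have "(- c) ^ Suc s * (- c) powr (a - ?s) = (- c) powr a"
      using c_neg by (subst powr_realpow[symmetric]) (simp_all only: powr_add[symmetric], simp_all)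
    moreover have "- (l * (a - ?s)) = l * (?s - a)" by (simp add: algebra_simps)
    moreover have "(- c) ^ Suc s * R = ((- c) ^ Suc s * (- c) powr (a - ?s)) * c\<^sub>G * \<tau>\<^sub>M / total_coeff * (pochhammer (- a) (Suc s) * rGamma (- (l * (a - ?s))) / rGamma (- (l * a)))"
      unfolding R_def by simp
    ultimately show ?thesis
      unfolding ml_moment_Suc[OF l a] continuous_mass_def by (simp add: mult_ac)
  qed
  finally show ?thesis
  proof (rule Lim_transform_eventually)
    show "eventually (\<lambda>n. (- c) ^ Suc s * ((?N n * real n powr (l * (a - ?s) + 1)) / (?W n * real n powr (l * a + 1))) =
       (\<integral>x. x ^ Suc s \<partial>rescaled (1 / (- c) * real n powr l) (core_size G H M n))) sequentially"
      using eventually_weight_pos eventually_gt_at_top[of 0]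
    proof eventually_elim
      case (elim n)
      have "(real n powr l) ^ Suc s = real n powr (l * ?s)"
        using elim by (subst powr_realpow[symmetric]) (simp_all only: powr_powr, simp)
      moreover have "real n powr (l * a + 1) = real n powr (l * (a - ?s) + 1) * real n powr (l * ?s)"
        unfolding powr_add[symmetric] by (simp add: algebra_simps)
      moreover have "0 < real n powr (l * (a - ?s) + 1)" "0 < real n powr (l * ?s)" using elim by auto
      ultimately show ?case
        unfolding core_moment_eq[OF elim(1)] power_mult_distrib power_divide using c_neg elim(1)
        by (simp add: divide_simps del: power_Suc)
    qed
  qed
qed

end

section \<open>Existence of the Mittag-Leffler law\<close>

text \<open>\<open>\<kappa> n\<close> is the largest \<open>K \<le> n\<close> whose bound
  \<open>1 / (K + 1)\<close> is in force from index \<open>n\<close> on. From \<open>N 0\<close> on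
  such a \<open>K\<close> exists, so the maximum is meaningful.\<close>

lemma diagonal_sequence:
  fixes f :: "nat \<Rightarrow> nat \<Rightarrow> real"
  assumes "\<And>K. f K \<longlonglongrightarrow> 0"
  obtains \<kappa> where "filterlim \<kappa> at_top sequentially" "(\<lambda>n. f (\<kappa> n) n) \<longlonglongrightarrow> 0"
proof -
  have "\<exists>N. \<forall>n\<ge>N. \<bar>f K n\<bar> < 1 / real (Suc K)" for K
    using assms[of K] LIMSEQ_D[of "f K" 0 "1 / real (Suc K)"] by auto
  then obtain N where N: "\<And>K n. N K \<le> n \<Longrightarrow> \<bar>f K n\<bar> < 1 / real (Suc K)" by metis
  define S where "S n = {K. K \<le> n \<and> N K \<le> n}" for n
  define \<kappa> where "\<kappa> n = Max (S n)" for n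
  have fin: "finite (S n)" for n unfolding S_def by (rule finite_subset[of _ "{..n}"]) auto
  have lim: "filterlim \<kappa> at_top sequentially"
    unfolding filterlim_at_top eventually_sequentially
  proof (intro allI exI impI)
    fix J n assume "max J (N J) \<le> n"
    then have "J \<in> S n" by (simp add: S_def)
    then show "J \<le> \<kappa> n" unfolding \<kappa>_def by (intro Max_ge fin)
  qed
  moreover have "(\<lambda>n. f (\<kappa> n) n) \<longlonglongrightarrow> 0"
  proof (rule Lim_null_comparison)
    show "eventually (\<lambda>n. norm (f (\<kappa> n) n) \<le> 1 / real (Suc (\<kappa> n))) sequentially"
      using eventually_ge_at_top[of "N 0"]
    proof eventually_elim
      case (elim n)
      then have "0 \<in> S n" by (simp add: S_def)
      then have "\<kappa> n \<in> S n" unfolding \<kappa>_def by (intro Max_in fin) auto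
      then show ?case using N[of "\<kappa> n" n] by (simp add: S_def)
    qed
    have "(\<lambda>k. 1 / real (Suc k)) \<longlonglongrightarrow> 0" by (rule lim_1_over_n[THEN LIMSEQ_Suc])
    then show "(\<lambda>n. 1 / real (Suc (\<kappa> n))) \<longlonglongrightarrow> 0" using lim by (rule filterlim_compose)
  qed
  ultimately show ?thesis by (rule that)
qed

lemma prob_bernoulli_mixture:
  assumes "0 \<le> p" "p \<le> 1"
  shows "measure_pmf.prob (bernoulli_mixture p B Z) A = p * measure_pmf.prob B A + (1 - p) * measure_pmf.prob Z A"
proof -
  have "bernoulli_mixture p B Z = bind_pmf (bernoulli_pmf p) (\<lambda>e. map_pmf (\<lambda>(b, z). of_bool e * b + (1 - of_bool e) * z) (pair_pmf B Z))"
    unfolding bernoulli_mixture_def pair_pmf_def[of "bernoulli_pmf p"] map_bind_pmf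
    by (simp add: map_pmf_def bind_assoc_pmf bind_return_pmf case_prod_unfold)
  also have "\<dots> = bind_pmf (bernoulli_pmf p) (\<lambda>e. if e then B else Z)"
  proof (rule bind_pmf_cong[OF refl])
    fix e
    have "(\<lambda>(b, z). of_bool e * b + (1 - of_bool e) * z) = (if e then fst else (snd :: nat \<times> nat \<Rightarrow> nat))"
      by (auto simp: fun_eq_iff)
    then show "map_pmf (\<lambda>(b, z). of_bool e * b + (1 - of_bool e) * z) (pair_pmf B Z) = (if e then B else Z)"
      by (simp add: map_fst_pair_pmf map_snd_pair_pmf)
  qed
  finally have "emeasure (bernoulli_mixture p B Z) A = (\<integral>\<^sup>+e. emeasure (if e then B else Z) A \<partial>bernoulli_pmf p)"
    by (simp only: emeasure_bind_pmf)
  also have "\<dots> = ennreal (measure_pmf.prob B A) * ennreal p + ennreal (measure_pmf.prob Z A) * ennreal (1 - p)"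
    using assms by (simp add: measure_pmf.emeasure_eq_measure)
  also have "\<dots> = ennreal (p * measure_pmf.prob B A + (1 - p) * measure_pmf.prob Z A)"
    using assms by (simp add: ennreal_mult[symmetric] ennreal_plus[symmetric] mult.commute del: ennreal_plus)
  finally show ?thesis
    unfolding measure_pmf.emeasure_eq_measure
    by (rule ennreal_inj[THEN iffD1, rotated 2]) (use assms in auto)
qed

text \<open>The atom at \<open>0\<close> contributes \<open>p * 0 ^ s\<close>, which is
  \<open>p\<close> for \<open>s = 0\<close> and vanishes otherwise.\<close>

lemma bernoulli_thinned_moments:
  assumes p: "0 \<le> p" "p \<le> 1" and L: "real_distribution L"
    and mom: "\<And>s. has_bochner_integral L (\<lambda>x. x ^ s) (m s)"
  shows "real_distribution (bernoulli_thinned p L)"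
    and "integrable (bernoulli_thinned p L) (\<lambda>x. x ^ s)"
    and "(\<integral>x. x ^ s \<partial>bernoulli_thinned p L) = p * 0 ^ s + (1 - p) * m s"
proof -
  interpret L: real_distribution L by (rule L)
  interpret P: pair_prob_space "measure_pmf (bernoulli_pmf p)" L by unfold_locales
  let ?N = "measure_pmf (bernoulli_pmf p) \<Otimes>\<^sub>M L"
  let ?g = "\<lambda>(e, x). (1 - of_bool e) * x :: real"
  have meas: "?g \<in> borel_measurable ?N"
    unfolding case_prod_unfold
    by (intro borel_measurable_times borel_measurable_diff borel_measurable_const
        measurable_compose[OF measurable_fst, of _ "measure_pmf (bernoulli_pmf p)"] measurable_compose[OF measurable_snd]) auto
  show "real_distribution (bernoulli_thinned p L)"
    unfolding bernoulli_thinned_def by (rule P.P.real_distribution_distr[OF meas])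
  have meas_s: "(\<lambda>y. ?g y ^ s) \<in> borel_measurable ?N" using meas by measurable
  have slice: "has_bochner_integral L (\<lambda>x. ?g (e, x) ^ s) (if e then 0 ^ s else m s)" for e
    using mom[of s] by (cases e) (auto simp: has_bochner_integral_iff L.prob_space[unfolded L.space_eq_univ])
  have int: "integrable ?N (\<lambda>y. ?g y ^ s)"
  proof (rule P.Fubini_integrable[OF meas_s])
    show "integrable (measure_pmf (bernoulli_pmf p)) (\<lambda>e. \<integral>x. norm (?g (e, x) ^ s) \<partial>L)"
      by (rule integrable_measure_pmf_finite) simp
    show "AE e in measure_pmf (bernoulli_pmf p). integrable L (\<lambda>x. ?g (e, x) ^ s)"
      by (intro always_eventually allI integrable.intros[OF slice])
  qed
  then show "integrable (bernoulli_thinned p L) (\<lambda>x. x ^ s)"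
    unfolding bernoulli_thinned_def by (subst integrable_distr_eq[OF meas]) auto
  have "(\<integral>x. x ^ s \<partial>bernoulli_thinned p L) = (\<integral>y. ?g y ^ s \<partial>?N)"
    unfolding bernoulli_thinned_def by (subst integral_distr[OF meas]) auto
  also have "\<dots> = (\<integral>e. (\<integral>x. ?g (e, x) ^ s \<partial>L) \<partial>measure_pmf (bernoulli_pmf p))"
    by (rule P.integral_fst'[OF int, symmetric])
  also have "\<dots> = (\<integral>e. (if e then 0 ^ s else m s) \<partial>measure_pmf (bernoulli_pmf p))"
    by (intro Bochner_Integration.integral_cong refl has_bochner_integral_integral_eq slice)
  also have "\<dots> = p * 0 ^ s + (1 - p) * m s" using p by (simp add: mult.commute)
  finally show "(\<integral>x. x ^ s \<partial>bernoulli_thinned p L) = p * 0 ^ s + (1 - p) * m s" .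
qed

context inner_series
begin

text \<open>The model scheme with outer series \<open>binomial_fps a\<close> and
  \<open>M = 1\<close> has \<open>continuous_mass = 1\<close>, so the limits of its moments are the
  wanted ones. Damping its weights by \<open>k powr (a - a')\<close> leads, up to a constant, to the
  scheme of exponent \<open>a'\<close>. The resulting loss \<open>n^(- l (a' - a))\<close> is that
  of the rescaling, so the mass near \<open>0\<close> is bounded uniformly in
  \<open>n\<close>.\<close>

lemma mittag_leffler_exists:
  assumes a: "0 < a" "a < 1"
  shows "\<exists>L. is_mittag_leffler l (- a * l) L"
proof -
  define a' where "a' = (1 + a) / 2"
  have a': "a < a'" "0 < a'" "a' < 1" using a by (auto simp: a'_def)
  let ?G = "binomial_fps a" and ?G' = "binomial_fps a'"
  have nn: "0 \<le> fps_nth ?G k" "0 \<le> fps_nth ?G' k" for k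
    using binomial_fps_pos[OF a, of k] binomial_fps_pos[of a' k] a'
    by (cases "k = 0"; force simp: binomial_fps_def)+
  have cp: "0 < (- c) powr a" using c_neg by simp
  interpret S: confluent_scheme H l c ?G 1 1 "-1" a 1 0
    by unfold_locales (use nn cp a in \<open>auto simp: fps_sing_binomial fps_sing_1\<close>)
  let ?W = "fps_nth (ext_scheme_at_1 ?G H 1)" and ?V = "fps_nth ((?G' oo H) * 1)"
  have mass: "S.continuous_mass = 1" using cp by (simp add: S.continuous_mass_def S.total_coeff_def)
  obtain B where B: "\<And>k. \<bar>(fps_nth ?G k * real k powr (a + 1)) / (fps_nth ?G' k * real k powr (a' + 1))\<bar> \<le> B"
  proof -
    have "rGamma (- a') \<noteq> 0" using rGamma_neg[of a'] a' by simp
    then have "(\<lambda>k. (fps_nth ?G k * real k powr (a + 1)) / (fps_nth ?G' k * real k powr (a' + 1)))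
       \<longlonglongrightarrow> (-1 * rGamma (- a)) / (-1 * rGamma (- a'))"
      using a a' by (intro tendsto_divide fps_sing_coeff_asymptotic[OF fps_sing_binomial]) auto
    then have "Bseq (\<lambda>k. (fps_nth ?G k * real k powr (a + 1)) / (fps_nth ?G' k * real k powr (a' + 1)))"
      by (rule convergent_imp_Bseq[OF convergentI])
    then show ?thesis using that unfolding Bseq_def by auto
  qed
  have B0: "0 \<le> B" using B[of 0] by simp
  have compare: "fps_nth ?G k * real k powr (a - a') \<le> B * fps_nth ?G' k" if "0 < k" for k
  proof -
    have pos: "0 < fps_nth ?G' k" using binomial_fps_pos[of a' k] a' that by simp
    have "real k powr (a - a') = real k powr (a + 1) / real k powr (a' + 1)"
      by (simp add: powr_diff[symmetric])
    then have "fps_nth ?G k * real k powr (a - a') / fps_nth ?G' k =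
        (fps_nth ?G k * real k powr (a + 1)) / (fps_nth ?G' k * real k powr (a' + 1))"
      by simp
    also have "\<dots> \<le> B" by (rule order_trans[OF abs_ge_self B])
    finally have "fps_nth ?G k * real k powr (a - a') / fps_nth ?G' k \<le> B" .
    then show ?thesis using pos by (simp add: divide_le_eq)
  qed
  define A where "A n = 1 / (- c) * real n powr l" for n
  have V: "(\<lambda>n. ?V n * real n powr (l * a' + 1)) \<longlonglongrightarrow>
      (- 1 * (- c) powr a' * 1 + 1 * 0) * rGamma (- (l * a'))"
    by (rule compose_coeff_asymptotic_confluent[OF fps_sing_binomial _ _ fps_sing_1]) (use a' in auto)
  have "(\<lambda>n. (1 / (- c)) powr (a' - a) * B * ((?V n * real n powr (l * a' + 1)) / (?W n * real n powr (l * a + 1)))) \<longlonglongrightarrow>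
      (1 / (- c)) powr (a' - a) * B * (((- 1 * (- c) powr a' * 1 + 1 * 0) * rGamma (- (l * a'))) / (S.total_coeff * rGamma (- (l * a))))"
    using S.weight_limit_pos by (intro tendsto_mult tendsto_divide V S.weight_asymptotic tendsto_const) auto
  from convergent_imp_Bseq[OF convergentI[OF this]] obtain K where
    K: "\<And>n. \<bar>(1 / (- c)) powr (a' - a) * B * ((?V n * real n powr (l * a' + 1)) / (?W n * real n powr (l * a + 1)))\<bar> \<le> K"
    unfolding Bseq_def by auto
  obtain N where N: "\<And>n. N \<le> n \<Longrightarrow> 0 < ?W n"
    using S.eventually_weight_pos unfolding eventually_sequentially by blast
  define X where "X n = core_size ?G H 1 n" for n
  have small: "measure (rescaled (A n) (X n)) {-\<delta><..<\<delta>} \<le> K * \<delta> powr (a' - a)"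
    if n: "N \<le> n" "0 < n" and \<delta>: "0 < \<delta>" for n \<delta>
  proof -
    note W = N[OF n(1)]
    have A: "0 < A n" unfolding A_def using c_neg n by (intro mult_pos_pos divide_pos_pos) auto
    have "measure (rescaled (A n) (X n)) {-\<delta><..<\<delta>} = measure_pmf.prob (X n) {k. real k / A n \<in> {-\<delta><..<\<delta>}}"
      unfolding rescaled_def by (subst measure_distr) (auto simp: vimage_def)
    also have "\<dots> = (\<Sum>k\<le>n. pmf (X n) k * indicator {k. real k / A n \<in> {-\<delta><..<\<delta>}} k)"
      unfolding X_def by (rule prob_eq_sum[OF S.set_pmf_core[OF W]])
    also have "\<dots> \<le> (\<Sum>k\<le>n. (\<delta> * A n) powr (a' - a) * B / ?W n * (fps_nth ?G' k * fps_nth (H ^ k * 1) n))"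
    proof (rule sum_mono)
      fix k assume "k \<in> {..n}"
      have Hk: "0 \<le> fps_nth (H ^ k * 1) n" using fps_nth_power_nonneg[OF nonneg] by simp
      show "pmf (X n) k * indicator {k. real k / A n \<in> {-\<delta><..<\<delta>}} k \<le>
         (\<delta> * A n) powr (a' - a) * B / ?W n * (fps_nth ?G' k * fps_nth (H ^ k * 1) n)"
      proof (cases "0 < k \<and> real k / A n < \<delta>")
        case False
        then have "pmf (X n) k * indicator {k. real k / A n \<in> {-\<delta><..<\<delta>}} k = 0"
          using S.pmf_core[OF W, of k] n by (cases "k = 0") (auto simp: X_def binomial_fps_def)
        also have "0 \<le> (\<delta> * A n) powr (a' - a) * B / ?W n * (fps_nth ?G' k * fps_nth (H ^ k * 1) n)"
          using B0 W Hk nn(2)[of k] by (intro mult_nonneg_nonneg divide_nonneg_nonneg) auto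
        finally show ?thesis .
      next
        case True
        then have k: "0 < k" "real k \<le> \<delta> * A n" using A by (auto simp: divide_less_eq)
        \<comment> \<open>Markov's inequality for a moment of negative order, applied term by
          term.\<close>
        have "1 = real k powr (a' - a) * real k powr (a - a')" using k by (simp add: powr_add[symmetric])
        also have "\<dots> \<le> (\<delta> * A n) powr (a' - a) * real k powr (a - a')"
          using k a' by (intro mult_right_mono powr_mono2) auto
        finally have 1: "1 \<le> (\<delta> * A n) powr (a' - a) * real k powr (a - a')" .
        have "fps_nth ?G k * 1 \<le> fps_nth ?G k * ((\<delta> * A n) powr (a' - a) * real k powr (a - a'))"
          by (intro mult_left_mono 1 nn)
        also have "\<dots> = (\<delta> * A n) powr (a' - a) * (fps_nth ?G k * real k powr (a - a'))" by simp
        also have "\<dots> \<le> (\<delta> * A n) powr (a' - a) * (B * fps_nth ?G' k)"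
          by (intro mult_left_mono compare k) auto
        finally have "fps_nth ?G k * (fps_nth (H ^ k * 1) n / ?W n) \<le>
            (\<delta> * A n) powr (a' - a) * (B * fps_nth ?G' k) * (fps_nth (H ^ k * 1) n / ?W n)"
          using Hk W by (intro mult_right_mono) auto
        moreover have "pmf (X n) k * indicator {k. real k / A n \<in> {-\<delta><..<\<delta>}} k \<le> pmf (X n) k"
          by (simp add: mult_left_le indicator_def)
        ultimately show ?thesis using S.pmf_core[OF W, of k] by (simp add: X_def mult_ac)
      qed
    qed
    also have "\<dots> = (\<delta> * A n) powr (a' - a) * B / ?W n * ?V n"
      by (simp only: sum_distrib_left[symmetric] compose_nth_eq_sum[OF H0])
    also have "\<dots> = \<delta> powr (a' - a) * ((1 / (- c)) powr (a' - a) * B * ((?V n * real n powr (l * a' + 1)) / (?W n * real n powr (l * a + 1))))"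
    proof -
      have "real n powr (l * a' + 1) = real n powr (l * (a' - a)) * real n powr (l * a + 1)"
        unfolding powr_add[symmetric] by (simp add: algebra_simps)
      moreover have "(\<delta> * A n) powr (a' - a) = \<delta> powr (a' - a) * ((1 / (- c)) powr (a' - a) * real n powr (l * (a' - a)))"
      proof -
        have nonneg': "0 \<le> \<delta>" "0 \<le> 1 / (- c)" "0 \<le> real n powr l" "0 \<le> 1 / (- c) * real n powr l"
          using \<delta> c_neg by (auto simp: divide_nonneg_neg divide_nonpos_neg)
        then show ?thesis by (simp only: A_def powr_mult powr_powr)
      qed
      moreover have "real n powr (l * a + 1) \<noteq> 0" using n by simp
      ultimately show ?thesis by simp
    qed
    also have "\<dots> \<le> \<delta> powr (a' - a) * K"
      by (intro mult_left_mono order_trans[OF abs_ge_self K]) simp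
    finally show ?thesis by (simp add: mult.commute)
  qed
  \<comment> \<open>The shift discards the indices with possibly vanishing weight, where the law of
    the core size is unspecified, and also \<open>n = 0\<close>.\<close>
  define N' where "N' = Suc N"
  define \<mu> where "\<mu> n = rescaled (A (n + N')) (X (n + N'))" for n
  have rd: "real_distribution (\<mu> n)" for n unfolding \<mu>_def by (rule real_distribution_rescaled)
  have nnA: "AE x in \<mu> n. 0 \<le> x" for n
    unfolding \<mu>_def A_def using c_neg by (intro AE_rescaled_nonneg mult_nonneg_nonneg divide_nonneg_nonneg) auto
  have W': "0 < ?W (n + N')" for n by (rule N) (simp add: N'_def)
  have int: "integrable (\<mu> n) (\<lambda>x. x ^ s)" for n s
    unfolding \<mu>_def X_def by (rule rescaled_moments(1)[OF S.set_pmf_core[OF W']])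
  have lim: "(\<lambda>n. \<integral>x. x ^ s \<partial>\<mu> n) \<longlonglongrightarrow> ml_moment l (- a * l) s" for s
  proof (cases s)
    case 0
    have "(\<integral>x. x ^ 0 \<partial>\<mu> n) = 1" for n
    proof -
      interpret real_distribution "\<mu> n" by (rule rd)
      show ?thesis using prob_space by simp
    qed
    then show ?thesis using ml_moment_0[OF l a] 0 by simp
  next
    case (Suc t)
    show ?thesis
      using LIMSEQ_ignore_initial_segment[OF S.core_moment_limit[of t], of N'] mass
      by (simp add: \<mu>_def A_def X_def Suc)
  qed
  obtain L r where r: "strict_mono r" and L: "real_distribution L" and w: "weak_conv_m (\<mu> \<circ> r) L"
    and Lnn: "AE x in L. 0 \<le> x" and mom: "\<And>s. has_bochner_integral L (\<lambda>x. x ^ s) (ml_moment l (- a * l) s)"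
    using moment_limit_exists[OF rd nnA int lim] by metis
  interpret L: real_distribution L by (rule L)
  have at0: "measure L {0} = 0"
  proof (rule no_atom_at_0[OF _ L w])
    show "real_distribution ((\<mu> \<circ> r) n)" for n using rd by simp
    show "0 < a' - a" using a' by simp
    show "measure ((\<mu> \<circ> r) n) {-\<delta><..<\<delta>} \<le> K * \<delta> powr (a' - a)" if "0 < \<delta>" for n \<delta>
      unfolding o_def \<mu>_def by (rule small) (use that in \<open>auto simp: N'_def\<close>)
  qed
  have "AE x in L. x \<noteq> 0"
    using at0 by (subst (asm) L.prob_eq_0) (auto elim!: eventually_mono)
  with Lnn have "AE x in L. x \<in> {0<..}" by eventually_elim auto
  then have "measure L {0<..} = 1" by (subst L.prob_eq_1) auto
  then have "is_mittag_leffler l (- a * l) L"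
    unfolding is_mittag_leffler_def
    using mom L.prob_space_axioms by (simp add: ml_moment_def)
  then show ?thesis by blast
qed

end

section \<open>The limit law of the core size\<close>

lemma total_variation_nonneg: "0 \<le> total_variation P Q"
proof -
  have "bdd_above (range (\<lambda>A. \<bar>measure_pmf.prob P A - measure_pmf.prob Q A\<bar>))"
  proof (rule bdd_aboveI2)
    show "\<bar>measure_pmf.prob P A - measure_pmf.prob Q A\<bar> \<le> 1" for A
      using measure_pmf.prob_le_1[of P A] measure_pmf.prob_le_1[of Q A]
        measure_nonneg[of P A] measure_nonneg[of Q A] by linarith
  qed
  from cSUP_upper[OF _ this, of "{}"] show ?thesis by (simp add: total_variation_def)
qed

lemma total_variation_le:
  assumes "\<And>A. \<bar>measure_pmf.prob P A - measure_pmf.prob Q A\<bar> \<le> e"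
  shows "total_variation P Q \<le> e"
  unfolding total_variation_def by (rule cSUP_least) (auto intro: assms)

text \<open>The default covers the null event, on which \<open>cond_pmf\<close> is unspecified. In
  the application the event has probability tending to \<open>1 - p > 0\<close>.\<close>

definition conditioned_above :: "nat pmf \<Rightarrow> nat \<Rightarrow> nat pmf" where
  "conditioned_above P K =
     (if set_pmf P \<inter> {K<..} = {} then return_pmf 0 else cond_pmf P {K<..})"

lemma conditioned_above_props:
  assumes "0 < measure_pmf.prob P {K<..}"
  shows "pmf (conditioned_above P K) k = (if K < k then pmf P k / measure_pmf.prob P {K<..} else 0)"
    and "set_pmf (conditioned_above P K) \<subseteq> set_pmf P"
    and "measure_pmf.prob (conditioned_above P K) A = measure_pmf.prob P (A \<inter> {K<..}) / measure_pmf.prob P {K<..}"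
proof -
  have ne: "set_pmf P \<inter> {K<..} \<noteq> {}"
    using assms measure_Int_set_pmf[of P "{K<..}"] by (auto simp: Int_commute)
  then show pmf: "pmf (conditioned_above P K) k = (if K < k then pmf P k / measure_pmf.prob P {K<..} else 0)" for k
    by (simp add: conditioned_above_def pmf_cond)
  show "set_pmf (conditioned_above P K) \<subseteq> set_pmf P"
    using ne by (auto simp: conditioned_above_def set_cond_pmf)
  have "emeasure (conditioned_above P K) A = emeasure (uniform_measure P {K<..}) A"
    using ne by (simp add: conditioned_above_def cond_pmf.rep_eq)
  then have "measure (conditioned_above P K) A = measure (uniform_measure P {K<..}) A"
    by (simp add: measure_def)
  also have "\<dots> = measure_pmf.prob P ({K<..} \<inter> A) / measure_pmf.prob P {K<..}"
    by (rule measure_uniform_measure) (use assms in \<open>auto simp: measure_pmf.emeasure_eq_measure\<close>)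
  finally show "measure_pmf.prob (conditioned_above P K) A = measure_pmf.prob P (A \<inter> {K<..}) / measure_pmf.prob P {K<..}"
    by (simp add: Int_commute)
qed

text \<open>Three errors: at most \<open>e\<close> up to \<open>K\<close>, at most \<open>t\<close>
  for the mass of \<open>B\<close> above \<open>K\<close>, and at most
  \<open>|d - (1 - p)| \<le> e + t\<close> for giving the conditioned tail the weight
  \<open>1 - p\<close> instead of \<open>d\<close>.\<close>

lemma prob_conditioned_decomposition:
  fixes X B :: "nat pmf"
  assumes p: "0 \<le> p" "p \<le> 1" and d: "d = measure_pmf.prob X {K<..}" "0 < d"
    and e: "e = (\<Sum>k\<le>K. \<bar>pmf X k - p * pmf B k\<bar>)" and t: "t = 1 - (\<Sum>k\<le>K. pmf B k)"
  shows "\<bar>d - (1 - p)\<bar> \<le> e + t"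
    and "total_variation X (bernoulli_mixture p B (conditioned_above X K)) \<le> 2 * (e + t)"
proof -
  have split: "measure_pmf.prob P A = measure_pmf.prob P (A \<inter> {..K}) + measure_pmf.prob P (A \<inter> {K<..})" for P :: "nat pmf" and A
  proof -
    have "measure_pmf.prob P ((A \<inter> {..K}) \<union> (A \<inter> {K<..})) = measure_pmf.prob P (A \<inter> {..K}) + measure_pmf.prob P (A \<inter> {K<..})"
      by (rule measure_pmf.finite_measure_Union) auto
    moreover have "(A \<inter> {..K}) \<union> (A \<inter> {K<..}) = A" by auto
    ultimately show ?thesis by simp
  qed
  have low: "\<bar>measure_pmf.prob X (A \<inter> {..K}) - p * measure_pmf.prob B (A \<inter> {..K})\<bar> \<le> e" for A
  proof -
    have fin: "finite (A \<inter> {..K})" by simp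
    have "\<bar>measure_pmf.prob X (A \<inter> {..K}) - p * measure_pmf.prob B (A \<inter> {..K})\<bar> = \<bar>\<Sum>k\<in>A \<inter> {..K}. pmf X k - p * pmf B k\<bar>"
      by (simp add: measure_measure_pmf_finite[OF fin] sum_subtractf sum_distrib_left)
    also have "\<dots> \<le> (\<Sum>k\<in>A \<inter> {..K}. \<bar>pmf X k - p * pmf B k\<bar>)" by (rule sum_abs)
    also have "\<dots> \<le> e" unfolding e by (rule sum_mono2) auto
    finally show ?thesis .
  qed
  have t_eq: "t = measure_pmf.prob B {K<..}"
    using split[of B UNIV] by (simp add: t measure_measure_pmf_finite)
  have t0: "0 \<le> t" unfolding t_eq by simp
  have tail: "p * measure_pmf.prob B (A \<inter> {K<..}) \<le> t" "0 \<le> p * measure_pmf.prob B (A \<inter> {K<..})" for A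
  proof -
    have "measure_pmf.prob B (A \<inter> {K<..}) \<le> t"
      unfolding t_eq by (intro measure_pmf.finite_measure_mono) auto
    then have "p * measure_pmf.prob B (A \<inter> {K<..}) \<le> 1 * t"
      using p by (intro mult_mono) auto
    then show "p * measure_pmf.prob B (A \<inter> {K<..}) \<le> t" by simp
  qed (use p in simp)
  show dq: "\<bar>d - (1 - p)\<bar> \<le> e + t"
  proof -
    have "1 = measure_pmf.prob X {..K} + d" using split[of X UNIV] d(1) by simp
    moreover have "p = p * measure_pmf.prob B {..K} + p * measure_pmf.prob B {K<..}"
      using split[of B UNIV] by (simp add: distrib_left[symmetric])
    ultimately show ?thesis using low[of UNIV] tail[of UNIV] by auto
  qed
  show "total_variation X (bernoulli_mixture p B (conditioned_above X K)) \<le> 2 * (e + t)"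
  proof (rule total_variation_le)
    have triangle: "\<bar>u - v + w\<bar> \<le> 2 * (e + t)"
      if "\<bar>u\<bar> \<le> e" "0 \<le> v" "v \<le> t" "\<bar>w\<bar> \<le> e + t" for u v w :: real
      using that unfolding abs_le_iff by (simp add: algebra_simps)
    fix A
    define y where "y = measure_pmf.prob X (A \<inter> {K<..})"
    have y: "0 \<le> y" "y \<le> d"
      unfolding y_def d by (auto intro: measure_pmf.finite_measure_mono)
    have "measure_pmf.prob X A - measure_pmf.prob (bernoulli_mixture p B (conditioned_above X K)) A =
       (measure_pmf.prob X (A \<inter> {..K}) - p * measure_pmf.prob B (A \<inter> {..K}))
       - p * measure_pmf.prob B (A \<inter> {K<..}) + y * (1 - (1 - p) / d)"
      unfolding prob_bernoulli_mixture[OF p] conditioned_above_props(3)[OF d(2)[unfolded d(1)]] split[of X A] split[of B A]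
      by (simp add: y_def d(1) algebra_simps)
    moreover have "\<bar>y * (1 - (1 - p) / d)\<bar> \<le> \<bar>d - (1 - p)\<bar>"
    proof -
      have "\<bar>y * (1 - (1 - p) / d)\<bar> = y * \<bar>1 - (1 - p) / d\<bar>" using y by (simp add: abs_mult)
      also have "\<dots> \<le> d * \<bar>1 - (1 - p) / d\<bar>" using y by (intro mult_right_mono) auto
      also have "\<dots> = \<bar>d * (1 - (1 - p) / d)\<bar>" using d(2) by (simp add: abs_mult)
      also have "d * (1 - (1 - p) / d) = d - (1 - p)" using d(2) by (simp add: field_simps)
      finally show ?thesis .
    qed
    ultimately show "\<bar>measure_pmf.prob X A - measure_pmf.prob (bernoulli_mixture p B (conditioned_above X K)) A\<bar> \<le> 2 * (e + t)"
      using triangle[OF low[of A] tail(2)[of A] tail(1)[of A] order_trans[OF _ dq]] by simp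
  qed
qed

text \<open>Multiplication by \<open>d\<close> undoes the conditioning, and the discarded values are
  at most \<open>K / A\<close> after rescaling.\<close>

lemma moment_conditioned_above:
  assumes S: "set_pmf X \<subseteq> {..n}" and d: "d = measure_pmf.prob X {K<..}" "0 < d" and A: "0 < A"
  shows "\<bar>d * (\<integral>x. x ^ Suc s \<partial>rescaled A (conditioned_above X K)) - (\<integral>x. x ^ Suc s \<partial>rescaled A X)\<bar> \<le> (real K / A) ^ Suc s"
proof -
  have S': "set_pmf (conditioned_above X K) \<subseteq> {..n}"
    using conditioned_above_props(2)[OF d(2)[unfolded d(1)]] S by blast
  have "d * (\<integral>x. x ^ Suc s \<partial>rescaled A (conditioned_above X K)) - (\<integral>x. x ^ Suc s \<partial>rescaled A X) =
      (\<Sum>k\<le>n. - (if k \<le> K then pmf X k * (real k / A) ^ Suc s else 0))"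
    unfolding rescaled_moments(2)[OF S] rescaled_moments(2)[OF S'] sum_distrib_left sum_subtractf[symmetric]
    using d by (intro sum.cong refl) (simp add: conditioned_above_props(1)[OF d(2)[unfolded d(1)]] del: power_Suc)
  then have "\<bar>d * (\<integral>x. x ^ Suc s \<partial>rescaled A (conditioned_above X K)) - (\<integral>x. x ^ Suc s \<partial>rescaled A X)\<bar> =
      (\<Sum>k\<le>n. (if k \<le> K then pmf X k * (real k / A) ^ Suc s else 0))"
    using A by (simp add: sum_negf sum_nonneg del: power_Suc)
  also have "\<dots> \<le> (\<Sum>k\<le>n. pmf X k * (real K / A) ^ Suc s)"
  proof (rule sum_mono)
    fix k
    have "(real k / A) ^ Suc s \<le> (real K / A) ^ Suc s" if "k \<le> K"
      using that A by (intro power_mono divide_right_mono) auto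
    then show "(if k \<le> K then pmf X k * (real k / A) ^ Suc s else 0) \<le> pmf X k * (real K / A) ^ Suc s"
      using A by (auto intro!: mult_left_mono simp del: power_Suc)
  qed
  also have "\<dots> = (real K / A) ^ Suc s"
    using sum_pmf_eq_1[of "{..n}" X] S by (simp add: sum_distrib_right[symmetric] del: power_Suc)
  finally show ?thesis .
qed

context confluent_scheme
begin

lemma continuous_mass_p:
  assumes p: "p = c\<^sub>M * \<tau>\<^sub>G / (c\<^sub>M * \<tau>\<^sub>G + \<tau>\<^sub>M * c\<^sub>G * (- c) powr a)"
  shows "continuous_mass = 1 - p"
proof -
  have "c\<^sub>M * \<tau>\<^sub>G + \<tau>\<^sub>M * c\<^sub>G * (- c) powr a = total_coeff" by (simp add: total_coeff_def mult_ac)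
  moreover have "total_coeff = c\<^sub>G * (- c) powr a * \<tau>\<^sub>M + c\<^sub>M * \<tau>\<^sub>G" by (simp add: total_coeff_def mult_ac)
  ultimately show ?thesis
    unfolding p continuous_mass_def using total_coeff_neg by (simp add: field_simps)
qed

lemma pmf_core_limit:
  assumes p: "p = c\<^sub>M * \<tau>\<^sub>G / (c\<^sub>M * \<tau>\<^sub>G + \<tau>\<^sub>M * c\<^sub>G * (- c) powr a)" and \<tau>: "0 < \<tau>\<^sub>G"
    and sums: "(\<lambda>k. fps_nth G k) sums \<tau>\<^sub>G"
  shows "(\<lambda>n. pmf (core_size G H M n) k) \<longlonglongrightarrow> p * pmf (boltzmann G 1) k"
proof -
  let ?W = "fps_nth (ext_scheme_at_1 G H M)"
  have la: "0 < l * a" "l * a < l" using l a by auto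
  have "(\<lambda>n. fps_nth G k * ((fps_nth (H ^ k * M) n * real n powr (l * a + 1)) / (?W n * real n powr (l * a + 1)))) \<longlonglongrightarrow>
      fps_nth G k * ((c\<^sub>M * rGamma (- (l * a))) / (total_coeff * rGamma (- (l * a))))"
    using weight_limit_pos
    by (intro tendsto_mult tendsto_const tendsto_divide power_coeff_asymptotic[OF M la] weight_asymptotic) auto
  moreover have "fps_nth G k * ((c\<^sub>M * rGamma (- (l * a))) / (total_coeff * rGamma (- (l * a)))) = p * pmf (boltzmann G 1) k"
  proof -
    have "pmf (boltzmann G 1) k = fps_nth G k / \<tau>\<^sub>G"
      using pmf_boltzmann[OF Gnn, of 1 \<tau>\<^sub>G k] sums \<tau> by simp
    moreover have "rGamma (- (l * a)) \<noteq> 0" using weight_limit_pos by auto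
    moreover have "c\<^sub>M * \<tau>\<^sub>G + \<tau>\<^sub>M * c\<^sub>G * (- c) powr a = total_coeff" by (simp add: total_coeff_def mult_ac)
    ultimately show ?thesis unfolding p using \<tau> by simp
  qed
  moreover have "eventually (\<lambda>n. fps_nth G k * ((fps_nth (H ^ k * M) n * real n powr (l * a + 1)) / (?W n * real n powr (l * a + 1))) =
     pmf (core_size G H M n) k) sequentially"
    using eventually_weight_pos eventually_gt_at_top[of 0]
    by eventually_elim (simp add: pmf_core)
  ultimately show ?thesis using Lim_transform_eventually by fastforce
qed

theorem core_size_limit:
  assumes p: "p = c\<^sub>M * \<tau>\<^sub>G / (c\<^sub>M * \<tau>\<^sub>G + \<tau>\<^sub>M * c\<^sub>G * (- c) powr a)" and \<tau>: "0 < \<tau>\<^sub>G"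
    and sums: "(\<lambda>k. fps_nth G k) sums \<tau>\<^sub>G" and p01: "0 \<le> p" "p < 1"
  defines "A \<equiv> \<lambda>n. 1 / (- c) * real n powr l"
  shows "\<exists>Z L. is_mittag_leffler l (- a * l) L \<and>
       (\<lambda>n. total_variation (core_size G H M n) (bernoulli_mixture p (boltzmann G 1) (Z n))) \<longlonglongrightarrow> 0 \<and>
       converges_with_moments (\<lambda>n. rescaled (A n) (Z n)) L \<and>
       converges_with_moments (\<lambda>n. rescaled (A n) (core_size G H M n)) (bernoulli_thinned p L)"
proof -
  define X where "X = core_size G H M"
  define B where "B = boltzmann G 1"
  define m where "m = ml_moment l (- a * l)"
  have q: "continuous_mass = 1 - p" by (rule continuous_mass_p[OF p])
  have A_pos: "0 < A n" if "0 < n" for n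
    unfolding A_def using that c_neg by (intro mult_pos_pos divide_pos_pos) auto
  define err where "err K n = (\<Sum>k\<le>K. \<bar>pmf (X n) k - p * pmf B k\<bar>)" for K n
  \<comment> \<open>The summand \<open>K / A n\<close> forces the diagonal choice of
    \<open>K\<close> to grow more slowly than the scale, so that cutting at \<open>K n\<close> does
    not affect the limits of the moments.\<close>
  have err: "(\<lambda>n. err K n + real K / A n) \<longlonglongrightarrow> 0" for K
  proof -
    have "(\<lambda>n. err K n) \<longlonglongrightarrow> (\<Sum>k\<le>K. \<bar>p * pmf B k - p * pmf B k\<bar>)"
      unfolding err_def X_def B_def by (intro tendsto_intros pmf_core_limit p \<tau> sums)
    moreover have "(\<lambda>n. real K * (- c) * real n powr (- l)) \<longlonglongrightarrow> real K * (- c) * 0"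
      using l by (intro tendsto_intros tendsto_neg_powr filterlim_real_sequentially) auto
    moreover have "real K * (- c) * real n powr (- l) = real K / A n" for n
      unfolding A_def by (simp add: powr_minus divide_inverse)
    ultimately show ?thesis using tendsto_add by fastforce
  qed
  obtain K where K: "filterlim K at_top sequentially" and K0: "(\<lambda>n. err (K n) n + real (K n) / A n) \<longlonglongrightarrow> 0"
    using diagonal_sequence[of "\<lambda>K n. err K n + real K / A n", OF err] by blast
  have err0: "0 \<le> err k n" for k n unfolding err_def by (intro sum_nonneg) auto
  have KA0: "0 \<le> real (K n) / A n" for n unfolding A_def using c_neg by (intro divide_nonneg_nonneg mult_nonneg_nonneg) auto
  have errK: "(\<lambda>n. err (K n) n) \<longlonglongrightarrow> 0"
    by (rule tendsto_sandwich[OF _ _ tendsto_const K0]) (use err0 KA0 in auto)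
  have KA: "(\<lambda>n. real (K n) / A n) \<longlonglongrightarrow> 0"
    by (rule tendsto_sandwich[OF _ _ tendsto_const K0]) (use err0 KA0 in auto)
  define tail where "tail n = 1 - (\<Sum>k\<le>K n. pmf B k)" for n
  have tail: "tail \<longlonglongrightarrow> 0"
  proof -
    have "(\<lambda>k. pmf B k) sums 1"
      using sums_divide[OF sums, of \<tau>\<^sub>G] \<tau> pmf_boltzmann[OF Gnn, of 1 \<tau>\<^sub>G] sums by (simp add: B_def)
    then have "(\<lambda>n. \<Sum>k\<le>n. pmf B k) \<longlonglongrightarrow> 1" by (simp add: sums_def_le)
    from filterlim_compose[OF this K] have "(\<lambda>n. 1 - (\<Sum>k\<le>K n. pmf B k)) \<longlonglongrightarrow> 1 - 1"
      by (intro tendsto_diff tendsto_const)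
    then show ?thesis by (simp add: tail_def[abs_def])
  qed
  define d where "d n = measure_pmf.prob (X n) {K n<..}" for n
  define Z where "Z n = conditioned_above (X n) (K n)" for n
  have sum0: "(\<lambda>n. err (K n) n + tail n) \<longlonglongrightarrow> 0" using tendsto_add[OF errK tail] by simp
  have d_lim: "d \<longlonglongrightarrow> 1 - p"
  proof -
    have "\<bar>d n - (1 - p)\<bar> \<le> err (K n) n + tail n" for n
    proof (cases "0 < d n")
      case True
      then show ?thesis
        by (intro prob_conditioned_decomposition(1)[OF p01(1) less_imp_le[OF p01(2)] _ True]) (auto simp: d_def err_def tail_def)
    next
      \<comment> \<open>The bound is also needed where \<open>d n = 0\<close>: eventual positivity
        of \<open>d\<close> is deduced only afterwards, from its limit \<open>1 - p\<close>.\<close>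
      case False
      have "d n = 0" using False by (simp add: d_def less_le)
      then have "measure_pmf.prob (X n) {..K n} = 1"
        using measure_pmf.prob_compl[of "{K n<..}" "X n"] by (simp add: d_def Compl_eq_Diff_UNIV[symmetric] Compl_greaterThan)
      then have "1 = (\<Sum>k\<le>K n. pmf (X n) k)" by (simp add: measure_measure_pmf_finite)
      moreover have "p * (\<Sum>k\<le>K n. pmf B k) \<le> p * 1"
        using measure_pmf.prob_le_1[of B "{..K n}"] p01 by (intro mult_left_mono) (auto simp: measure_measure_pmf_finite)
      moreover have "(\<Sum>k\<le>K n. pmf (X n) k) - p * (\<Sum>k\<le>K n. pmf B k) \<le> err (K n) n"
        unfolding err_def sum_distrib_left sum_subtractf[symmetric] by (intro sum_mono) auto
      moreover have "0 \<le> tail n"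
        using measure_pmf.prob_le_1[of B "{..K n}"] by (auto simp: tail_def measure_measure_pmf_finite)
      ultimately show ?thesis using \<open>d n = 0\<close> p01 by auto
    qed
    then have "(\<lambda>n. d n - (1 - p)) \<longlonglongrightarrow> 0"
      by (intro Lim_null_comparison[OF _ sum0] always_eventually) auto
    then show ?thesis by (rule LIM_zero_cancel)
  qed
  have d_pos: "eventually (\<lambda>n. 0 < d n) sequentially"
    by (rule order_tendstoD(1)[OF d_lim]) (use p01 in simp)
  have tv: "(\<lambda>n. total_variation (X n) (bernoulli_mixture p B (Z n))) \<longlonglongrightarrow> 0"
  proof (rule tendsto_sandwich[where f = "\<lambda>_. 0"])
    show "eventually (\<lambda>n. total_variation (X n) (bernoulli_mixture p B (Z n)) \<le> 2 * (err (K n) n + tail n)) sequentially"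
      using d_pos
    proof eventually_elim
      case (elim n)
      show ?case unfolding Z_def
        by (intro prob_conditioned_decomposition(2)[OF p01(1) less_imp_le[OF p01(2)] _ elim]) (auto simp: d_def err_def tail_def)
    qed
    show "(\<lambda>n. 2 * (err (K n) n + tail n)) \<longlonglongrightarrow> 0" using tendsto_mult[OF tendsto_const sum0, of 2] by simp
  qed (auto simp: total_variation_nonneg)
  obtain L where L: "is_mittag_leffler l (- a * l) L" using mittag_leffler_exists[OF a] by blast
  have mom: "has_bochner_integral L (\<lambda>x. x ^ s) (m s)" for s
    using L unfolding is_mittag_leffler_def m_def ml_moment_def by blast
  have rdL: "real_distribution L"
    using L unfolding is_mittag_leffler_def real_distribution_def real_distribution_axioms_def by blast
  have growth: "(\<lambda>s. m s * t ^ s / fact s) \<longlonglongrightarrow> 0" for t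
    unfolding m_def by (rule ml_moment_growth[OF l a])
  have lim_X: "(\<lambda>n. \<integral>x. x ^ Suc s \<partial>rescaled (A n) (X n)) \<longlonglongrightarrow> (1 - p) * m (Suc s)" for s
    using core_moment_limit[of s] by (simp only: q A_def X_def m_def)
  have set_X: "eventually (\<lambda>n. set_pmf (X n) \<subseteq> {..n}) sequentially"
    using eventually_weight_pos by eventually_elim (simp only: X_def set_pmf_core)
  have set_Z: "eventually (\<lambda>n. set_pmf (Z n) \<subseteq> {..n}) sequentially"
    using set_X d_pos
  proof eventually_elim
    case (elim n)
    then show ?case using conditioned_above_props(2)[of "X n" "K n"] by (auto simp: Z_def d_def)
  qed
  have moment_0: "(\<integral>x. x ^ 0 \<partial>rescaled a P) = 1" for a P
    using prob_space.prob_space[OF real_distribution.axioms(1)[OF real_distribution_rescaled[of a P]]] by simp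
  have int_X: "eventually (\<lambda>n. integrable (rescaled (A n) (X n)) (\<lambda>x. x ^ s)) sequentially" for s
    using set_X by eventually_elim (rule rescaled_moments(1))
  have int_Z: "eventually (\<lambda>n. integrable (rescaled (A n) (Z n)) (\<lambda>x. x ^ s)) sequentially" for s
    using set_Z by eventually_elim (rule rescaled_moments(1))
  have lim_Z: "(\<lambda>n. \<integral>x. x ^ s \<partial>rescaled (A n) (Z n)) \<longlonglongrightarrow> m s" for s
  proof (cases s)
    case 0
    show ?thesis unfolding 0 moment_0 m_def ml_moment_0[OF l a] by simp
  next
    case (Suc t)
    have "(\<lambda>n. d n * (\<integral>x. x ^ Suc t \<partial>rescaled (A n) (Z n)) - (\<integral>x. x ^ Suc t \<partial>rescaled (A n) (X n))) \<longlonglongrightarrow> 0"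
    proof (rule Lim_null_comparison)
      show "eventually (\<lambda>n. norm (d n * (\<integral>x. x ^ Suc t \<partial>rescaled (A n) (Z n)) - (\<integral>x. x ^ Suc t \<partial>rescaled (A n) (X n))) \<le> (real (K n) / A n) ^ Suc t) sequentially"
        using set_X d_pos eventually_gt_at_top[of 0]
      proof eventually_elim
        case (elim n)
        then show ?case
          using moment_conditioned_above[OF elim(1) d_def elim(2) A_pos[OF elim(3)], of t] by (simp add: Z_def)
      qed
      show "(\<lambda>n. (real (K n) / A n) ^ Suc t) \<longlonglongrightarrow> 0" using tendsto_power[OF KA, of "Suc t"] by simp
    qed
    from tendsto_add[OF this lim_X[of t]]
    have "(\<lambda>n. d n * (\<integral>x. x ^ Suc t \<partial>rescaled (A n) (Z n))) \<longlonglongrightarrow> (1 - p) * m (Suc t)" by simp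
    from tendsto_divide[OF this d_lim]
    have "(\<lambda>n. d n * (\<integral>x. x ^ Suc t \<partial>rescaled (A n) (Z n)) / d n) \<longlonglongrightarrow> m (Suc t)" using p01 by simp
    moreover have "eventually (\<lambda>n. d n * (\<integral>x. x ^ Suc t \<partial>rescaled (A n) (Z n)) / d n = (\<integral>x. x ^ Suc t \<partial>rescaled (A n) (Z n))) sequentially"
      using d_pos by eventually_elim simp
    ultimately show ?thesis unfolding Suc by (rule Lim_transform_eventually)
  qed
  have conv_Z: "converges_with_moments (\<lambda>n. rescaled (A n) (Z n)) L"
    unfolding converges_with_moments_def
  proof (intro conjI allI int_Z)
    show "weak_conv_m (\<lambda>n. rescaled (A n) (Z n)) L"
      using mom by (intro weak_conv_m_of_moments[OF real_distribution_rescaled rdL int_Z lim_Z _ _ growth])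
        (auto simp: has_bochner_integral_iff)
    show "integrable L (\<lambda>x. x ^ s)" for s using mom by (auto simp: has_bochner_integral_iff)
    show "(\<lambda>n. \<integral>x. x ^ s \<partial>rescaled (A n) (Z n)) \<longlonglongrightarrow> (\<integral>x. x ^ s \<partial>L)" for s
      using lim_Z[of s] mom[of s] by (simp add: has_bochner_integral_iff)
  qed
  note T = bernoulli_thinned_moments[OF p01(1) less_imp_le[OF p01(2)] rdL mom]
  \<comment> \<open>The atom at \<open>0\<close> changes the moment of order \<open>0\<close> only,
    so the growth condition carries over from \<open>m\<close>.\<close>
  define m' where "m' s = p * 0 ^ s + (1 - p) * m s" for s
  have lim_X': "(\<lambda>n. \<integral>x. x ^ s \<partial>rescaled (A n) (X n)) \<longlonglongrightarrow> m' s" for s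
  proof (cases s)
    case 0
    show ?thesis unfolding 0 moment_0 m'_def m_def ml_moment_0[OF l a] by simp
  next
    case (Suc t)
    show ?thesis unfolding Suc m'_def using lim_X[of t] by simp
  qed
  have growth': "(\<lambda>s. m' s * t ^ s / fact s) \<longlonglongrightarrow> 0" for t
  proof -
    have "(\<lambda>s. (1 - p) * (m s * t ^ s / fact s)) \<longlonglongrightarrow> (1 - p) * 0"
      by (intro tendsto_intros growth)
    then have "(\<lambda>s. (1 - p) * (m s * t ^ s / fact s)) \<longlonglongrightarrow> 0" by simp
    moreover have "eventually (\<lambda>s. (1 - p) * (m s * t ^ s / fact s) = m' s * t ^ s / fact s) sequentially"
      using eventually_gt_at_top[of 0] by eventually_elim (simp add: m'_def)
    ultimately show ?thesis by (rule Lim_transform_eventually)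
  qed
  have conv_X: "converges_with_moments (\<lambda>n. rescaled (A n) (X n)) (bernoulli_thinned p L)"
    unfolding converges_with_moments_def
  proof (intro conjI allI int_X)
    show "weak_conv_m (\<lambda>n. rescaled (A n) (X n)) (bernoulli_thinned p L)"
      using T(3) by (intro weak_conv_m_of_moments[OF real_distribution_rescaled T(1) int_X lim_X' T(2) _ growth'])
        (simp add: m'_def)
    show "integrable (bernoulli_thinned p L) (\<lambda>x. x ^ s)" for s by (rule T(2))
    show "(\<lambda>n. \<integral>x. x ^ s \<partial>rescaled (A n) (X n)) \<longlonglongrightarrow> (\<integral>x. x ^ s \<partial>bernoulli_thinned p L)" for s
      using lim_X'[of s] T(3)[of s] by (simp add: m'_def)
  qed
  show ?thesis
    using L tv conv_Z conv_X unfolding X_def B_def by blast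
qed

end

section \<open>Reduction to radius of convergence one\<close>

lemma fps_sing_rescale:
  assumes f: "singular_expansion f \<rho> \<tau> c l" and l: "0 < l" and k: "k \<noteq> 0"
  shows "fps_sing (rescale k \<rho> f) (k * \<tau>) (k * c) l"
proof -
  let ?F = "cfps (rescale 1 \<rho> f)"
  note F = singular_expansion_imp_sing_type[OF f l]
  have eq: "cfps (rescale k \<rho> f) = fps_const (of_real k) * ?F"
    by (simp add: fps_eq_iff)
  have rad: "1 \<le> fps_conv_radius (cfps (rescale k \<rho> f))"
    unfolding eq using F(1) k by (simp add: fps_conv_radius_cmult_left)
  have ev: "eval_fps (cfps (rescale k \<rho> f)) z = of_real k * eval_fps ?F z" if z: "z \<in> ball 0 1" for z
  proof -
    have "ereal (norm z) < 1" using z by (simp add: one_ereal_def)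
    then have "ereal (norm z) < fps_conv_radius ?F" using F(1) less_le_trans by blast
    then show ?thesis unfolding eq by (subst eval_fps_mult) auto
  qed
  have "sing_type N l (k * c) (\<lambda>z. eval_fps (cfps (rescale k \<rho> f)) z - of_real (k * \<tau>))" for N
    using sing_type_cmult[OF F(2)[of N], of k]
    by (subst sing_type_cong[where g = "\<lambda>z. of_real k * (eval_fps ?F z - of_real \<tau>)"])
       (auto simp: ev right_diff_distrib)
  with rad show ?thesis by (simp add: fps_sing_def)
qed

lemma rescale_power_mult:
  assumes "\<rho> \<noteq> 0"
  shows "rescale k \<rho> H ^ j * rescale 1 \<rho> M = rescale (k ^ j) \<rho> (H ^ j * M)"
proof -
  have lin: "rescale b \<rho> f = fps_const b * (f oo (fps_const \<rho> * fps_X))" for b f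
    by (simp add: fps_eq_iff)
  show ?thesis
    unfolding lin by (simp add: power_mult_distrib fps_const_power fps_compose_mult_distrib fps_compose_power[symmetric] mult.assoc)
qed

text \<open>The factor \<open>\<sigma>^k\<close> from \<open>G\<close> cancels against
  \<open>\<sigma>^(-k)\<close> from the \<open>k\<close>-th power of \<open>H\<close>, and
  \<open>\<rho>^n\<close> is common to numerator and denominator.\<close>

lemma core_size_rescale:
  assumes \<rho>: "\<rho> \<noteq> 0" and \<sigma>: "\<sigma> \<noteq> 0" and H0: "fps_nth H 0 = 0"
  shows "core_size (rescale 1 \<sigma> G) (rescale (1 / \<sigma>) \<rho> H) (rescale 1 \<rho> M) n = core_size G H M n"
proof -
  let ?G = "rescale 1 \<sigma> G" and ?H = "rescale (1 / \<sigma>) \<rho> H" and ?M = "rescale 1 \<rho> M"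
  have coeff: "fps_nth (fps_nth (ext_scheme ?G ?H ?M) k) n = \<rho> ^ n * fps_nth (fps_nth (ext_scheme G H M) k) n" for k
    unfolding ext_scheme_nth rescale_power_mult[OF \<rho>] using \<sigma> by (simp add: power_one_over)
  have "fps_nth ?H 0 = 0" using H0 by simp
  then have "fps_nth (ext_scheme_at_1 ?G ?H ?M) n = \<rho> ^ n * fps_nth (ext_scheme_at_1 G H M) n"
    by (simp add: ext_scheme_at_1_nth H0 coeff sum_distrib_left)
  with coeff show ?thesis unfolding core_size_def using \<rho> by simp
qed

lemma boltzmann_rescale: "boltzmann (rescale 1 \<sigma> G) 1 = boltzmann G \<sigma>"
  by (simp add: boltzmann_def)

theorem theorem4p4:
  fixes G H M :: "real fps"
    and \<rho>\<^sub>G \<rho>\<^sub>H \<rho>\<^sub>M \<tau>\<^sub>G \<tau>\<^sub>H \<tau>\<^sub>M c\<^sub>G c\<^sub>H c\<^sub>M l\<^sub>G l\<^sub>H l\<^sub>M p \<kappa> :: real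
  assumes nonneg: "\<And>n. 0 \<le> fps_nth G n" "\<And>n. 0 \<le> fps_nth H n" "\<And>n. 0 \<le> fps_nth M n"
    and H0: "fps_nth H 0 = 0" and M0: "M \<noteq> 0"
    and sing_G: "singular_expansion G \<rho>\<^sub>G \<tau>\<^sub>G c\<^sub>G l\<^sub>G"
    and sing_H: "singular_expansion H \<rho>\<^sub>H \<tau>\<^sub>H c\<^sub>H l\<^sub>H"
    and sing_M: "singular_expansion M \<rho>\<^sub>M \<tau>\<^sub>M c\<^sub>M l\<^sub>M"
    and exponents: "0 < l\<^sub>G" "l\<^sub>G < 1" "0 < l\<^sub>H" "l\<^sub>H < 1" "0 < l\<^sub>M" "l\<^sub>M < 1"
    and critical: "\<tau>\<^sub>H = \<rho>\<^sub>G" "\<rho>\<^sub>M = \<rho>\<^sub>H"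
    and confluent: "l\<^sub>M = l\<^sub>G * l\<^sub>H"
    and p: "p = c\<^sub>M * \<tau>\<^sub>G / (c\<^sub>M * \<tau>\<^sub>G + \<tau>\<^sub>M * c\<^sub>G * (- c\<^sub>H / \<rho>\<^sub>G) powr l\<^sub>G)"
    and \<kappa>: "\<kappa> = \<tau>\<^sub>H / (- c\<^sub>H)"
  shows "0 \<le> p \<and> p \<le> 1 \<and>
    (\<exists>(Z :: nat \<Rightarrow> nat pmf) (L :: real measure).
       is_mittag_leffler l\<^sub>H (- l\<^sub>G * l\<^sub>H) L \<and>
       (\<lambda>n. total_variation (core_size G H M n)
              (bernoulli_mixture p (boltzmann G \<rho>\<^sub>G) (Z n))) \<longlonglongrightarrow> 0 \<and>
       converges_with_moments (\<lambda>n. rescaled (\<kappa> * real n powr l\<^sub>H) (Z n)) L \<and>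
       converges_with_moments (\<lambda>n. rescaled (\<kappa> * real n powr l\<^sub>H) (core_size G H M n))
         (bernoulli_thinned p L))"
proof -
  \<comment> \<open>By criticality \<open>\<tau>\<^sub>H = \<rho>\<^sub>G\<close>, the inner series
    divided by \<open>\<rho>\<^sub>G\<close> takes the value \<open>1\<close> at its singularity.
    Its leading coefficient becomes \<open>c\<^sub>H / \<rho>\<^sub>G\<close>, the quantity in the
    formula for \<open>p\<close>.\<close>
  let ?G = "rescale 1 \<rho>\<^sub>G G" and ?H = "rescale (1 / \<rho>\<^sub>G) \<rho>\<^sub>H H" and ?M = "rescale 1 \<rho>\<^sub>H M"
  have \<rho>: "0 < \<rho>\<^sub>G" "0 < \<rho>\<^sub>H" and c0: "c\<^sub>G \<noteq> 0" "c\<^sub>H \<noteq> 0" "c\<^sub>M \<noteq> 0"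
    and sums: "(\<lambda>n. fps_nth G n * \<rho>\<^sub>G ^ n) sums \<tau>\<^sub>G" "(\<lambda>n. fps_nth H n * \<rho>\<^sub>H ^ n) sums \<tau>\<^sub>H"
      "(\<lambda>n. fps_nth M n * \<rho>\<^sub>M ^ n) sums \<tau>\<^sub>M"
    using sing_G sing_H sing_M unfolding singular_expansion_def by blast+
  have G: "fps_sing ?G \<tau>\<^sub>G c\<^sub>G l\<^sub>G" using fps_sing_rescale[OF sing_G exponents(1), of 1] by simp
  have H: "fps_sing ?H 1 (c\<^sub>H / \<rho>\<^sub>G) l\<^sub>H"
    using fps_sing_rescale[OF sing_H exponents(3), of "1 / \<rho>\<^sub>G"] \<rho> critical(1) by simp
  have M: "fps_sing ?M \<tau>\<^sub>M c\<^sub>M (l\<^sub>H * l\<^sub>G)"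
    using fps_sing_rescale[OF sing_M exponents(5), of 1] by (simp add: confluent critical mult.commute)
  have nn: "0 \<le> fps_nth ?G n" "0 \<le> fps_nth ?H n" "0 \<le> fps_nth ?M n" for n
    using nonneg \<rho> by simp_all
  have la: "0 < l\<^sub>H * l\<^sub>G" "l\<^sub>H * l\<^sub>G < 1" using exponents confluent by (simp_all add: mult.commute)
  \<comment> \<open>With these signs both terms in the denominator of \<open>p\<close> are negative,
    which places \<open>p\<close> between \<open>0\<close> and \<open>1\<close>.\<close>
  have neg: "c\<^sub>G < 0" "c\<^sub>H / \<rho>\<^sub>G < 0" "c\<^sub>M < 0"
    using fps_sing_nonneg_imp_c_neg[OF G exponents(1,2) c0(1) nn(1)]
      fps_sing_nonneg_imp_c_neg[OF H exponents(3,4) _ nn(2)]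
      fps_sing_nonneg_imp_c_neg[OF M la c0(3) nn(3)] c0 \<rho> by auto
  \<comment> \<open>The zero series has infinite radius of convergence.\<close>
  have "G \<noteq> 0"
    using sing_G unfolding singular_expansion_def by auto
  have pos: "0 < \<tau>" if s: "(\<lambda>n. fps_nth f n * \<rho> ^ n) sums \<tau>" and f: "f \<noteq> 0" "\<And>n. 0 \<le> fps_nth f n" and r: "0 < \<rho>"
    for f :: "real fps" and \<rho> \<tau> :: real
  proof -
    obtain i where "fps_nth f i \<noteq> 0" using f(1) fps_nonzero_nth by blast
    then have "0 < fps_nth f i * \<rho> ^ i" using f(2)[of i] r by simp
    then have "0 < (\<Sum>n. fps_nth f n * \<rho> ^ n)"
      using f(2) r by (intro suminf_pos2[OF sums_summable[OF s]]) auto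
    then show ?thesis using sums_unique[OF s] by simp
  qed
  have \<tau>: "0 < \<tau>\<^sub>G" "0 < \<tau>\<^sub>M"
    using pos[OF sums(1) \<open>G \<noteq> 0\<close> nonneg(1) \<rho>(1)] pos[OF sums(3) M0 nonneg(3)] \<rho>(2) critical by auto
  have cp: "0 < (- (c\<^sub>H / \<rho>\<^sub>G)) powr l\<^sub>G" using c0 \<rho> by simp
  have negs: "c\<^sub>M * \<tau>\<^sub>G < 0" "\<tau>\<^sub>M * c\<^sub>G * (- (c\<^sub>H / \<rho>\<^sub>G)) powr l\<^sub>G < 0"
    using neg \<tau> cp by (auto simp: mult_less_0_iff zero_less_mult_iff)
  have p': "p = c\<^sub>M * \<tau>\<^sub>G / (c\<^sub>M * \<tau>\<^sub>G + \<tau>\<^sub>M * c\<^sub>G * (- (c\<^sub>H / \<rho>\<^sub>G)) powr l\<^sub>G)"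
    using p by simp
  have p01: "0 \<le> p" "p < 1"
    unfolding p' using negs by (auto simp: zero_le_divide_iff divide_less_eq)
  interpret confluent_scheme ?H l\<^sub>H "c\<^sub>H / \<rho>\<^sub>G" ?G ?M \<tau>\<^sub>G c\<^sub>G l\<^sub>G \<tau>\<^sub>M c\<^sub>M
  proof
    show "fps_nth ?H 0 = 0" using H0 by simp
    show "(\<lambda>n. fps_nth ?H n) sums 1"
      using sums_mult[OF sums(2), of "1 / \<rho>\<^sub>G"] \<rho> critical by (simp add: mult.assoc)
    show "c\<^sub>G * (- (c\<^sub>H / \<rho>\<^sub>G)) powr l\<^sub>G * \<tau>\<^sub>M + \<tau>\<^sub>G * c\<^sub>M < 0"
      using negs by (simp add: mult_ac)
  qed (use nn exponents G H M c0 \<rho> in auto)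
  have "1 / (- (c\<^sub>H / \<rho>\<^sub>G)) = \<kappa>" using \<kappa> critical by simp
  moreover have "(\<lambda>k. fps_nth ?G k) sums \<tau>\<^sub>G" using sums(1) by simp
  ultimately show ?thesis
    using core_size_limit[OF p' \<tau>(1) _ p01] p01 core_size_rescale[of \<rho>\<^sub>H \<rho>\<^sub>G H G M] \<rho> H0
    by (simp add: boltzmann_rescale)
qed

end
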